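(* Let $A\in\mathbb C^{n\times n}$, $B\in\mathbb C^{m\times m}$, $D\in\mathbb C^{n\times m}$ with $\operatorname{rank}(D)\le k$, and let $E,F\subset\mathbb C$ be disjoint compact sets with $\mathcal W(A)\subseteq E$ and $\mathcal W(-B)\subseteq F$. Let $X$ be the (unique) solution of $AX+XB=D$. Then for every integer $h\ge 1$, \[ \sigma_{1+kh}(X)\le K\, Z_h(E,F)\,\|X\|_2, \] where $K=1$ if $A$ and $B$ are both normal matrices, and $K=(1+\sqrt2)^2$ otherwise.
   Context: $\|\cdot\|_2$ is the spectral norm and $\sigma_j(\cdot)$ denotes the $j$-th largest singular value (taken to be $0$ if $j$ exceeds the smaller matrix dimension). The numerical range of a square matrix $M$ is $\mathcal W(M)=\{x^*Mx/x^*x : x\neq 0\}$. $\mathcal R_{h,h}$ is the set of rational functions whose numerator and denominator both have degree at most $h$. The $h$-th Zolotarev number of $E,F$ is $Z_h(E,F):=\min_{r\in\mathcal R_{h,h}} \frac{\max_{z\in E}|r(z)|}{\min_{z\in F}|r(z)|}$. *)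

theory Defs
  imports "Jordan_Normal_Form.Schur_Decomposition" "Jordan_Normal_Form.DL_Rank"
    "HOL-Library.Multiset" "HOL-Computational_Algebra.Polynomial"
begin

definition vnorm :: "complex vec \<Rightarrow> real" where
  "vnorm v = sqrt (\<Sum>i<dim_vec v. (cmod (v $ i))^2)"

(* spectral norm = operator 2-norm (0 for matrices with no columns) *)
definition spec_norm :: "complex mat \<Rightarrow> real" where
  "spec_norm X = Sup (insert 0 {vnorm (X *\<^sub>v v) | v. v \<in> carrier_vec (dim_col X) \<and> vnorm v = 1})"

definition crank :: "complex mat \<Rightarrow> nat" where
  "crank M = vec_space.rank (dim_row M) (M :: complex mat)"

definition eig_mset :: "complex mat \<Rightarrow> complex multiset" where
  "eig_mset M = Abs_multiset (\<lambda>z. order z (char_poly M))"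

definition sing_vals :: "complex mat \<Rightarrow> real list" where
  "sing_vals X = rev (sorted_list_of_multiset
      (image_mset (\<lambda>z. sqrt (Re z)) (eig_mset (mat_adjoint X * X))))"

definition sigma :: "nat \<Rightarrow> complex mat \<Rightarrow> real" where
  "sigma j X = (if 1 \<le> j \<and> j \<le> length (sing_vals X) then sing_vals X ! (j - 1) else 0)"

definition normal_mat :: "complex mat \<Rightarrow> bool" where
  "normal_mat M \<longleftrightarrow> M * mat_adjoint M = mat_adjoint M * M"

definition num_range :: "complex mat \<Rightarrow> complex set" where
  "num_range M = {(\<Sum>i<dim_row M. cnj (x $ i) * (M *\<^sub>v x) $ i) / (\<Sum>i<dim_row M. cnj (x $ i) * x $ i)
                  | x. x \<in> carrier_vec (dim_row M) \<and> x \<noteq> 0\<^sub>v (dim_row M)}"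

(* h-th Zolotarev number: infimum over r = p/q in R_{h,h} of
   max_E |r| / min_F |r| = max_E |p/q| * max_F |q/p|; rational functions with a pole
   on E or a zero on F give an infinite ratio and are excluded. *)
definition zolotarev :: "nat \<Rightarrow> complex set \<Rightarrow> complex set \<Rightarrow> real" where
  "zolotarev h E F = Inf {(SUP z\<in>E. cmod (poly p z / poly q z)) * (SUP z\<in>F. cmod (poly q z / poly p z))
      | p q :: complex poly. p \<noteq> 0 \<and> q \<noteq> 0 \<and> degree p \<le> h \<and> degree q \<le> h \<and>
          (\<forall>z\<in>E. poly q z \<noteq> 0) \<and> (\<forall>z\<in>F. poly p z \<noteq> 0)}"

end

theory Submission
  imports "HOL-Complex_Analysis.Complex_Analysis" Defs
begin

no_notation Finite_Cartesian_Product.vec_nth (infixl "$" 90)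
no_notation fps_nth (infixl "$" 75)
no_notation inner (infix "\<bullet>" 70)
hide_const (open) Finite_Cartesian_Product.vec Finite_Cartesian_Product.mat Determinants.det
hide_type (open) Finite_Cartesian_Product.vec

text \<open>Put \<open>C = - B\<close> and let \<open>r = p / q\<close> be a competitor in the Zolotarev problem. Since \<open>D\<close> has rank at
  most \<open>k\<close>, the equations \<open>D C^j w = 0\<close> for \<open>j < h\<close> are at most \<open>k h\<close> linear conditions on \<open>w\<close>; under
  them \<open>X p(C) w = p(A) X w\<close> and \<open>X q(C) w = q(A) X w\<close>, so \<open>v = p(C) w\<close> satisfies
  \<open>X v = r(A) X (1/r)(C) v\<close>. Some such \<open>v\<close> lies in the span of the first \<open>1 + k h\<close> right singular
  vectors, hence \<open>\<sigma>\<close> is at most the product of the norms of \<open>r(A)\<close>, \<open>X\<close> and \<open>(1/r)(C)\<close>. For normal matrices the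
  spectral theorem bounds the outer factors by suprema over the numerical ranges; in general this
  costs a factor \<open>1 + sqrt 2\<close> each, by the theorem of Crouzeix and Palencia.

  The latter is proved by the method of Ransford and Schwenninger: for a convex domain around the numerical
  range, the Cauchy transform \<open>g\<close> of the conjugate of \<open>f\<close> is bounded by the supremum of \<open>|f|\<close>, and
  \<open>f(A) + g(A)\<^sup>*\<close> has norm at most 2 by positivity of the double layer kernel. If \<open>K\<close> is the extremal
  constant this gives \<open>K^4 \<le> 2 K^3 + K^2\<close>. Perturbing \<open>A\<close> to a diagonalizable matrix avoids a holomorphic
  functional calculus.\<close>

section \<open>Cauchy transforms over smooth convex curves\<close>

text \<open>The delicate point is the bound for the Cauchy transform g of the conjugate of f. Inside
  the domain the double layer kernel has mass 2, and using only this would give the bound 3 for g.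
  The gain comes from the boundary: from a boundary point the curve is seen under an angle of at
  most pi, so at most mass 1 stays spread out. The remaining mass concentrates at the point and
  reproduces the conjugate of f there, of which one full copy is subtracted. Convexity acts twice,
  through the sign of the scalar kernel and through the sign of its matrix version. Both signs come
  from the same fact, that a convex domain lies on one side of each tangent. The numerical range
  itself has neither a smooth boundary nor, in general, interior points, so a smooth convex curve
  has to be built slightly outside it. Bounds for rational functions of a matrix are stated as
  comparisons of p(A) x with q(A) x. In this form they survive limits of matrices, and no rational
  function of a general matrix has to be defined.\<close>

lemma integral_periodic_shift:
  fixes h :: "real \<Rightarrow> 'a::banach"
  assumes cont: "continuous_on UNIV h" and per: "\<And>t. h (t + 1) = h t" and a: "a \<in> {0..1}"
  shows "integral {0..1} (\<lambda>t. h (a + t)) = integral {0..1} h"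
proof -
  have int: "h integrable_on {l..u}" for l u
    by (intro integrable_continuous_real continuous_on_subset[OF cont]) auto
  have "integral {0..1} (\<lambda>t. h (a + t)) = integral {a..a + 1} h"
    using integral_shift_Icc_real[of 0 1 h a] by (simp add: add.commute o_def)
  also have "\<dots> = integral {a..1} h + integral {1..a + 1} h"
    using a by (intro Henstock_Kurzweil_Integration.integral_combine[symmetric] int) auto
  also have "integral {1..a + 1} h = integral {0..a} h"
    using integral_shift_Icc_real[of 0 a h 1] by (simp add: per o_def add.commute[of 1])
  also have "integral {a..1} h + integral {0..a} h = integral {0..1} h"
    using a by (subst add.commute) (intro Henstock_Kurzweil_Integration.integral_combine int, auto)
  finally show ?thesis .
qed

lemma has_integral_cnj': "(f has_integral I) S \<Longrightarrow> ((\<lambda>x. cnj (f x)) has_integral cnj I) S"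
  using has_integral_linear[OF _ bounded_linear_cnj] by (simp add: o_def)

text \<open>Used in two ways: on short arcs, with \<open>c\<close> the limiting value of the
  density, and with \<open>c = 0\<close>, \<open>e = 1\<close> on the far arc, where only the mass
  of the kernel counts.\<close>

lemma norm_weighted_integral_diff_le:
  fixes k :: "real \<Rightarrow> real" and F :: "real \<Rightarrow> complex"
  assumes k: "continuous_on {l..u} k" and F: "continuous_on {l..u} F"
    and k0: "\<And>t. t \<in> {l..u} \<Longrightarrow> 0 \<le> k t"
    and Fe: "\<And>t. t \<in> {l..u} \<Longrightarrow> norm (F t - c) \<le> e"
  shows "norm (integral {l..u} (\<lambda>t. of_real (k t) * F t) - of_real (integral {l..u} k) * c)
    \<le> e * integral {l..u} k"
proof -
  have ik: "k integrable_on {l..u}" using k by (rule integrable_continuous_real)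
  have "((\<lambda>t. of_real (k t) * c) has_integral of_real (integral {l..u} k) * c) {l..u}"
    using has_integral_mult_left[OF has_integral_of_real[OF integrable_integral[OF ik]]] .
  moreover have "((\<lambda>t. of_real (k t) * F t) has_integral integral {l..u} (\<lambda>t. of_real (k t) * F t)) {l..u}"
    by (intro integrable_integral integrable_continuous_real continuous_intros k F)
  ultimately have hi: "((\<lambda>t. of_real (k t) * F t - of_real (k t) * c) has_integral
      integral {l..u} (\<lambda>t. of_real (k t) * F t) - of_real (integral {l..u} k) * c) {l..u}"
    by (rule has_integral_diff[rotated])
  have he: "((\<lambda>t. e * k t) has_integral e * integral {l..u} k) {l..u}"
    using has_integral_mult_right[OF integrable_integral[OF ik]] .
  have "norm (of_real (k t) * F t - of_real (k t) * c) \<le> e * k t" if "t \<in> {l..u}" for t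
  proof -
    have "norm (of_real (k t) * (F t - c)) \<le> k t * e"
      using k0[OF that] Fe[OF that] by (simp add: norm_mult mult_left_mono)
    then show ?thesis by (simp add: right_diff_distrib mult.commute)
  qed
  then show ?thesis
    using integral_norm_bound_integral[OF has_integral_integrable[OF hi] has_integral_integrable[OF he]]
    by (simp add: integral_unique[OF hi] integral_unique[OF he])
qed

lemma continuous_on_Lipschitz_real:
  fixes f :: "'a::real_normed_vector \<Rightarrow> real"
  assumes "\<And>x y. \<bar>f x - f y\<bar> \<le> c * norm (x - y)"
  shows "continuous_on S f"
proof -
  have "(f \<longlongrightarrow> f x) (at x within S)" for x
  proof (rule LIM_zero_cancel, rule tendsto_rabs_zero_cancel, rule tendsto_sandwich[of "\<lambda>_. 0"])
    show "((\<lambda>y. c * norm (y - x)) \<longlongrightarrow> 0) (at x within S)"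
      by (auto intro!: tendsto_eq_intros)
    show "((\<lambda>y. 0) \<longlongrightarrow> (0::real)) (at x within S)" by simp
  qed (auto simp: assms)
  then show ?thesis unfolding continuous_on_def by blast
qed

text \<open>\<open>P\<close> is the Minkowski functional of a convex domain around 0, not
  necessarily symmetric, and \<open>\<gamma>\<close> runs once counterclockwise along its boundary.
  \<open>supporting\<close> says that the domain lies to the left of every tangent; in this form
  convexity makes the kernels nonnegative. Describing the domain by \<open>P\<close> gives dilations
  and slightly larger domains \<open>P z < s\<close> for free.\<close>

locale convex_curve =
  fixes P :: "complex \<Rightarrow> real" and \<gamma> \<gamma>' :: "real \<Rightarrow> complex" and c\<^sub>0 c\<^sub>1 :: real
  assumes P_add: "P (x + y) \<le> P x + P y"
    and P_scale: "0 \<le> t \<Longrightarrow> P (t *\<^sub>R x) = t * P x"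
    and c\<^sub>0_pos: "0 < c\<^sub>0" and P_lower: "c\<^sub>0 * norm x \<le> P x" and P_upper: "P x \<le> c\<^sub>1 * norm x"
    and \<gamma>_deriv: "(\<gamma> has_vector_derivative \<gamma>' t) (at t)"
    and \<gamma>'_cont: "continuous_on UNIV \<gamma>'"
    and \<gamma>_periodic: "\<gamma> (t + 1) = \<gamma> t" and \<gamma>'_periodic: "\<gamma>' (t + 1) = \<gamma>' t"
    and \<gamma>'_nonzero: "\<gamma>' t \<noteq> 0"
    and P_\<gamma>: "P (\<gamma> t) = 1"
    and \<gamma>_surj: "P z = 1 \<Longrightarrow> \<exists>t\<in>{0..1}. \<gamma> t = z"
    and \<gamma>_inj: "0 < t \<Longrightarrow> t < 1 \<Longrightarrow> \<gamma> (a + t) \<noteq> \<gamma> a"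
    and supporting: "P w \<le> 1 \<Longrightarrow> 0 \<le> Im (\<gamma>' t * cnj (\<gamma> t - w))"
    and winding_0: "winding_number \<gamma> 0 = 1"
begin

section \<open>Sublevel sets of the gauge and the Cauchy formula\<close>

lemma P_0 [simp]: "P 0 = 0"
  using P_scale[of 0 0] by simp

lemma P_nonneg: "0 \<le> P x"
  by (rule order_trans[OF _ P_lower]) (use c\<^sub>0_pos in auto)

lemma P_diff: "\<bar>P x - P y\<bar> \<le> c\<^sub>1 * norm (x - y)"
  using P_add[of "x - y" y] P_add[of "y - x" x] P_upper[of "x - y"] P_upper[of "y - x"]
  by (simp add: norm_minus_commute abs_le_iff)

lemma P_continuous: "continuous_on S P"
  using P_diff by (rule continuous_on_Lipschitz_real)

lemma convex_sublevel: "convex {z. P z < s}"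
proof (rule convexI)
  fix x y and u v :: real
  assume *: "x \<in> {z. P z < s}" "y \<in> {z. P z < s}" "0 \<le> u" "0 \<le> v" "u + v = 1"
  have "P (u *\<^sub>R x + v *\<^sub>R y) \<le> u * P x + v * P y"
    using P_add[of "u *\<^sub>R x" "v *\<^sub>R y"] * by (simp add: P_scale)
  also have "\<dots> < s"
    using * convex_bound_lt[of "P x" s "P y" u v] by simp
  finally show "u *\<^sub>R x + v *\<^sub>R y \<in> {z. P z < s}" by simp
qed

lemma open_sublevel: "open {z. P z < s}"
  by (intro open_Collect_less P_continuous continuous_intros)

lemma closed_sublevel: "closed {z. P z \<le> s}"
  by (intro closed_Collect_le P_continuous continuous_intros)

lemma bounded_sublevel: "bounded {z. P z \<le> s}"
proof (rule boundedI)
  fix z assume "z \<in> {z. P z \<le> s}"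
  then show "norm z \<le> s / c\<^sub>0"
    using P_lower[of z] c\<^sub>0_pos by (simp add: field_simps)
qed

lemma compact_sublevel: "compact {z. P z \<le> s}"
  using closed_sublevel bounded_sublevel compact_eq_bounded_closed by blast

lemma \<gamma>_cont: "continuous_on S \<gamma>"
  by (intro continuous_at_imp_continuous_on ballI has_vector_derivative_continuous[OF \<gamma>_deriv])

lemma \<gamma>'_cont': "continuous_on S \<gamma>'"
  using \<gamma>'_cont continuous_on_subset by blast

lemma valid_path: "valid_path \<gamma>"
  unfolding valid_path_def
  by (rule C1_differentiable_imp_piecewise)
     (auto simp: C1_differentiable_on_def intro!: exI[of _ \<gamma>'] \<gamma>_deriv \<gamma>'_cont')

lemma closed_path: "pathfinish \<gamma> = pathstart \<gamma>"
  using \<gamma>_periodic[of 0] by (simp add: pathfinish_def pathstart_def)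

lemma path_image: "path_image \<gamma> = {z. P z = 1}"
  using \<gamma>_surj P_\<gamma> by (force simp: path_image_def)

lemma winding_number_inside:
  assumes "P z < 1" shows "winding_number \<gamma> z = 1"
proof -
  have "winding_number \<gamma> z = winding_number \<gamma> 0"
  proof (rule winding_number_eq)
    show "connected {z. P z < 1}" by (rule convex_connected[OF convex_sublevel])
  qed (use assms in \<open>auto simp: path_image valid_path_imp_path valid_path closed_path\<close>)
  then show ?thesis using winding_0 by simp
qed

lemma contour_iff:
  "(f has_contour_integral I) \<gamma> \<longleftrightarrow> ((\<lambda>t. f (\<gamma> t) * \<gamma>' t) has_integral I) {0..1}"
  unfolding has_contour_integral using vector_derivative_at[OF \<gamma>_deriv] by simp

lemma Cauchy_formula:
  assumes s: "1 < s" and f: "f holomorphic_on {z. P z < s}" and z: "P z < 1"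
  shows "((\<lambda>t. f (\<gamma> t) * (\<gamma>' t / (\<gamma> t - z))) has_integral 2 * pi * \<i> * f z) {0..1}"
proof -
  have "((\<lambda>w. f w / (w - z)) has_contour_integral 2 * pi * \<i> * winding_number \<gamma> z * f z) \<gamma>"
  proof (rule Cauchy_integral_formula_convex_simple[OF convex_sublevel f])
    show "z \<in> interior {z. P z < s}"
      using z s interior_open[OF open_sublevel] by auto
  qed (use s z in \<open>auto simp: valid_path path_image closed_path\<close>)
  then show ?thesis
    by (simp add: contour_iff winding_number_inside[OF z] field_simps)
qed

lemma \<gamma>_neq: "P z < 1 \<Longrightarrow> \<gamma> t \<noteq> z"
  using P_\<gamma>[of t] by auto

text \<open>The double layer kernel: the angular speed of \<open>\<gamma> t\<close> as seen from
  \<open>z\<close>, divided by pi. A full turn has mass 2, half a turn has mass 1.\<close>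

definition kern :: "complex \<Rightarrow> real \<Rightarrow> real" where
  "kern z t = Im (\<gamma>' t / (\<gamma> t - z)) / pi"

lemma Im_divide_nonneg:
  assumes "0 \<le> Im (x * cnj y)" shows "0 \<le> Im (x / y)"
proof -
  have "x / y = x * cnj y / of_real ((norm y)\<^sup>2)" by (subst complex_div_cnj) simp
  then show ?thesis using assms by (simp add: Im_divide_of_real)
qed

lemma kern_nonneg: "P z \<le> 1 \<Longrightarrow> 0 \<le> kern z t"
  unfolding kern_def using supporting[of z t] by (simp add: Im_divide_nonneg)

lemma kern_periodic: "kern z (t + 1) = kern z t"
  by (simp add: kern_def \<gamma>_periodic \<gamma>'_periodic)

lemma kern_cont: "(\<And>t. t \<in> S \<Longrightarrow> \<gamma> t \<noteq> z) \<Longrightarrow> continuous_on S (kern z)"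
  unfolding kern_def by (intro continuous_intros \<gamma>_cont \<gamma>'_cont') auto

lemma kern_mass: "P z < 1 \<Longrightarrow> (kern z has_integral 2) {0..1}"
  using has_integral_divide[OF has_integral_Im[OF Cauchy_formula[of 2 "\<lambda>_. 1" z]], of pi]
  by (simp add: kern_def[abs_def])

definition conj_cauchy :: "(complex \<Rightarrow> complex) \<Rightarrow> complex \<Rightarrow> complex" where
  "conj_cauchy f z = integral {0..1} (\<lambda>t. cnj (f (\<gamma> t)) * (\<gamma>' t / (\<gamma> t - z))) / (2 * pi * \<i>)"

context
  fixes f :: "complex \<Rightarrow> complex" and s :: real
  assumes s: "1 < s" and f: "f holomorphic_on {z. P z < s}"
begin

lemma f\<gamma>_cont: "continuous_on S (\<lambda>t. f (\<gamma> t))"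
  by (rule continuous_on_compose2[OF holomorphic_on_imp_continuous_on[OF f] \<gamma>_cont])
     (use s P_\<gamma> in auto)

lemma conj_cauchy_integral:
  assumes z: "P z < 1"
  shows "((\<lambda>t. cnj (f (\<gamma> t)) * (\<gamma>' t / (\<gamma> t - z))) has_integral 2 * pi * \<i> * conj_cauchy f z) {0..1}"
proof -
  have "(\<lambda>t. cnj (f (\<gamma> t)) * (\<gamma>' t / (\<gamma> t - z))) integrable_on {0..1}"
    by (intro integrable_continuous_real continuous_intros f\<gamma>_cont \<gamma>_cont \<gamma>'_cont')
       (use \<gamma>_neq[OF z] in auto)
  from integrable_integral[OF this] show ?thesis
    by (simp add: conj_cauchy_def)
qed

lemma conj_cauchy_holomorphic: "conj_cauchy f holomorphic_on {z. P z < 1}"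
proof -
  obtain B where B: "\<And>t. t \<in> {0..1} \<Longrightarrow> norm (\<gamma>' t) \<le> B"
    using compact_imp_bounded[OF compact_continuous_image[OF \<gamma>'_cont'[of "{0..1}"]]]
    unfolding bounded_iff by blast
  \<comment> \<open>Differentiating a Cauchy integral needs only a density that is continuous on the
    curve; the conjugate of \<open>f\<close> is one, although it is not holomorphic.\<close>
  have "(\<lambda>z. 2 * pi * \<i> * conj_cauchy f z) field_differentiable at z" if z: "P z < 1" for z
    unfolding field_differentiable_def
  proof (rule exI, rule Cauchy_next_derivative(2)
      [of \<gamma> "cnj \<circ> f" B "{z. P z < 1}" 1])
    show "continuous_on (path_image \<gamma>) (cnj \<circ> f)"
      by (intro continuous_on_compose continuous_on_cnj continuous_on_id
          continuous_on_subset[OF holomorphic_on_imp_continuous_on[OF f]])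
         (use s path_image in \<open>auto intro!: continuous_intros\<close>)
    show "norm (vector_derivative \<gamma> (at t)) \<le> B" if "t \<in> {0..1}" for t
      using B[OF that] vector_derivative_at[OF \<gamma>_deriv] by simp
    show "((\<lambda>u. (cnj \<circ> f) u / (u - w) ^ 1) has_contour_integral 2 * pi * \<i> * conj_cauchy f w) \<gamma>"
      if "w \<in> {z. P z < 1} - path_image \<gamma>" for w
      using conj_cauchy_integral[of w] that by (simp add: contour_iff)
  qed (use z open_sublevel path_image valid_path in auto)
  then have "(\<lambda>z. 2 * pi * \<i> * conj_cauchy f z) holomorphic_on {z. P z < 1}"
    by (simp add: holomorphic_on_def field_differentiable_at_within)
  from holomorphic_on_mult[OF holomorphic_on_const[of "1 / (2 * pi * \<i>)"] this] show ?thesis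
    by simp
qed

text \<open>Subtracting the conjugated Cauchy formula for \<open>f\<close> leaves only the imaginary
  part of the Cauchy kernel. Adding the conjugate of \<open>f\<close> thus trades a complex kernel
  for a nonnegative one of known mass.\<close>

lemma conj_cauchy_eq:
  assumes z: "P z < 1"
  shows "((\<lambda>t. of_real (kern z t) * cnj (f (\<gamma> t))) has_integral conj_cauchy f z + cnj (f z)) {0..1}"
proof -
  let ?q = "\<lambda>t. \<gamma>' t / (\<gamma> t - z)"
  have "((\<lambda>t. cnj (f (\<gamma> t)) * ?q t - cnj (f (\<gamma> t) * ?q t)) has_integral
     2 * pi * \<i> * conj_cauchy f z - cnj (2 * pi * \<i> * f z)) {0..1}"
    by (intro has_integral_diff conj_cauchy_integral z has_integral_cnj' Cauchy_formula[OF s f])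
  from has_integral_divide[OF this, of "2 * pi * \<i>"]
  have "((\<lambda>t. (cnj (f (\<gamma> t)) * ?q t - cnj (f (\<gamma> t) * ?q t)) / (2 * pi * \<i>)) has_integral
      conj_cauchy f z + cnj (f z)) {0..1}"
    by (simp add: add_divide_distrib)
  moreover have "(cnj (f (\<gamma> t)) * ?q t - cnj (f (\<gamma> t) * ?q t)) / (2 * pi * \<i>)
      = of_real (kern z t) * cnj (f (\<gamma> t))" for t
  proof -
    have "cnj (f (\<gamma> t)) * ?q t - cnj (f (\<gamma> t) * ?q t) = cnj (f (\<gamma> t)) * (?q t - cnj (?q t))"
      by (simp add: algebra_simps)
    then show ?thesis
      unfolding complex_diff_cnj kern_def by (simp add: field_simps)
  qed
  ultimately show ?thesis by simp
qed

section \<open>Boundary behaviour of the conjugate Cauchy transform\<close>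

lemma far_mass_at_boundary:
  assumes \<eta>: "0 < \<eta>" "\<eta> < 1/2"
  shows "integral {\<eta>..1 - \<eta>} (\<lambda>t. kern (\<gamma> a) (a + t)) \<le> 1"
proof -
  \<comment> \<open>Chords from \<open>\<gamma> a\<close> lie to the left of the tangent
    \<open>\<gamma>' a\<close>. Divided by the tangent and rotated by \<open>- \<i>\<close> they
    fall into the closed right half plane, where the principal logarithm is a primitive of the
    Cauchy kernel and its imaginary part varies by at most pi.\<close>
  define L where "L = (\<lambda>t. Ln (- \<i> * ((\<gamma> (a + t) - \<gamma> a) / \<gamma>' a)))"
  have ne: "\<gamma> (a + t) \<noteq> \<gamma> a" if "t \<in> {\<eta>..1 - \<eta>}" for t
    using \<gamma>_inj[of t a] that \<eta> by auto
  have Re0: "0 \<le> Re (- \<i> * ((\<gamma> (a + t) - \<gamma> a) / \<gamma>' a))" for t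
  proof -
    have "0 \<le> Im (cnj (\<gamma>' a * cnj (\<gamma> (a + t) - \<gamma> a)) )"
      using supporting[of "\<gamma> (a + t)" a] P_\<gamma> by (simp add: algebra_simps)
    then have "0 \<le> Im ((\<gamma> (a + t) - \<gamma> a) * cnj (\<gamma>' a))"
      by (simp add: mult.commute)
    from Im_divide_nonneg[OF this] have "0 \<le> Im ((\<gamma> (a + t) - \<gamma> a) / \<gamma>' a)" .
    moreover have "Re (- \<i> * x) = Im x" for x by simp
    ultimately show ?thesis by metis
  qed
  have Im_L: "\<bar>Im (L t)\<bar> \<le> pi / 2" if "t \<in> {\<eta>..1 - \<eta>}" for t
    unfolding L_def by (subst Re_Ln_pos_le) (use ne[OF that] \<gamma>'_nonzero Re0 in auto)
  have deriv: "(L has_vector_derivative \<gamma>' (a + t) / (\<gamma> (a + t) - \<gamma> a)) (at t within {\<eta>..1 - \<eta>})"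
    if t: "t \<in> {\<eta>..1 - \<eta>}" for t
  proof -
    have 1: "((\<lambda>t. - \<i> * ((\<gamma> (a + t) - \<gamma> a) / \<gamma>' a)) has_vector_derivative
        - \<i> * (\<gamma>' (a + t) / \<gamma>' a)) (at t)"
      by (auto intro!: derivative_eq_intros vector_diff_chain_at[of "\<lambda>t. a + t" 1 t \<gamma>, unfolded o_def, simplified] \<gamma>_deriv)
    have nz: "- \<i> * ((\<gamma> (a + t) - \<gamma> a) / \<gamma>' a) \<notin> \<real>\<^sub>\<le>\<^sub>0"
      using Re0[of t] ne[OF t] \<gamma>'_nonzero[of a] complex_nonpos_Reals_iff
      by (metis complex_eqI complex_i_mult_minus divide_eq_0_iff eq_iff_diff_eq_0 mult_eq_0_iff
          neg_equal_0_iff_equal complex_i_not_zero order_antisym zero_complex.sel)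
    have "(Ln has_field_derivative inverse (- \<i> * ((\<gamma> (a + t) - \<gamma> a) / \<gamma>' a)))
        (at (- \<i> * ((\<gamma> (a + t) - \<gamma> a) / \<gamma>' a)))"
      by (rule has_field_derivative_Ln[OF nz])
    from field_vector_diff_chain_at[OF 1 this]
    have "(L has_vector_derivative - \<i> * (\<gamma>' (a + t) / \<gamma>' a) *
        inverse (- \<i> * ((\<gamma> (a + t) - \<gamma> a) / \<gamma>' a))) (at t)"
      by (simp only: L_def o_def)
    moreover have "- \<i> * (u / v) * inverse (- \<i> * (x / v)) = u / x" if "x \<noteq> 0" "v \<noteq> 0" for u v x :: complex
      using that by (simp add: field_simps)
    ultimately show ?thesis
      using ne[OF t] \<gamma>'_nonzero[of a] by (auto intro: has_vector_derivative_at_within)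
  qed
  have "((\<lambda>t. \<gamma>' (a + t) / (\<gamma> (a + t) - \<gamma> a)) has_integral L (1 - \<eta>) - L \<eta>) {\<eta>..1 - \<eta>}"
    using \<eta> by (intro fundamental_theorem_of_calculus deriv) auto
  from integral_unique[OF has_integral_divide[OF has_integral_Im[OF this], of pi]]
  have "integral {\<eta>..1 - \<eta>} (\<lambda>t. kern (\<gamma> a) (a + t)) = (Im (L (1 - \<eta>)) - Im (L \<eta>)) / pi"
    by (simp only: kern_def minus_complex.sel)
  also have "\<dots> \<le> 1"
    using Im_L[of \<eta>] Im_L[of "1 - \<eta>"] \<eta> by (simp add: field_simps abs_le_iff)
  finally show ?thesis .
qed

text \<open>The arc \<open>{\<eta>..1 - \<eta>}\<close> keeps a positive distance from
  \<open>\<gamma> a\<close>, so the kernel has no singularity there.\<close>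

lemma far_mass_tendsto:
  assumes \<eta>: "0 < \<eta>" "\<eta> < 1/2"
  shows "((\<lambda>z. integral {\<eta>..1 - \<eta>} (\<lambda>t. kern z (a + t))) \<longlongrightarrow>
     integral {\<eta>..1 - \<eta>} (\<lambda>t. kern (\<gamma> a) (a + t))) (at (\<gamma> a))"
proof -
  have "compact ((\<lambda>t. \<gamma> (a + t)) ` {\<eta>..1 - \<eta>})"
    by (intro compact_continuous_image continuous_on_compose2[OF \<gamma>_cont[of UNIV]]) (auto intro!: continuous_intros)
  then have op: "open (- (\<lambda>t. \<gamma> (a + t)) ` {\<eta>..1 - \<eta>})"
    by (simp add: compact_imp_closed open_Compl)
  have mem: "\<gamma> a \<in> - (\<lambda>t. \<gamma> (a + t)) ` {\<eta>..1 - \<eta>}"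
  proof (rule ComplI, elim imageE)
    fix t assume "\<gamma> a = \<gamma> (a + t)" "t \<in> {\<eta>..1 - \<eta>}"
    then show False using \<gamma>_inj[of t a] \<eta> by simp
  qed
  let ?U = "- (\<lambda>t. \<gamma> (a + t)) ` {\<eta>..1 - \<eta>}"
  have "continuous_on (?U \<times> cbox \<eta> (1 - \<eta>)) (\<lambda>(z, t). kern z (a + t))"
    unfolding kern_def split_beta
    by (intro continuous_intros continuous_on_compose2[OF \<gamma>_cont[of UNIV]]
        continuous_on_compose2[OF \<gamma>'_cont]) auto
  from integral_continuous_on_param[OF this]
  have "continuous_on ?U (\<lambda>z. integral {\<eta>..1 - \<eta>} (\<lambda>t. kern z (a + t)))" by simp
  then show ?thesis
    using op mem continuous_on_eq_continuous_at isCont_def by blast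
qed

text \<open>Let N and Far be the masses of the kernel near and far from \<open>z0\<close>, so that N
  + Far = 2. Near \<open>z0\<close> the density is almost the conjugate of \<open>f z0\<close>. The
  transform is therefore almost the far integral plus (N - 1) times that value, of modulus at most
  Far + |1 - Far|. This is 1 as long as Far is at most 1, which holds in the limit.\<close>

lemma conj_cauchy_boundary:
  assumes f1: "\<And>z. P z \<le> 1 \<Longrightarrow> norm (f z) \<le> 1" and z0: "P z0 = 1" and e: "0 < e"
  shows "\<forall>\<^sub>F z in at z0 within {z. P z < 1}. norm (conj_cauchy f z) \<le> 1 + e"
proof -
  obtain a where a: "a \<in> {0..1}" "\<gamma> a = z0" using \<gamma>_surj[OF z0] by blast
  \<comment> \<open>Five portions of error: two because the near mass is at most 2, two from
    \<open>Far z + \<bar>1 - Far z\<bar>\<close> when \<open>Far z < 1 + d\<close>, and one from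
    replacing \<open>f z\<close> by \<open>f z0\<close>.\<close>
  define d where "d = e / 5"
  have d: "0 < d" using e by (simp add: d_def)
  have "continuous (at 0) (\<lambda>t. f (\<gamma> (a + t)))"
    using continuous_on_compose2[OF f\<gamma>_cont[of UNIV], of UNIV "\<lambda>t. a + t"]
    by (auto simp: continuous_on_eq_continuous_at intro!: continuous_intros)
  then have "\<exists>\<eta>>0. \<forall>t. dist t 0 < \<eta> \<longrightarrow> dist (f (\<gamma> (a + t))) (f (\<gamma> (a + 0))) < d"
    unfolding continuous_at_eps_delta using d by blast
  then obtain \<eta>' where \<eta>': "\<eta>' > 0" "\<And>t. \<bar>t\<bar> < \<eta>' \<Longrightarrow> norm (f (\<gamma> (a + t)) - f z0) < d"
    using a by (auto simp: dist_norm)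
  define \<eta> where "\<eta> = min (\<eta>' / 2) (1 / 4)"
  have \<eta>: "0 < \<eta>" "\<eta> < 1/2" "\<eta> < \<eta>'" using \<eta>'(1) by (auto simp: \<eta>_def)
  have near1: "norm (f (\<gamma> (a + t)) - f z0) \<le> d" if "t \<in> {0..\<eta>}" for t
    using \<eta>'(2)[of t] \<eta> that by auto
  \<comment> \<open>By periodicity the end of the parameter interval is the arc just before
    \<open>\<gamma> a\<close>.\<close>
  have near2: "norm (f (\<gamma> (a + t)) - f z0) \<le> d" if "t \<in> {1 - \<eta>..1}" for t
    using \<eta>'(2)[of "t - 1"] \<gamma>_periodic[of "a + t - 1"] \<eta> that by (auto simp: algebra_simps)
  define Far where "Far = (\<lambda>z. integral {\<eta>..1 - \<eta>} (\<lambda>t. kern z (a + t)))"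
  have "(Far \<longlongrightarrow> Far z0) (at z0)" "Far z0 \<le> 1"
    using far_mass_tendsto[OF \<eta>(1,2), of a] far_mass_at_boundary[OF \<eta>(1,2), of a] a
    by (simp_all add: Far_def)
  then have "\<forall>\<^sub>F z in at z0. Far z < 1 + d"
    using d by (intro order_tendstoD(2)[where a = "1 + d"]) auto
  then have ev1: "\<forall>\<^sub>F z in at z0 within {z. P z < 1}. Far z < 1 + d"
    by (rule filter_leD[OF at_le, rotated]) auto
  have "isCont f z0"
    using holomorphic_on_imp_continuous_on[OF f] s z0 open_sublevel
    by (simp add: continuous_on_eq_continuous_at)
  then have "(f \<longlongrightarrow> f z0) (at z0 within {z. P z < 1})"
    unfolding isCont_def by (rule tendsto_within_subset) simp
  then have ev2: "\<forall>\<^sub>F z in at z0 within {z. P z < 1}. norm (f z - f z0) < d"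
    using d by (simp add: tendsto_iff dist_norm)
  have ev3: "\<forall>\<^sub>F z in at z0 within {z. P z < 1}. P z < 1"
    by (simp add: eventually_at_filter)
  show ?thesis
    using ev1 ev2 ev3
  proof eventually_elim
    case (elim z)
    let ?k = "\<lambda>t. kern z (a + t)" and ?F = "\<lambda>t. cnj (f (\<gamma> (a + t)))"
    let ?I = "\<lambda>l u. integral {l..u} (\<lambda>t. of_real (?k t) * ?F t)"
    let ?N = "\<lambda>l u. integral {l..u} ?k"
    have kc: "continuous_on S ?k" for S
      by (rule continuous_on_compose2[OF kern_cont[of UNIV z]])
         (use \<gamma>_neq[OF elim(3)] in \<open>auto intro!: continuous_intros\<close>)
    have Fc: "continuous_on S ?F" for S
      by (intro continuous_on_cnj continuous_on_compose2[OF f\<gamma>_cont[of UNIV]]) (auto intro!: continuous_intros)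
    have k0: "0 \<le> ?k t" for t using kern_nonneg elim(3) by simp
    have ci: "g integrable_on {l..u}" if "\<And>S. continuous_on S g" for g :: "real \<Rightarrow> 'b::banach" and l u
      by (rule integrable_continuous_real[OF that])
    have split: "integral {0..1} g = integral {0..\<eta>} g + integral {\<eta>..1 - \<eta>} g + integral {1 - \<eta>..1} g"
      if "\<And>S. continuous_on S g" for g :: "real \<Rightarrow> 'b::banach"
      using \<eta> Henstock_Kurzweil_Integration.integral_combine[OF _ _ ci[OF that], of 0 "1 - \<eta>" 1]
        Henstock_Kurzweil_Integration.integral_combine[OF _ _ ci[OF that], of 0 "\<eta>" "1 - \<eta>"] by simp
    have "?N 0 1 = integral {0..1} (kern z)"
      using a by (intro integral_periodic_shift kern_cont kern_periodic \<gamma>_neq elim) auto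
    also have "\<dots> = 2" using kern_mass[OF elim(3)] by (rule integral_unique)
    finally have N: "?N 0 \<eta> + Far z + ?N (1 - \<eta>) 1 = 2"
      using split[OF kc] by (simp add: Far_def)
    have "?I 0 1 = integral {0..1} (\<lambda>t. of_real (kern z t) * cnj (f (\<gamma> t)))"
      using a by (intro integral_periodic_shift[where h = "\<lambda>t. of_real (kern z t) * cnj (f (\<gamma> t))"]
          continuous_intros kern_cont \<gamma>_neq elim f\<gamma>_cont) (auto simp: kern_periodic \<gamma>_periodic)
    also have "\<dots> = conj_cauchy f z + cnj (f z)"
      using conj_cauchy_eq[OF elim(3)] by (rule integral_unique)
    finally have I: "conj_cauchy f z = ?I 0 \<eta> + ?I \<eta> (1 - \<eta>) + ?I (1 - \<eta>) 1 - cnj (f z)"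
      using split[of "\<lambda>t. of_real (?k t) * ?F t"] kc Fc by (auto simp: continuous_intros)
    let ?c = "cnj (f z0)"
    have b1: "norm (?I 0 \<eta> - of_real (?N 0 \<eta>) * ?c) \<le> d * ?N 0 \<eta>"
      using near1 by (intro norm_weighted_integral_diff_le kc Fc k0) (simp flip: complex_cnj_diff)
    have b3: "norm (?I (1 - \<eta>) 1 - of_real (?N (1 - \<eta>) 1) * ?c) \<le> d * ?N (1 - \<eta>) 1"
      using near2 by (intro norm_weighted_integral_diff_le kc Fc k0) (simp flip: complex_cnj_diff)
    have b2: "norm (?I \<eta> (1 - \<eta>)) \<le> Far z"
      using norm_weighted_integral_diff_le[of \<eta> "1 - \<eta>" ?k ?F 0 1] kc Fc k0 f1 P_\<gamma> by (simp add: Far_def)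
    have N0: "0 \<le> ?N 0 \<eta>" "0 \<le> ?N (1 - \<eta>) 1" "0 \<le> Far z"
      unfolding Far_def by (intro integral_nonneg ci kc k0)+
    have b4: "norm (of_real (1 - Far z) * ?c) \<le> \<bar>1 - Far z\<bar>"
      using f1[of z0] z0 by (simp add: norm_mult mult_left_le del: of_real_diff)
    have b5: "norm (?c - cnj (f z)) \<le> d"
      using elim(2) by (simp flip: complex_cnj_diff add: norm_minus_commute)
    have "conj_cauchy f z = (?I 0 \<eta> - of_real (?N 0 \<eta>) * ?c) + ?I \<eta> (1 - \<eta>)
       + (?I (1 - \<eta>) 1 - of_real (?N (1 - \<eta>) 1) * ?c)
       + of_real (?N 0 \<eta> + ?N (1 - \<eta>) 1 - 1) * ?c + (?c - cnj (f z))"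
      unfolding I by (simp add: algebra_simps)
    moreover have "?N 0 \<eta> + ?N (1 - \<eta>) 1 - 1 = 1 - Far z" using N by simp
    ultimately have "norm (conj_cauchy f z) \<le> d * ?N 0 \<eta> + Far z + d * ?N (1 - \<eta>) 1 + \<bar>1 - Far z\<bar> + d"
      using b1 b2 b3 b4 b5 by (metis (no_types, lifting) add_mono norm_triangle_le)
    also have "\<dots> \<le> d * (?N 0 \<eta> + ?N (1 - \<eta>) 1) + (1 + 2 * d) + d"
      using elim(1) d by (simp add: algebra_simps abs_if)
    also have "d * (?N 0 \<eta> + ?N (1 - \<eta>) 1) \<le> d * 2"
      using N N0 d by (intro mult_left_mono) auto
    finally show ?case by (simp add: d_def)
  qed
qed

text \<open>The boundary estimate is local, and it is made uniform by compactness: bad points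
  approaching the curve would accumulate at a boundary point and contradict
  \<open>conj_cauchy_boundary\<close>. The maximum modulus principle is applied on a smaller
  sublevel set, so no continuous extension to the curve is involved.\<close>

theorem norm_conj_cauchy_le:
  assumes f1: "\<And>z. P z \<le> 1 \<Longrightarrow> norm (f z) \<le> 1" and z: "P z < 1"
  shows "norm (conj_cauchy f z) \<le> 1"
proof (rule field_le_epsilon)
  fix e :: real assume e: "0 < e"
  have "\<exists>\<sigma><1. \<forall>z. \<sigma> \<le> P z \<and> P z < 1 \<longrightarrow> norm (conj_cauchy f z) \<le> 1 + e"
  proof (rule ccontr)
    assume contra: "\<not> ?thesis"
    have "\<exists>z. 1 - 1 / real (Suc n) \<le> P z \<and> P z < 1 \<and> \<not> norm (conj_cauchy f z) \<le> 1 + e" for n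
      using contra by (metis diff_gt_0_iff_gt diff_diff_eq2 diff_add_cancel of_nat_0_less_iff zero_less_Suc
          zero_less_divide_1_iff add_diff_cancel_left')
    then obtain w where w: "\<And>n. 1 - 1 / real (Suc n) \<le> P (w n)" "\<And>n. P (w n) < 1"
      "\<And>n. \<not> norm (conj_cauchy f (w n)) \<le> 1 + e"
      by metis
    obtain z0 r where z0: "P z0 \<le> 1" and r: "strict_mono r" "(w \<circ> r) \<longlonglongrightarrow> z0"
      using compact_sublevel[of 1] w(2) unfolding compact_def
      by (metis (mono_tags, lifting) less_imp_le mem_Collect_eq)
    have lim: "(\<lambda>n. P (w (r n))) \<longlonglongrightarrow> P z0"
      using continuous_on_tendsto_compose[OF P_continuous[of UNIV] r(2)] by (simp add: o_def)
    have "(\<lambda>n. 1 - 1 / real (Suc n)) \<longlonglongrightarrow> 1 - 0"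
      by (intro tendsto_intros LIMSEQ_Suc[OF lim_1_over_n])
    then have "(\<lambda>n. 1 - 1 / real (Suc (r n))) \<longlonglongrightarrow> 1"
      using LIMSEQ_subseq_LIMSEQ[OF _ r(1)] by (fastforce simp: o_def)
    then have "1 \<le> P z0" by (rule LIMSEQ_le[OF _ lim]) (use w(1) in auto)
    with z0 have Pz0: "P z0 = 1" by simp
    have "w (r n) \<in> {z. P z < 1} \<and> w (r n) \<noteq> z0" for n
      using w(2)[of "r n"] Pz0 by auto
    then have "filterlim (w \<circ> r) (at z0 within {z. P z < 1}) sequentially"
      unfolding filterlim_at using r(2) by simp
    from eventually_compose_filterlim[OF conj_cauchy_boundary[OF f1 Pz0 e] this]
    show False using w(3) by (simp add: eventually_False_sequentially)
  qed
  then obtain \<sigma> where \<sigma>: "\<sigma> < 1" "\<And>z. \<sigma> \<le> P z \<Longrightarrow> P z < 1 \<Longrightarrow> norm (conj_cauchy f z) \<le> 1 + e"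
    by blast
  \<comment> \<open>The level set \<open>P = \<tau>\<close> lies in the strip where the bound is
    known, and it still encloses \<open>z\<close>.\<close>
  define \<tau> where "\<tau> = max \<sigma> (P z)"
  have \<tau>: "\<tau> < 1" "\<sigma> \<le> \<tau>" "P z \<le> \<tau>" using \<sigma>(1) z by (auto simp: \<tau>_def)
  let ?S = "{z. P z \<le> \<tau>}"
  show "norm (conj_cauchy f z) \<le> 1 + e"
  proof (rule maximum_modulus_frontier[of "conj_cauchy f" ?S])
    show "conj_cauchy f holomorphic_on interior ?S"
      by (rule holomorphic_on_subset[OF conj_cauchy_holomorphic])
         (use \<tau>(1) interior_subset[of ?S] in auto)
    have "closure ?S = ?S" using closed_sublevel by simp
    moreover have "?S \<subseteq> {z. P z < 1}" using \<tau>(1) by auto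
    ultimately show "continuous_on (closure ?S) (conj_cauchy f)"
      by (metis holomorphic_on_imp_continuous_on holomorphic_on_subset conj_cauchy_holomorphic)
    fix x assume "x \<in> frontier ?S"
    moreover have "{z. P z < \<tau>} \<subseteq> interior ?S"
      by (rule interior_maximal) (auto simp: open_sublevel)
    ultimately have "P x \<le> \<tau>" "\<not> P x < \<tau>"
      using closed_sublevel by (auto simp: frontier_def)
    then have "P x = \<tau>" by simp
    then show "norm (conj_cauchy f x) \<le> 1 + e" using \<sigma>(2) \<tau> by auto
  qed (use \<tau> bounded_sublevel in auto)
qed

text \<open>For a diagonalizable matrix with eigenvalues \<open>\<mu> i\<close>,
  \<open>R c t\<close> is a form of the resolvent at \<open>\<gamma> t\<close> times
  \<open>\<gamma>' t\<close>, and \<open>pos\<close> is positivity of the double layer kernel tested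
  on two vectors. Multiplying by \<open>f\<close>, of modulus at most 1 on the curve, and
  integrating gives the conclusion: the left side by the Cauchy integrals of \<open>f\<close> and of
  its conjugate, the right side by the Cauchy formula for the constant 1.\<close>

lemma norm_form_sum_le:
  fixes \<mu> :: "'i \<Rightarrow> complex" and cxx cxy cyx cyy :: "'i \<Rightarrow> complex" and I :: "'i set"
  defines "R \<equiv> \<lambda>c t. \<Sum>i\<in>I. c i * (\<gamma>' t / (\<gamma> t - \<mu> i))"
  assumes \<mu>: "\<And>i. i \<in> I \<Longrightarrow> P (\<mu> i) < 1"
    and f1: "\<And>z. P z \<le> 1 \<Longrightarrow> norm (f z) \<le> 1"
    and pos: "\<And>t. norm (R cxy t - cnj (R cyx t)) \<le> Im (R cxx t) + Im (R cyy t)"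
  shows "norm ((\<Sum>i\<in>I. f (\<mu> i) * cxy i) + cnj (\<Sum>i\<in>I. conj_cauchy f (\<mu> i) * cyx i))
    \<le> Re (\<Sum>i\<in>I. cxx i) + Re (\<Sum>i\<in>I. cyy i)"
proof (cases "finite I")
  case True
  have int1: "((\<lambda>t. h (\<gamma> t) * R c t) has_integral (\<Sum>i\<in>I. c i * (2 * pi * \<i> * h (\<mu> i)))) {0..1}"
    if "1 < s'" "h holomorphic_on {z. P z < s'}" for h c s'
  proof -
    have "((\<lambda>t. \<Sum>i\<in>I. c i * (h (\<gamma> t) * (\<gamma>' t / (\<gamma> t - \<mu> i)))) has_integral
      (\<Sum>i\<in>I. c i * (2 * pi * \<i> * h (\<mu> i)))) {0..1}"
      by (intro has_integral_sum has_integral_mult_right Cauchy_formula[OF that] \<mu> True)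
    then show ?thesis by (simp add: R_def sum_distrib_left mult_ac)
  qed
  have int2: "((\<lambda>t. cnj (f (\<gamma> t)) * R cyx t) has_integral
      (\<Sum>i\<in>I. cyx i * (2 * pi * \<i> * conj_cauchy f (\<mu> i)))) {0..1}"
  proof -
    have "((\<lambda>t. \<Sum>i\<in>I. cyx i * (cnj (f (\<gamma> t)) * (\<gamma>' t / (\<gamma> t - \<mu> i)))) has_integral
      (\<Sum>i\<in>I. cyx i * (2 * pi * \<i> * conj_cauchy f (\<mu> i)))) {0..1}"
      by (intro has_integral_sum has_integral_mult_right conj_cauchy_integral \<mu> True)
    then show ?thesis by (simp add: R_def sum_distrib_left mult_ac)
  qed
  let ?L = "(\<Sum>i\<in>I. f (\<mu> i) * cxy i) + cnj (\<Sum>i\<in>I. conj_cauchy f (\<mu> i) * cyx i)"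
  have "((\<lambda>t. f (\<gamma> t) * R cxy t - cnj (cnj (f (\<gamma> t)) * R cyx t)) has_integral
     (\<Sum>i\<in>I. cxy i * (2 * pi * \<i> * f (\<mu> i))) - cnj (\<Sum>i\<in>I. cyx i * (2 * pi * \<i> * conj_cauchy f (\<mu> i)))) {0..1}"
    by (intro has_integral_diff has_integral_cnj' int1[OF s f] int2)
  moreover have "(\<Sum>i\<in>I. cxy i * (2 * pi * \<i> * f (\<mu> i))) - cnj (\<Sum>i\<in>I. cyx i * (2 * pi * \<i> * conj_cauchy f (\<mu> i)))
     = 2 * pi * \<i> * ?L"
    by (simp add: sum_distrib_left distrib_left mult_ac flip: sum_negf)
  ultimately have i1: "((\<lambda>t. f (\<gamma> t) * (R cxy t - cnj (R cyx t))) has_integral 2 * pi * \<i> * ?L) {0..1}"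
    by (simp add: algebra_simps)
  have i2: "((\<lambda>t. Im (R c t)) has_integral 2 * pi * Re (\<Sum>i\<in>I. c i)) {0..1}" for c
    using has_integral_Im[OF int1[of 2 "\<lambda>_. 1" c]] by (simp add: sum_distrib_left mult_ac)
  have i3: "((\<lambda>t. Im (R cxx t) + Im (R cyy t)) has_integral
      2 * pi * Re (\<Sum>i\<in>I. cxx i) + 2 * pi * Re (\<Sum>i\<in>I. cyy i)) {0..1}"
    by (intro has_integral_add i2)
  have "norm (f (\<gamma> t) * (R cxy t - cnj (R cyx t))) \<le> Im (R cxx t) + Im (R cyy t)" for t
    using mult_mono[OF f1[of "\<gamma> t"] pos[of t]] P_\<gamma>[of t] by (simp add: norm_mult)
  then have "norm (2 * pi * \<i> * ?L) \<le> 2 * pi * Re (\<Sum>i\<in>I. cxx i) + 2 * pi * Re (\<Sum>i\<in>I. cyy i)"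
    using integral_norm_bound_integral[OF has_integral_integrable[OF i1] has_integral_integrable[OF i3]]
    unfolding integral_unique[OF i1] integral_unique[OF i3] by blast
  moreover have norm_2pi: "norm (2 * pi * \<i> * x) = 2 * pi * norm x" for x :: complex
    by (simp add: norm_mult)
  ultimately have "2 * pi * norm ?L \<le> 2 * pi * (Re (\<Sum>i\<in>I. cxx i) + Re (\<Sum>i\<in>I. cyy i))"
    unfolding norm_2pi by (simp only: distrib_left)
  then show ?thesis by (subst (asm) mult_le_cancel_left_pos) auto
qed simp

end

end

section \<open>Smooth convex curves around a convex set\<close>

lemma deriv_nonneg_right:
  fixes F :: "real \<Rightarrow> real"
  assumes "(F has_real_derivative D) (at 0)" "F 0 = 0" "\<forall>\<^sub>F h in at_right 0. 0 \<le> F h"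
  shows "0 \<le> D"
proof (rule ccontr)
  assume "\<not> 0 \<le> D"
  then obtain d where d: "0 < d" "\<And>h. 0 < h \<Longrightarrow> h < d \<Longrightarrow> F h < 0"
    using has_real_derivative_neg_dec_right[OF assms(1)] assms(2) by auto
  then have "\<forall>\<^sub>F h in at_right 0. F h < 0"
    by (auto simp: eventually_at_right_field)
  with assms(3) have "\<forall>\<^sub>F h in at_right (0::real). False"
    by eventually_elim auto
  then show False by simp
qed

lemma convex_curve_polar:
  fixes P :: "complex \<Rightarrow> real" and u' :: "real \<Rightarrow> real"
  defines "u \<equiv> \<lambda>\<theta>. P (cis \<theta>)"
  defines "\<gamma> \<equiv> \<lambda>t. cis (2 * pi * t) / of_real (u (2 * pi * t))"
  defines "\<gamma>' \<equiv> \<lambda>t. 2 * pi * cis (2 * pi * t) * (\<i> * of_real (u (2 * pi * t)) - of_real (u' (2 * pi * t)))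
    / of_real ((u (2 * pi * t))\<^sup>2)"
  assumes P_add: "\<And>x y. P (x + y) \<le> P x + P y"
    and P_scale: "\<And>t x. 0 \<le> t \<Longrightarrow> P (t *\<^sub>R x) = t * P x"
    and c0: "0 < c0" and P_lower: "\<And>x. c0 * norm x \<le> P x" and P_upper: "\<And>x. P x \<le> c1 * norm x"
    and u': "\<And>\<theta>. (u has_real_derivative u' \<theta>) (at \<theta>)" and u'_cont: "continuous_on UNIV u'"
    and u'_per: "\<And>\<theta>. u' (\<theta> + 2 * pi) = u' \<theta>"
  shows "convex_curve P \<gamma> \<gamma>' c0 c1"
proof -
  have u_pos: "0 < u \<theta>" for \<theta>
    using P_lower[of "cis \<theta>"] c0 by (simp add: u_def)
  have u_per: "u (\<theta> + 2 * pi) = u \<theta>" for \<theta>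
    by (simp add: u_def flip: cis_mult)
  have P_0: "P 0 = 0" using P_scale[of 0 0] by simp
  have u_cont: "continuous_on S u" for S
    by (intro continuous_at_imp_continuous_on ballI DERIV_isCont[OF u'])
  \<comment> \<open>In the frame rotated by \<open>\<theta>\<close>, the pair
    \<open>u \<theta>\<close>, \<open>u' \<theta>\<close> is the derivative of \<open>P\<close> at
    \<open>cis \<theta>\<close>; a sublinear function dominates its derivative. The supporting line
    property reduces to this.\<close>
  have tangent: "\<alpha> * u \<theta> + \<beta> * u' \<theta> \<le> P (Complex \<alpha> \<beta> * cis \<theta>)" for \<alpha> \<beta> \<theta>
  proof (cases "\<beta> = 0")
    case True
    have "\<alpha> * u \<theta> \<le> P (\<alpha> *\<^sub>R cis \<theta>)"
    proof (cases "0 \<le> \<alpha>")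
      case True then show ?thesis by (simp add: P_scale u_def)
    next
      case False
      have "P 0 \<le> P (\<alpha> *\<^sub>R cis \<theta>) + P ((- \<alpha>) *\<^sub>R cis \<theta>)"
        using P_add[of "\<alpha> *\<^sub>R cis \<theta>" "(- \<alpha>) *\<^sub>R cis \<theta>"] by simp
      then show ?thesis using False P_0 P_scale[of "- \<alpha>" "cis \<theta>"] by (simp add: u_def)
    qed
    then show ?thesis using True by (simp add: scaleR_conv_of_real complex_of_real_def)
  next
    case False
    define w where "w = Complex \<alpha> \<beta> * cis \<theta>"
    \<comment> \<open>For small \<open>k > 0\<close> the point
      \<open>cis (\<theta> + \<beta> * k)\<close> is a combination of \<open>w\<close> and
      \<open>cis \<theta>\<close> with nonnegative coefficients, and \<open>F\<close> is the slack
      in sublinearity. It vanishes at 0, so its derivative there is nonnegative.\<close>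
    define F where "F = (\<lambda>k. sin (\<beta> * k) / \<beta> * P w + (cos (\<beta> * k) - \<alpha> * sin (\<beta> * k) / \<beta>) * u \<theta> - u (\<theta> + \<beta> * k))"
    have "0 \<le> P w - \<alpha> * u \<theta> - \<beta> * u' \<theta>"
    proof (rule deriv_nonneg_right[of F])
      have "((\<lambda>k. u (\<theta> + \<beta> * k)) has_real_derivative u' (\<theta> + \<beta> * 0) * \<beta>) (at 0)"
        by (rule DERIV_chain2[OF u']) (auto intro!: derivative_eq_intros)
      then show "(F has_real_derivative P w - \<alpha> * u \<theta> - \<beta> * u' \<theta>) (at 0)"
        unfolding F_def using False by (auto intro!: derivative_eq_intros)
      show "F 0 = 0" by (simp add: F_def)
      have "((\<lambda>k. sin (\<beta> * k) / (\<beta> * k)) \<longlongrightarrow> 1) (at_right 0)"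
      proof -
        have "((\<lambda>x::real. sin x / x) \<longlongrightarrow> 1) (at 0)"
          using DERIV_sin[of 0] by (simp add: has_field_derivative_iff)
        moreover have "filterlim (\<lambda>k. \<beta> * k) (at 0) (at_right 0)"
          unfolding filterlim_at using False
          by (auto intro!: tendsto_eq_intros simp: eventually_at_filter)
        ultimately show ?thesis by (rule filterlim_compose)
      qed
      then have "\<forall>\<^sub>F k in at_right 0. 0 < sin (\<beta> * k) / (\<beta> * k)"
        by (rule order_tendstoD(1)) simp
      moreover have "((\<lambda>k. cos (\<beta> * k) - \<alpha> * sin (\<beta> * k) / \<beta>) \<longlongrightarrow> 1) (at_right 0)"
        using False by (auto intro!: tendsto_eq_intros)
      then have "\<forall>\<^sub>F k in at_right 0. 0 < cos (\<beta> * k) - \<alpha> * sin (\<beta> * k) / \<beta>"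
        by (rule order_tendstoD(1)) simp
      ultimately show "\<forall>\<^sub>F k in at_right 0. 0 \<le> F k"
        using eventually_at_right_less[of "0::real"]
      proof eventually_elim
        case (elim k)
        have "sin (\<beta> * k) / \<beta> = sin (\<beta> * k) / (\<beta> * k) * k" using elim(3) by simp
        then have "0 < sin (\<beta> * k) / \<beta>"
          using mult_pos_pos[OF elim(1,3)] by simp
        with elim have pos: "0 \<le> sin (\<beta> * k) / \<beta>" "0 \<le> cos (\<beta> * k) - \<alpha> * sin (\<beta> * k) / \<beta>"
          by simp_all
        have "cis (\<theta> + \<beta> * k) = (sin (\<beta> * k) / \<beta>) *\<^sub>R w + (cos (\<beta> * k) - \<alpha> * sin (\<beta> * k) / \<beta>) *\<^sub>R cis \<theta>"
          using False by (simp add: w_def complex_eq_iff cos_add sin_add field_simps)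
        then have "u (\<theta> + \<beta> * k) \<le> sin (\<beta> * k) / \<beta> * P w + (cos (\<beta> * k) - \<alpha> * sin (\<beta> * k) / \<beta>) * P (cis \<theta>)"
          using P_add P_scale pos by (metis u_def)
        then show ?case by (simp add: F_def u_def)
      qed
    qed
    then show ?thesis by (simp add: w_def)
  qed
  have u2: "((\<lambda>t. u (2 * pi * t)) has_real_derivative u' (2 * pi * t) * (2 * pi)) (at t)" for t
    by (rule DERIV_chain2[OF u']) (auto intro!: derivative_eq_intros)
  have deriv: "(\<gamma> has_vector_derivative \<gamma>' t) (at t)" for t
  proof -
    have "((\<lambda>t. inverse (u (2 * pi * t))) has_real_derivative
        - (inverse (u (2 * pi * t)) * (u' (2 * pi * t) * (2 * pi)) * inverse (u (2 * pi * t)))) (at t)"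
      using u_pos[of "2 * pi * t"] by (intro DERIV_inverse' u2) auto
    then have "((\<lambda>t. inverse (u (2 * pi * t))) has_real_derivative
        - (u' (2 * pi * t) * (2 * pi)) / (u (2 * pi * t))\<^sup>2) (at t)"
      by (simp add: power2_eq_square divide_inverse mult_ac)
    then have 1: "((\<lambda>t. complex_of_real (inverse (u (2 * pi * t)))) has_vector_derivative
        of_real (- (u' (2 * pi * t) * (2 * pi)) / (u (2 * pi * t))\<^sup>2)) (at t)"
      by (rule has_vector_derivative_of_real)
    have 2: "((\<lambda>t. cis (2 * pi * t)) has_vector_derivative 2 * pi * \<i> * cis (2 * pi * t)) (at t)"
    proof -
      have "((\<lambda>t. exp (\<i> * (2 * pi * of_real t))) has_vector_derivative 2 * pi * \<i> * exp (\<i> * (2 * pi * of_real t))) (at t)"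
        by (auto intro!: derivative_eq_intros has_vector_derivative_real_field simp: mult_ac)
      then show ?thesis by (simp add: cis_conv_exp)
    qed
    have "\<gamma> = (\<lambda>t. cis (2 * pi * t) * complex_of_real (inverse (u (2 * pi * t))))"
      by (simp add: \<gamma>_def fun_eq_iff divide_inverse)
    moreover have "cis (2 * pi * t) * of_real (- (u' (2 * pi * t) * (2 * pi)) / (u (2 * pi * t))\<^sup>2) +
        2 * pi * \<i> * cis (2 * pi * t) * complex_of_real (inverse (u (2 * pi * t))) = \<gamma>' t"
      using u_pos[of "2 * pi * t"] by (simp add: \<gamma>'_def field_simps power2_eq_square)
    ultimately show ?thesis using has_vector_derivative_mult[OF 2 1] by simp
  qed
  have ne: "complex_of_real (u x) \<noteq> 0" for x using u_pos[of x] by simp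
  have P_\<gamma>: "P (\<gamma> t) = 1" for t
  proof -
    have "\<gamma> t = (1 / u (2 * pi * t)) *\<^sub>R cis (2 * pi * t)"
      by (simp add: \<gamma>_def scaleR_conv_of_real)
    then show ?thesis
      using u_pos[of "2 * pi * t"] P_scale[of "1 / u (2 * pi * t)"] by (simp add: u_def)
  qed
  have \<gamma>'_cont: "continuous_on S \<gamma>'" for S
    unfolding \<gamma>'_def
    by (intro continuous_intros continuous_on_compose2[OF u_cont] continuous_on_compose2[OF u'_cont] continuous_on_cis)
       (use ne in auto)
  have per: "\<gamma> (t + 1) = \<gamma> t" "\<gamma>' (t + 1) = \<gamma>' t" for t
    using u_per[of "2 * pi * t"] u'_per[of "2 * pi * t"]
    by (simp_all add: \<gamma>_def \<gamma>'_def distrib_left flip: cis_mult)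
  have \<gamma>_surj: "\<exists>t\<in>{0..1}. \<gamma> t = z" if z: "P z = 1" for z
  proof (rule bexI)
    have zz: "z = norm z *\<^sub>R cis (Arg2pi z)"
      using Arg2pi_eq[of z] by (simp add: cis_conv_exp scaleR_conv_of_real)
    then have "norm z * u (Arg2pi z) = 1"
      using P_scale[of "norm z" "cis (Arg2pi z)"] z by (simp add: u_def)
    then have "norm z = 1 / u (Arg2pi z)"
      using u_pos[of "Arg2pi z"] by (simp add: field_simps)
    then show "\<gamma> (Arg2pi z / (2 * pi)) = z"
      using zz by (simp add: \<gamma>_def scaleR_conv_of_real)
    show "Arg2pi z / (2 * pi) \<in> {0..1}"
      using Arg2pi[of z] by (simp add: field_simps)
  qed
  have valid: "valid_path \<gamma>"
    unfolding valid_path_def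
    by (rule C1_differentiable_imp_piecewise)
       (auto simp: C1_differentiable_on_def intro!: exI[of _ \<gamma>'] deriv \<gamma>'_cont)
  show ?thesis
  proof
    show "\<gamma> (a + t) \<noteq> \<gamma> a" if t: "0 < t" "t < 1" for a t
    proof
      assume eq: "\<gamma> (a + t) = \<gamma> a"
      then have "norm (\<gamma> (a + t)) = norm (\<gamma> a)" by simp
      then have "u (2 * pi * (a + t)) = u (2 * pi * a)"
        using u_pos by (simp add: \<gamma>_def norm_divide less_imp_le)
      with eq have "cis (2 * pi * (a + t)) = cis (2 * pi * a)"
        using ne by (simp add: \<gamma>_def)
      then have "cis (2 * pi * a) * cis (2 * pi * t) = cis (2 * pi * a) * 1"
        by (simp add: cis_mult distrib_left)
      then have "cis (2 * pi * t) = 1" by (subst (asm) mult_left_cancel) auto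
      then have "cos (2 * pi * t) = 1" by (metis cis.sel(1) one_complex.sel(1))
      then obtain n :: int where "2 * pi * t = of_int n * 2 * pi"
        using cos_one_2pi_int by auto
      then have "t = of_int n" by simp
      then show False using t by simp
    qed
    show "0 \<le> Im (\<gamma>' t * cnj (\<gamma> t - w))" if w: "P w \<le> 1" for t w
    proof -
      define \<theta> where "\<theta> = 2 * pi * t"
      \<comment> \<open>In the rotated frame the claim becomes \<open>tangent\<close> for the real
        and imaginary parts of \<open>z\<close>.\<close>
      define z where "z = w / cis \<theta>"
      have wz: "w = z * cis \<theta>" by (simp add: z_def)
      have "\<gamma> t = cis \<theta> * (1 / u \<theta>)"
        "\<gamma>' t = (2 * pi / (u \<theta>)\<^sup>2) * cis \<theta> * (\<i> * u \<theta> - u' \<theta>)"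
        by (simp_all add: \<gamma>_def \<gamma>'_def flip: \<theta>_def)
      moreover have "a * c * x * cnj (c * of_real r - y * c) = a * (x * (of_real r - cnj y)) * (c * cnj c)"
        for a c x y :: complex and r :: real
        by (simp add: algebra_simps)
      ultimately have "\<gamma>' t * cnj (\<gamma> t - w) = (2 * pi / (u \<theta>)\<^sup>2) *
          ((\<i> * u \<theta> - u' \<theta>) * (of_real (1 / u \<theta>) - cnj z)) * (cis \<theta> * cnj (cis \<theta>))"
        unfolding wz by metis
      also have "cis \<theta> * cnj (cis \<theta>) = 1" by (simp add: cis_cnj cis_mult)
      finally have "Im (\<gamma>' t * cnj (\<gamma> t - w)) = 2 * pi / (u \<theta>)\<^sup>2 *
          Im ((\<i> * u \<theta> - u' \<theta>) * (of_real (1 / u \<theta>) - cnj z))"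
        by (simp only: mult_1_right times_complex.sel Im_complex_of_real Re_complex_of_real mult_zero_left add_0_right)
      also have "Im ((\<i> * u \<theta> - u' \<theta>) * (of_real (1 / u \<theta>) - cnj z)) = 1 - (Re z * u \<theta> + Im z * u' \<theta>)"
        using u_pos[of \<theta>] by (simp add: field_simps)
      finally have "Im (\<gamma>' t * cnj (\<gamma> t - w)) = 2 * pi / (u \<theta>)\<^sup>2 * (1 - (Re z * u \<theta> + Im z * u' \<theta>))" .
      moreover have "Re z * u \<theta> + Im z * u' \<theta> \<le> 1"
        using tangent[of "Re z" \<theta> "Im z"] w wz by simp
      ultimately show ?thesis by simp
    qed
    show "winding_number \<gamma> 0 = 1"
    proof -
      \<comment> \<open>A continuous logarithm of \<open>\<gamma>\<close>. As \<open>u\<close> is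
        periodic, only the argument contributes to its increment over one period.\<close>
      define L where "L = (\<lambda>t. 2 * pi * \<i> * of_real t - of_real (ln (u (2 * pi * t))) :: complex)"
      have 1: "((\<lambda>t. complex_of_real (ln (u (2 * pi * t)))) has_vector_derivative
          of_real (1 / u (2 * pi * t) * (u' (2 * pi * t) * (2 * pi)))) (at t)" for t
        by (intro has_vector_derivative_of_real DERIV_chain2[OF DERIV_ln_divide] u2 u_pos)
      have "(L has_vector_derivative \<gamma>' t / \<gamma> t) (at t)" for t
      proof -
        have "(L has_vector_derivative 2 * pi * \<i> - of_real (1 / u (2 * pi * t) * (u' (2 * pi * t) * (2 * pi)))) (at t)"
          unfolding L_def
          by (rule has_vector_derivative_diff[OF _ 1])
             (auto intro!: derivative_eq_intros has_vector_derivative_real_field)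
        moreover have "2 * pi * \<i> - of_real (1 / u (2 * pi * t) * (u' (2 * pi * t) * (2 * pi))) = \<gamma>' t / \<gamma> t"
          using ne[of "2 * pi * t"] by (simp add: \<gamma>_def \<gamma>'_def field_simps power2_eq_square)
        ultimately show ?thesis by simp
      qed
      then have "((\<lambda>t. \<gamma>' t / \<gamma> t) has_integral L 1 - L 0) {0..1}"
        by (intro fundamental_theorem_of_calculus) (auto intro: has_vector_derivative_at_within)
      moreover have "L 1 - L 0 = 2 * pi * \<i>" using u_per[of 0] by (simp add: L_def)
      ultimately have "((\<lambda>w. 1 / (w - 0)) has_contour_integral 2 * pi * \<i>) \<gamma>"
        unfolding has_contour_integral using vector_derivative_at[OF deriv] by simp
      moreover have "0 \<notin> path_image \<gamma>"
        using P_\<gamma> P_0 unfolding path_image_def by (metis imageE zero_neq_one)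
      ultimately show ?thesis
        by (simp add: winding_number_valid_path[OF valid] contour_integral_unique del: diff_zero)
    qed
    show "\<gamma>' t \<noteq> 0" for t
    proof -
      have "\<i> * complex_of_real (u (2 * pi * t)) - of_real (u' (2 * pi * t)) \<noteq> 0"
        using u_pos[of "2 * pi * t"] by (simp add: complex_eq_iff)
      then show ?thesis using ne by (simp add: \<gamma>'_def)
    qed
  qed (use P_add P_scale c0 P_lower P_upper deriv \<gamma>'_cont per P_\<gamma> \<gamma>_surj in auto)
qed

section \<open>Gauges of convex neighbourhoods and their smoothing\<close>

lemma exists_gauge:
  fixes G :: "complex set"
  assumes G: "convex G" and d: "0 < d" "cball 0 d \<subseteq> G" and R: "0 < R" "G \<subseteq> cball 0 R"
  obtains p where "\<And>x y. p (x + y) \<le> p x + p y" "\<And>t x. 0 \<le> t \<Longrightarrow> p (t *\<^sub>R x) = t * p x"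
    "\<And>x. norm x / R \<le> p x" "\<And>x. p x \<le> norm x / d"
    "\<And>x t. 0 < t \<Longrightarrow> p x < t \<Longrightarrow> x /\<^sub>R t \<in> G" "\<And>x t. 0 < t \<Longrightarrow> x /\<^sub>R t \<in> G \<Longrightarrow> p x \<le> t"
proof -
  \<comment> \<open>\<open>G\<close> may be neither open nor closed, so the infimum of
    \<open>T x\<close> need not belong to \<open>T x\<close>. Hence membership in \<open>G\<close>
    is compared with \<open>p\<close> by \<open><\<close> in one direction and by
    \<open>\<le>\<close> in the other.\<close>
  define T where "T = (\<lambda>x. {t. 0 < t \<and> x /\<^sub>R t \<in> G})"
  define p where "p = (\<lambda>x. Inf (T x))"
  have bdd: "bdd_below (T x)" for x
    by (rule bdd_belowI[of _ 0]) (auto simp: T_def)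
  have big: "t \<in> T x" if "0 < t" "norm x / d \<le> t" for x t
  proof -
    have "norm (x /\<^sub>R t) \<le> d" using that d(1) by (simp add: field_simps)
    then have "x /\<^sub>R t \<in> G" using d(2) by auto
    then show ?thesis using that by (simp add: T_def)
  qed
  have pos1: "0 < norm x / d + e" if "0 < e" for x e
    using that d(1) by (intro add_nonneg_pos) auto
  have ne: "T x \<noteq> {}" for x
    using big[OF pos1[of 1 x]] by force
  have G0: "0 \<in> G" using d by auto
  have up: "t \<in> T x" if "t' \<in> T x" "t' \<le> t" for x t t'
  proof -
    have pos: "0 < t'" "0 < t" using that by (auto simp: T_def)
    have "(1 - t' / t) *\<^sub>R 0 + (t' / t) *\<^sub>R (x /\<^sub>R t') \<in> G"
    proof (rule convexD[OF G G0])
      show "x /\<^sub>R t' \<in> G" using that(1) by (simp add: T_def)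
      show "0 \<le> 1 - t' / t" "0 \<le> t' / t" using pos that(2) by simp_all
    qed simp
    moreover have "(t' / t) *\<^sub>R (x /\<^sub>R t') = x /\<^sub>R t" using pos by (simp add: divide_inverse)
    ultimately have "x /\<^sub>R t \<in> G" by (simp only: scaleR_zero_right add_0_left)
    then show ?thesis using pos by (simp add: T_def)
  qed
  have le: "p x \<le> t" if "0 < t" "x /\<^sub>R t \<in> G" for x t
    unfolding p_def using that by (intro cInf_lower bdd) (auto simp: T_def)
  have lt: "t \<in> T x" if "p x < t" for x t
  proof -
    have "\<exists>t'\<in>T x. t' < t"
      using that unfolding p_def cInf_less_iff[OF ne[of x] bdd[of x]] .
    then obtain t' where "t' \<in> T x" "t' < t" ..
    then show ?thesis using up[of t' x t] by simp
  qed
  have inG: "x /\<^sub>R t \<in> G" if "0 < t" "p x < t" for x t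
    using lt[OF that(2)] by (simp add: T_def)
  have lower: "norm x / R \<le> p x" for x
    unfolding p_def
  proof (rule cInf_greatest[OF ne])
    fix t assume "t \<in> T x"
    then have "norm (x /\<^sub>R t) \<le> R" "0 < t" using R(2) by (auto simp: T_def)
    then show "norm x / R \<le> t" using R(1) by (simp add: field_simps)
  qed
  have upper: "p x \<le> norm x / d" for x
  proof (rule field_le_epsilon)
    fix e :: real assume "0 < e"
    then show "p x \<le> norm x / d + e"
      unfolding p_def by (intro cInf_lower bdd big pos1) auto
  qed
  have sub: "p (x + y) \<le> p x + p y" for x y
  proof (rule field_le_epsilon)
    fix e :: real assume e: "0 < e"
    obtain s t where s: "s = p x + e / 2" "s \<in> T x" and t: "t = p y + e / 2" "t \<in> T y"
      using lt[of x "p x + e / 2"] lt[of y "p y + e / 2"] e by simp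
    have pos: "0 < s" "0 < t" using s t by (auto simp: T_def)
    have "s / (s + t) + t / (s + t) = 1" unfolding add_divide_distrib[symmetric] using pos by simp
    then have "(s / (s + t)) *\<^sub>R (x /\<^sub>R s) + (t / (s + t)) *\<^sub>R (y /\<^sub>R t) \<in> G"
      using s t pos by (intro convexD[OF G]) (auto simp: T_def)
    moreover have "(s / (s + t)) *\<^sub>R (x /\<^sub>R s) + (t / (s + t)) *\<^sub>R (y /\<^sub>R t) = (x + y) /\<^sub>R (s + t)"
    proof -
      have "s / (s + t) * inverse s = inverse (s + t)" "t / (s + t) * inverse t = inverse (s + t)"
        using pos by (simp_all add: divide_simps)
      then show ?thesis by (simp only: scaleR_scaleR scaleR_add_right)
    qed
    ultimately have "p (x + y) \<le> s + t" using pos by (intro le) auto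
    then have "p (x + y) \<le> p x + p y + (e / 2 + e / 2)" unfolding s(1) t(1) by linarith
    then show "p (x + y) \<le> p x + p y + e" by simp
  qed
  have le_scale: "p (t *\<^sub>R x) \<le> t * p x" if t: "0 < t" for t x
  proof (rule field_le_epsilon)
    fix e :: real assume e: "0 < e"
    have "p x + e / t \<in> T x" using e t by (intro lt) simp
    then obtain q where q: "q = p x + e / t" "0 < q" "x /\<^sub>R q \<in> G" by (simp add: T_def)
    have eq: "(t *\<^sub>R x) /\<^sub>R (t * q) = x /\<^sub>R q" using t by (simp add: field_simps)
    have "p (t *\<^sub>R x) \<le> t * q"
    proof (rule le)
      show "(t *\<^sub>R x) /\<^sub>R (t * q) \<in> G" unfolding eq by (rule q(3))
    qed (use t q in simp)
    then have "p (t *\<^sub>R x) \<le> t * (p x + e / t)" unfolding q(1) .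
    also have "t * (p x + e / t) = t * p x + e" using t by (simp add: distrib_left)
    finally show "p (t *\<^sub>R x) \<le> t * p x + e" .
  qed
  have p_nonneg: "0 \<le> p x" for x
    unfolding p_def by (rule cInf_greatest[OF ne]) (auto simp: T_def)
  have scale: "p (t *\<^sub>R x) = t * p x" if "0 \<le> t" for t x
  proof (cases "t = 0")
    case True then show ?thesis using upper[of 0] p_nonneg[of 0] by simp
  next
    case False
    then have "0 < t" using that by simp
    then have "t * p x \<le> p (t *\<^sub>R x)"
      using le_scale[of "inverse t" "t *\<^sub>R x"] by (simp add: field_simps)
    then show ?thesis using le_scale[OF \<open>0 < t\<close>, of x] by simp
  qed
  show ?thesis
    by (rule that[of p]) (fact sub scale lower upper inG le)+
qed

text \<open>Averaging a gauge over small rotations keeps it sublinear and makes its restriction to the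
  unit circle continuously differentiable, whatever the shape of the unit ball.\<close>

lemma exists_smooth_gauge:
  fixes p :: "complex \<Rightarrow> real"
  assumes p_add: "\<And>x y. p (x + y) \<le> p x + p y"
    and p_scale: "\<And>t x. 0 \<le> t \<Longrightarrow> p (t *\<^sub>R x) = t * p x"
    and c0: "0 < c0" and p_lower: "\<And>x. c0 * norm x \<le> p x" and p_upper: "\<And>x. p x \<le> c1 * norm x"
    and e: "0 < e"
  obtains P \<gamma> \<gamma>' where "convex_curve P \<gamma> \<gamma>' c0 c1" "\<And>x. \<bar>P x - p x\<bar> \<le> e * c1 * norm x"
proof -
  have p_diff: "\<bar>p x - p y\<bar> \<le> c1 * norm (x - y)" for x y
    using p_add[of "x - y" y] p_add[of "y - x" x] p_upper[of "x - y"] p_upper[of "y - x"]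
    by (simp add: norm_minus_commute abs_le_iff)
  have c1: "0 \<le> c1" using order_trans[OF p_lower[of 1] p_upper[of 1]] c0 by simp
  have p_cont: "continuous_on S p" for S using p_diff by (rule continuous_on_Lipschitz_real)
  have int: "(\<lambda>\<phi>. p (cis \<phi> * x)) integrable_on {l..r}" for x l r
    by (intro integrable_continuous_real continuous_on_compose2[OF p_cont[of UNIV]] continuous_intros continuous_on_cis) auto
  define P where "P = (\<lambda>x. integral {-e..e} (\<lambda>\<phi>. p (cis \<phi> * x)) / (2 * e))"
  define v where "v = (\<lambda>\<phi>. p (cis \<phi>))"
  \<comment> \<open>On the unit circle \<open>P\<close> is the moving average of \<open>v\<close>
    over an interval of length \<open>2 * e\<close>. Its derivative is therefore a difference of
    values of \<open>v\<close>, and continuity of \<open>v\<close> is enough for \<open>P\<close> to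
    be continuously differentiable there.\<close>
  define u' where "u' = (\<lambda>\<theta>. (v (\<theta> + e) - v (\<theta> - e)) / (2 * e))"
  have v_cont: "continuous_on S v" for S
    unfolding v_def by (intro continuous_on_compose2[OF p_cont[of UNIV]] continuous_intros continuous_on_cis) auto
  have mean_le: "P x \<le> b" if "\<And>\<phi>. \<bar>\<phi>\<bar> \<le> e \<Longrightarrow> p (cis \<phi> * x) \<le> b" for x b
  proof -
    have "integral {-e..e} (\<lambda>\<phi>. p (cis \<phi> * x)) \<le> integral {-e..e} (\<lambda>\<phi>. b)"
      by (intro integral_le int) (auto intro!: that)
    then show ?thesis using e by (simp add: P_def field_simps)
  qed
  have mean_ge: "b \<le> P x" if "\<And>\<phi>. \<bar>\<phi>\<bar> \<le> e \<Longrightarrow> b \<le> p (cis \<phi> * x)" for x b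
  proof -
    have "integral {-e..e} (\<lambda>\<phi>. b) \<le> integral {-e..e} (\<lambda>\<phi>. p (cis \<phi> * x))"
      by (intro integral_le int) (auto intro!: that)
    then show ?thesis using e by (simp add: P_def field_simps)
  qed
  have close: "\<bar>p (cis \<phi> * x) - p x\<bar> \<le> e * c1 * norm x" if "\<bar>\<phi>\<bar> \<le> e" for \<phi> x
  proof -
    have "norm (cis \<phi> - 1) \<le> \<bar>\<phi>\<bar>"
      using dist_exp_i_1[of \<phi>] abs_sin_le_one abs_sin_x_le_abs_x[of "\<phi> / 2"] by (simp add: cis_conv_exp)
    then have "c1 * (norm (cis \<phi> - 1) * norm x) \<le> c1 * (e * norm x)"
      using that c1 by (intro mult_left_mono mult_right_mono) auto
    moreover have "norm (cis \<phi> * x - x) = norm (cis \<phi> - 1) * norm x"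
      by (simp add: left_diff_distrib flip: norm_mult)
    ultimately show ?thesis using p_diff[of "cis \<phi> * x" x] by (simp add: mult_ac)
  qed
  have "\<bar>P x - p x\<bar> \<le> e * c1 * norm x" for x
  proof -
    have "P x \<le> p x + e * c1 * norm x" by (rule mean_le) (use close[of _ x] in \<open>fastforce simp: abs_le_iff\<close>)
    moreover have "p x - e * c1 * norm x \<le> P x" by (rule mean_ge) (use close[of _ x] in \<open>fastforce simp: abs_le_iff\<close>)
    ultimately show ?thesis by (simp add: abs_le_iff)
  qed
  moreover have "convex_curve P (\<lambda>t. cis (2 * pi * t) / of_real (P (cis (2 * pi * t))))
     (\<lambda>t. 2 * pi * cis (2 * pi * t) * (\<i> * of_real (P (cis (2 * pi * t))) - of_real (u' (2 * pi * t)))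
      / of_real ((P (cis (2 * pi * t)))\<^sup>2)) c0 c1"
  proof (rule convex_curve_polar)
    show "P (x + y) \<le> P x + P y" for x y
    proof -
      have "integral {-e..e} (\<lambda>\<phi>. p (cis \<phi> * (x + y))) \<le>
          integral {-e..e} (\<lambda>\<phi>. p (cis \<phi> * x) + p (cis \<phi> * y))"
        by (intro integral_le int integrable_add) (auto simp: distrib_left p_add)
      also have "\<dots> = integral {-e..e} (\<lambda>\<phi>. p (cis \<phi> * x)) + integral {-e..e} (\<lambda>\<phi>. p (cis \<phi> * y))"
        by (intro integral_add int)
      finally show ?thesis using e by (simp add: P_def divide_right_mono flip: add_divide_distrib)
    qed
    show "P (t *\<^sub>R x) = t * P x" if "0 \<le> t" for t x
      using that p_scale by (simp add: P_def mult_scaleR_right)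
    show "c0 * norm x \<le> P x" for x
      using p_lower[of "cis _ * x"] by (intro mean_ge) (simp add: norm_mult)
    show "P x \<le> c1 * norm x" for x
      using p_upper[of "cis _ * x"] by (intro mean_le) (simp add: norm_mult)
    show "continuous_on UNIV u'"
      unfolding u'_def using e by (intro continuous_intros continuous_on_compose2[OF v_cont[of UNIV]]) auto
    show "u' (\<theta> + 2 * pi) = u' \<theta>" for \<theta>
    proof -
      have "v (x + 2 * pi) = v x" for x by (simp add: v_def flip: cis_mult)
      from this[of "\<theta> + e"] this[of "\<theta> - e"] show ?thesis by (simp add: u'_def algebra_simps)
    qed
    show "((\<lambda>\<theta>. P (cis \<theta>)) has_real_derivative u' \<theta>) (at \<theta>)" for \<theta>
    proof -
      \<comment> \<open>A base point to the left of every averaging interval that occurs for angles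
        within 1 of \<open>\<theta>\<close>.\<close>
      define a where "a = \<theta> - e - 1"
      define J where "J = (\<lambda>x. integral {a..x} v)"
      have J: "(J has_real_derivative v x) (at x)" if x: "a < x" for x
      proof -
        have "(J has_real_derivative v x) (at x within {a..x + 1})"
          unfolding J_def using x by (intro integral_has_real_derivative v_cont) auto
        moreover have "at x within {a..x + 1} = at x" using x by (intro at_within_interior) auto
        ultimately show ?thesis by simp
      qed
      have D: "((\<lambda>x. (J (x + e) - J (x - e)) / (2 * e)) has_real_derivative u' \<theta>) (at \<theta>)"
      proof -
        have "((\<lambda>x. J (x + e)) has_real_derivative v (\<theta> + e) * 1) (at \<theta>)"
          by (rule DERIV_chain2[OF J]) (use e in \<open>auto simp: a_def intro!: derivative_eq_intros\<close>)
        moreover have "((\<lambda>x. J (x - e)) has_real_derivative v (\<theta> - e) * 1) (at \<theta>)"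
          by (rule DERIV_chain2[OF J]) (use e in \<open>auto simp: a_def intro!: derivative_eq_intros\<close>)
        ultimately show ?thesis
          unfolding u'_def mult_1_right by (rule DERIV_cdivide[OF DERIV_diff])
      qed
      have "(J (x + e) - J (x - e)) / (2 * e) = P (cis x)" if "x \<in> ball \<theta> 1" for x
      proof -
        have "integral {-e..e} (\<lambda>\<phi>. p (cis \<phi> * cis x)) = integral {-e..e} (v \<circ> (\<lambda>\<phi>. x + \<phi>))"
          by (simp add: v_def o_def cis_mult add.commute)
        also have "\<dots> = integral {x - e..x + e} v"
          using integral_shift_Icc_real[of "-e" e v x] by (simp add: o_def add.commute)
        also have "\<dots> = J (x + e) - J (x - e)"
          using Henstock_Kurzweil_Integration.integral_combine[OF _ _ integrable_continuous_real[OF v_cont],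
              of a "x - e" "x + e"] that e
          by (simp add: J_def a_def dist_real_def abs_less_iff)
        finally show ?thesis by (simp add: P_def)
      qed
      then show ?thesis
        by (intro has_field_derivative_transform_within_open[OF D, where S = "ball \<theta> 1"]) auto
    qed
  qed (use c0 in auto)
  ultimately show ?thesis using that by blast
qed

text \<open>\<open>W\<close> will be a numerical range and \<open>V\<close> a region where a
  rational function is under control. The margin \<open>\<eta>\<close> keeps numerical ranges of
  perturbed matrices inside the curve, and \<open>s > 1\<close> keeps the function holomorphic
  beyond it. As \<open>W\<close> may be a point or a segment, it is thickened by a ball before its
  gauge is taken.\<close>

theorem exists_convex_curve_between:
  fixes W V :: "complex set"
  assumes W: "convex W" "bounded W" "W \<noteq> {}" and V: "open V" "closure W \<subseteq> V"
  obtains P \<gamma> \<gamma>' c\<^sub>0 c\<^sub>1 c s \<eta> where "convex_curve P \<gamma> \<gamma>' c\<^sub>0 c\<^sub>1" "1 < s" "0 < \<eta>"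
    "\<And>w v. w \<in> W \<Longrightarrow> norm (v - w) \<le> \<eta> \<Longrightarrow> P (v - c) < 1" "\<And>z. P z < s \<Longrightarrow> z + c \<in> V"
proof -
  obtain c where c: "c \<in> W" using W by blast
  obtain r where r: "0 < r" "{x. infdist x (closure W) \<le> r} \<subseteq> V"
  proof -
    have "compact (closure W)" "closure W \<noteq> {}" using W by (auto simp: compact_closure)
    from compact_in_open_separated[OF this(2,1) V] that show ?thesis by blast
  qed
  define d where "d = r / 2"
  have d: "0 < d" using r by (simp add: d_def)
  have inV: "z \<in> V" if "w \<in> W" "norm (z - w) \<le> 2 * d" for z w
  proof -
    have "infdist z (closure W) \<le> dist z w"
      using that closure_subset by (intro infdist_le) auto
    then show ?thesis using that r by (auto simp: d_def dist_norm)
  qed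
  obtain R0 where R0: "\<And>w. w \<in> W \<Longrightarrow> norm w \<le> R0" using W(2) by (auto simp: bounded_iff)
  define R where "R = R0 + norm c"
  have R: "norm (w - c) \<le> R" if "w \<in> W" for w
    using R0[OF that] norm_triangle_ineq4[of w c] by (simp add: R_def)
  have Rn: "0 \<le> R" using R[OF c] by simp
  define G where "G = {w - c + b |w b. w \<in> W \<and> norm b \<le> d}"
  have G: "convex G"
  proof (rule convexI)
    fix x y and a b :: real assume "x \<in> G" "y \<in> G" and ab: "0 \<le> a" "0 \<le> b" "a + b = 1"
    then obtain w1 b1 w2 b2 where x: "x = w1 - c + b1" "w1 \<in> W" "norm b1 \<le> d"
      and y: "y = w2 - c + b2" "w2 \<in> W" "norm b2 \<le> d"
      unfolding G_def by blast
    have "a *\<^sub>R w1 + b *\<^sub>R w2 \<in> W" by (rule convexD[OF W(1) x(2) y(2) ab])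
    moreover have "a *\<^sub>R b1 + b *\<^sub>R b2 \<in> cball 0 d"
      using x y by (intro convexD[OF convex_cball _ _ ab]) auto
    moreover have "a *\<^sub>R x + b *\<^sub>R y = (a *\<^sub>R w1 + b *\<^sub>R w2) - c + (a *\<^sub>R b1 + b *\<^sub>R b2)"
    proof -
      have "(a + b) *\<^sub>R c = c" using ab by simp
      then show ?thesis unfolding x y by (simp add: algebra_simps scaleR_add_left)
    qed
    ultimately show "a *\<^sub>R x + b *\<^sub>R y \<in> G" unfolding G_def mem_cball_0 by blast
  qed
  have dG: "cball 0 d \<subseteq> G"
    using c by (force simp: G_def)
  have GR: "G \<subseteq> cball 0 (R + d)"
    using R by (auto simp: G_def intro!: norm_triangle_le add_mono)
  have Rd: "0 < R + d" using Rn d by simp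
  obtain p where p: "\<And>x y. p (x + y) \<le> p x + p y" "\<And>t x. 0 \<le> t \<Longrightarrow> p (t *\<^sub>R x) = t * p x"
    "\<And>x. norm x / (R + d) \<le> p x" "\<And>x. p x \<le> norm x / d"
    and pG: "\<And>x t. 0 < t \<Longrightarrow> p x < t \<Longrightarrow> x /\<^sub>R t \<in> G" and Gp: "\<And>x t. 0 < t \<Longrightarrow> x /\<^sub>R t \<in> G \<Longrightarrow> p x \<le> t"
    by (rule exists_gauge[OF G d dG Rd GR], rule that) assumption+
  \<comment> \<open>Dilation by \<open>1 + \<tau>\<close> moves points of \<open>G\<close> by at
    most \<open>d / 2\<close>. This leaves room for the margin around \<open>W\<close>, and dilated
    points stay within \<open>2 * d\<close> of \<open>W\<close>, hence in \<open>V\<close>.\<close>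
  define \<tau> where "\<tau> = d / (2 * (R + d))"
  have \<tau>: "0 < \<tau>" "\<tau> * (R + d) = d / 2" using d Rd unfolding \<tau>_def by (simp, simp add: divide_simps)
  have pW: "p (v - c) \<le> 1 / (1 + \<tau>)" if "w \<in> W" "norm (v - w) \<le> d / 2" for v w
  proof (rule Gp)
    have "norm (\<tau> *\<^sub>R (w - c) + (1 + \<tau>) *\<^sub>R (v - w)) \<le> \<tau> * R + (1 + \<tau>) * (d / 2)"
      using \<tau> R[OF that(1)] that(2) by (intro norm_triangle_le add_mono) (auto intro!: mult_left_mono)
    also have "\<dots> \<le> \<tau> * (R + d) + d / 2" using \<tau> d by (simp add: algebra_simps)
    also have "\<dots> = d" using \<tau> by simp
    finally have "w - c + (\<tau> *\<^sub>R (w - c) + (1 + \<tau>) *\<^sub>R (v - w)) \<in> G"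
      unfolding G_def using that(1) by blast
    moreover have "w - c + (\<tau> *\<^sub>R (w - c) + (1 + \<tau>) *\<^sub>R (v - w)) = (v - c) /\<^sub>R (1 / (1 + \<tau>))"
      by (simp add: algebra_simps)
    ultimately show "(v - c) /\<^sub>R (1 / (1 + \<tau>)) \<in> G" by simp
  qed (use \<tau> in auto)
  have pV: "z + c \<in> V" if "p z < 1 + \<tau>" for z
  proof -
    have "z /\<^sub>R (1 + \<tau>) \<in> G" using that \<tau> by (intro pG) auto
    then obtain w b where w: "z /\<^sub>R (1 + \<tau>) = w - c + b" "w \<in> W" "norm b \<le> d"
      unfolding G_def by blast
    have "z = (1 + \<tau>) *\<^sub>R (z /\<^sub>R (1 + \<tau>))" using \<tau> by simp
    then have "z = (1 + \<tau>) *\<^sub>R (w - c + b)" using w by simp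
    then have "z + c - w = \<tau> *\<^sub>R (w - c) + (1 + \<tau>) *\<^sub>R b" by (simp add: algebra_simps)
    also have "norm \<dots> \<le> \<tau> * R + (1 + \<tau>) * d"
      using \<tau> R[OF w(2)] w(3) by (intro norm_triangle_le add_mono) (auto intro!: mult_left_mono)
    also have "\<dots> = \<tau> * (R + d) + d" by (simp add: algebra_simps)
    also have "\<dots> \<le> 2 * d" using \<tau> d by simp
    finally show ?thesis using inV[OF w(2), of "z + c"] by simp
  qed
  define M where "M = (1 + \<tau>) * (R + d)"
  have M: "0 < M" using \<tau> Rd by (simp add: M_def)
  \<comment> \<open>Makes the smoothing error at most \<open>\<tau> / 4\<close> on the ball of
    radius \<open>M\<close>, which contains all points where \<open>P\<close> and \<open>p\<close>
    are compared below.\<close>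
  define e where "e = \<tau> * d / (4 * M)"
  have "0 < e" "e / d * M = \<tau> / 4"
    using \<tau>(1) d M by (simp_all add: e_def)
  then have e: "0 < e" "e / d * ((1 + \<tau>) * (R + d)) \<le> \<tau> / 4"
    by (simp_all add: M_def)
  have p': "1 / (R + d) * norm x \<le> p x" "p x \<le> 1 / d * norm x" for x
    using p(3,4)[of x] by simp_all
  obtain P \<gamma> \<gamma>' where P: "convex_curve P \<gamma> \<gamma>' (1 / (R + d)) (1 / d)"
    "\<And>x. \<bar>P x - p x\<bar> \<le> e * (1 / d) * norm x"
    by (rule exists_smooth_gauge[OF p(1,2) _ p' e(1)]) (use Rd that in auto)
  interpret convex_curve P \<gamma> \<gamma>' "1 / (R + d)" "1 / d" by (rule P(1))
  show ?thesis
  proof (rule that[OF P(1), of "1 + \<tau> / 2" "d / 2" c])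
    fix w v assume wv: "w \<in> W" "norm (v - w) \<le> d / 2"
    have "norm (v - c) \<le> norm (v - w) + norm (w - c)"
      using norm_triangle_ineq[of "v - w" "w - c"] by simp
    then have n: "norm (v - c) \<le> R + d" using R[OF wv(1)] wv(2) d by simp
    have "P (v - c) \<le> p (v - c) + e / d * norm (v - c)"
      using P(2)[of "v - c"] by (simp add: abs_le_iff)
    also have "\<dots> \<le> 1 / (1 + \<tau>) + e / d * (R + d)"
      using pW[OF wv] n e(1) d by (intro add_mono mult_left_mono) auto
    also have "e / d * (R + d) \<le> \<tau> / 4 / (1 + \<tau>)"
      using e(2) \<tau>(1) by (simp add: field_simps)
    also have "1 / (1 + \<tau>) + \<tau> / 4 / (1 + \<tau>) < 1"
      unfolding add_divide_distrib[symmetric] using \<tau>(1) by simp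
    finally show "P (v - c) < 1" by simp
  next
    fix z assume z: "P z < 1 + \<tau> / 2"
    have "norm z / (R + d) \<le> 1 + \<tau>"
      using P_lower[of z] z \<tau>(1) by simp
    then have n: "norm z \<le> (1 + \<tau>) * (R + d)" using Rd by (simp add: field_simps)
    have "p z \<le> P z + e / d * norm z"
      using P(2)[of z] by (simp add: abs_le_iff)
    also have "\<dots> < 1 + \<tau> / 2 + e / d * ((1 + \<tau>) * (R + d))"
      using z n e(1) d by (intro add_less_le_mono mult_left_mono) auto
    also have "\<dots> \<le> 1 + \<tau>" using e(2) \<tau>(1) by linarith
    finally show "z + c \<in> V" by (intro pV) simp
  qed (use \<tau> d in auto)
qed

section \<open>Norms, adjoints and matrix polynomials\<close>

lemma vnorm_L2: "vnorm v = L2_set (\<lambda>i. cmod (v $ i)) {..<dim_vec v}"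
  by (simp add: vnorm_def L2_set_def)

lemma vnorm_nonneg [simp]: "0 \<le> vnorm v"
  by (simp add: vnorm_L2 L2_set_nonneg)

lemma cscalar_prod_sum: "x \<in> carrier_vec n \<Longrightarrow> y \<in> carrier_vec n \<Longrightarrow> x \<bullet>c y = (\<Sum>i<n. x $ i * cnj (y $ i))"
  by (auto simp: scalar_prod_def atLeast0LessThan)

lemma cscalar_prod_self: "x \<bullet>c x = complex_of_real ((vnorm x)\<^sup>2)"
proof -
  have "x \<bullet>c x = (\<Sum>i<dim_vec x. x $ i * cnj (x $ i))" by (rule cscalar_prod_sum) auto
  also have "\<dots> = complex_of_real (\<Sum>i<dim_vec x. (cmod (x $ i))\<^sup>2)"
    unfolding of_real_sum complex_norm_square ..
  also have "(\<Sum>i<dim_vec x. (cmod (x $ i))\<^sup>2) = (vnorm x)\<^sup>2"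
    by (simp add: vnorm_def sum_nonneg)
  finally show ?thesis .
qed

lemma vnorm_eq_0_iff: "x \<in> carrier_vec n \<Longrightarrow> vnorm x = 0 \<longleftrightarrow> x = 0\<^sub>v n"
  by (auto simp: vnorm_L2 L2_set_eq_0_iff)

lemma cscalar_prod_cnj: "x \<in> carrier_vec n \<Longrightarrow> y \<in> carrier_vec n \<Longrightarrow> cnj (x \<bullet>c y) = y \<bullet>c x"
  by (simp add: cscalar_prod_sum[of x n y] cscalar_prod_sum[of y n x] mult.commute)

lemma cauchy_schwarz:
  assumes "x \<in> carrier_vec n" "y \<in> carrier_vec n"
  shows "cmod (x \<bullet>c y) \<le> vnorm x * vnorm y"
proof -
  have "cmod (x \<bullet>c y) \<le> (\<Sum>i<n. \<bar>cmod (x $ i)\<bar> * \<bar>cmod (y $ i)\<bar>)"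
    unfolding cscalar_prod_sum[OF assms] by (rule sum_norm_le) (simp add: norm_mult)
  also have "\<dots> \<le> L2_set (\<lambda>i. cmod (x $ i)) {..<n} * L2_set (\<lambda>i. cmod (y $ i)) {..<n}"
    by (rule L2_set_mult_ineq)
  finally show ?thesis using assms by (simp add: vnorm_L2)
qed

lemma vnorm_smult: "vnorm (a \<cdot>\<^sub>v x) = cmod a * vnorm x"
proof -
  have "L2_set (\<lambda>i. cmod ((a \<cdot>\<^sub>v x) $ i)) {..<dim_vec x} = L2_set (\<lambda>i. cmod a * cmod (x $ i)) {..<dim_vec x}"
    by (rule L2_set_cong) (auto simp: norm_mult)
  then show ?thesis by (simp add: vnorm_L2 L2_set_right_distrib)
qed

lemma cscalar_prod_add_left:
  "x \<in> carrier_vec n \<Longrightarrow> y \<in> carrier_vec n \<Longrightarrow> z \<in> carrier_vec n \<Longrightarrow> (x + y) \<bullet>c z = x \<bullet>c z + y \<bullet>c z"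
  by (rule add_scalar_prod_distrib) auto

lemma cscalar_prod_smult_left:
  "x \<in> carrier_vec n \<Longrightarrow> z \<in> carrier_vec n \<Longrightarrow> (a \<cdot>\<^sub>v x) \<bullet>c z = a * (x \<bullet>c z)"
  by (rule smult_scalar_prod_distrib) auto

lemma mat_adjoint_index [simp]:
  "i < dim_col A \<Longrightarrow> j < dim_row A \<Longrightarrow> mat_adjoint A $$ (i, j) = cnj (A $$ (j, i))"
  by (simp add: mat_adjoint_def mat_of_rows_def)

lemma mat_adjoint_carrier [simp]: "A \<in> carrier_mat n m \<Longrightarrow> mat_adjoint A \<in> carrier_mat m n"
  by (auto simp: mat_adjoint_def)

lemma mat_adjoint_dim [simp]: "dim_row (mat_adjoint A) = dim_col A" "dim_col (mat_adjoint A) = dim_row A"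
  by (simp_all add: mat_adjoint_def)

lemma mat_adjoint_adjoint [simp]: "mat_adjoint (mat_adjoint (A :: complex mat)) = A"
  by (rule eq_matI) auto

lemma mat_adjoint_mult:
  fixes A B :: "complex mat"
  assumes "A \<in> carrier_mat n m" "B \<in> carrier_mat m l"
  shows "mat_adjoint (A * B) = mat_adjoint B * mat_adjoint A"
  using assms by (intro eq_matI) (auto simp: scalar_prod_def mult.commute)

lemma cscalar_prod_adjoint:
  fixes A :: "complex mat"
  assumes "A \<in> carrier_mat n m" "x \<in> carrier_vec m" "y \<in> carrier_vec n"
  shows "(A *\<^sub>v x) \<bullet>c y = x \<bullet>c (mat_adjoint A *\<^sub>v y)"
proof -
  have "(A *\<^sub>v x) \<bullet>c y = (\<Sum>i<n. \<Sum>j<m. A $$ (i, j) * x $ j * cnj (y $ i))"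
    using assms by (subst cscalar_prod_sum) (auto simp: scalar_prod_def sum_distrib_right atLeast0LessThan)
  also have "\<dots> = (\<Sum>j<m. \<Sum>i<n. A $$ (i, j) * x $ j * cnj (y $ i))"
    by (rule sum.swap)
  also have "\<dots> = x \<bullet>c (mat_adjoint A *\<^sub>v y)"
    using assms mult_mat_vec_carrier[OF mat_adjoint_carrier[OF assms(1)] assms(3)]
    by (subst cscalar_prod_sum[of x m])
      (auto simp: scalar_prod_def sum_distrib_left atLeast0LessThan mult_ac intro!: sum.cong)
  finally show ?thesis .
qed

text \<open>The constant is the Frobenius norm. Its finiteness makes the supremum in
  \<open>spec_norm\<close> meaningful and the numerical range bounded.\<close>

lemma exists_opnorm_bound:
  fixes M :: "complex mat"
  assumes M: "M \<in> carrier_mat n m"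
  obtains C where "0 \<le> C" "\<And>x. x \<in> carrier_vec m \<Longrightarrow> vnorm (M *\<^sub>v x) \<le> C * vnorm x"
proof -
  define C where "C = L2_set (\<lambda>i. vnorm (conjugate (row M i))) {..<n}"
  have "vnorm (M *\<^sub>v x) \<le> C * vnorm x" if x: "x \<in> carrier_vec m" for x
  proof -
    have "cmod ((M *\<^sub>v x) $ i) \<le> vnorm (conjugate (row M i)) * vnorm x" if "i < n" for i
    proof -
      have "(M *\<^sub>v x) $ i = x \<bullet>c conjugate (row M i)"
        using that M x by (auto intro: comm_scalar_prod[of _ m])
      then show ?thesis
        using cauchy_schwarz[of x m "conjugate (row M i)"] that M x by (simp add: mult.commute)
    qed
    then have "L2_set (\<lambda>i. cmod ((M *\<^sub>v x) $ i)) {..<n} \<le> L2_set (\<lambda>i. vnorm (conjugate (row M i)) * vnorm x) {..<n}"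
      by (intro L2_set_mono) auto
    then show ?thesis
      using M by (simp add: vnorm_L2[of "M *\<^sub>v x"] C_def L2_set_left_distrib)
  qed
  moreover have "0 \<le> C" by (simp add: C_def L2_set_nonneg)
  ultimately show ?thesis using that by blast
qed

lemma mult_mat_vec_zero: "M \<in> carrier_mat n m \<Longrightarrow> M *\<^sub>v 0\<^sub>v m = (0\<^sub>v n :: complex vec)"
  by (intro eq_vecI) (auto simp: scalar_prod_def)

lemma vnorm_mult_le_from_unit:
  fixes M :: "complex mat"
  assumes M: "M \<in> carrier_mat n m" and x: "x \<in> carrier_vec m"
    and unit: "\<And>u. u \<in> carrier_vec m \<Longrightarrow> vnorm u = 1 \<Longrightarrow> vnorm (M *\<^sub>v u) \<le> K"
  shows "vnorm (M *\<^sub>v x) \<le> K * vnorm x"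
proof (cases "vnorm x = 0")
  case True
  then have "x = 0\<^sub>v m" using vnorm_eq_0_iff[OF x] by simp
  then show ?thesis using mult_mat_vec_zero[OF M] vnorm_eq_0_iff[of "0\<^sub>v n" n] True by simp
next
  case False
  then have pos: "0 < vnorm x" using vnorm_nonneg[of x] by linarith
  define u where "u = complex_of_real (1 / vnorm x) \<cdot>\<^sub>v x"
  have u: "u \<in> carrier_vec m" "vnorm u = 1" using x pos by (simp_all add: u_def vnorm_smult norm_divide)
  have "M *\<^sub>v u = complex_of_real (1 / vnorm x) \<cdot>\<^sub>v (M *\<^sub>v x)"
    unfolding u_def by (rule mult_mat_vec[OF M x])
  then have "vnorm (M *\<^sub>v u) = vnorm (M *\<^sub>v x) / vnorm x"
    using pos by (simp add: vnorm_smult norm_divide)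
  with unit[OF u] show ?thesis using pos by (simp only: pos_divide_le_eq)
qed

lemma spec_norm_bound:
  assumes M: "M \<in> carrier_mat n m" and x: "x \<in> carrier_vec m"
  shows "vnorm (M *\<^sub>v x) \<le> spec_norm M * vnorm x"
proof (rule vnorm_mult_le_from_unit[OF M x])
  fix u :: "complex vec" assume u: "u \<in> carrier_vec m" "vnorm u = 1"
  obtain C where C: "0 \<le> C" "\<And>x. x \<in> carrier_vec m \<Longrightarrow> vnorm (M *\<^sub>v x) \<le> C * vnorm x"
    using exists_opnorm_bound[OF M] by metis
  have "bdd_above (insert 0 {vnorm (M *\<^sub>v v) |v. v \<in> carrier_vec (dim_col M) \<and> vnorm v = 1})"
    by (rule bdd_aboveI[of _ C]) (use C M in force)
  then show "vnorm (M *\<^sub>v u) \<le> spec_norm M"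
    unfolding spec_norm_def using u M by (intro cSup_upper) auto
qed

lemma spec_norm_nonneg: "0 \<le> spec_norm M"
proof -
  have M: "M \<in> carrier_mat (dim_row M) (dim_col M)" by simp
  obtain C where C: "0 \<le> C" "\<And>x. x \<in> carrier_vec (dim_col M) \<Longrightarrow> vnorm (M *\<^sub>v x) \<le> C * vnorm x"
    using exists_opnorm_bound[OF M] by metis
  show ?thesis
    unfolding spec_norm_def
    by (rule cSup_upper) (use C in \<open>auto intro!: bdd_aboveI[of _ C]\<close>, force)
qed

lemma num_range_iff:
  assumes "M \<in> carrier_mat n n"
  shows "num_range M = {((M *\<^sub>v x) \<bullet>c x) / (x \<bullet>c x) |x. x \<in> carrier_vec n \<and> x \<noteq> 0\<^sub>v n}"
proof -
  have *: "(\<Sum>i<n. cnj (x $ i) * (M *\<^sub>v x) $ i) = (M *\<^sub>v x) \<bullet>c x" "(\<Sum>i<n. cnj (x $ i) * x $ i) = x \<bullet>c x"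
    if "x \<in> carrier_vec n" for x
    using that assms by (simp_all add: cscalar_prod_sum[of _ n] mult.commute)
  have "dim_row M = n" using assms by simp
  show ?thesis
    unfolding num_range_def \<open>dim_row M = n\<close>
    by (rule Collect_cong, rule ex_cong1) (use * in auto)
qed

lemma mat_diag_mult_vec:
  fixes f :: "nat \<Rightarrow> complex"
  shows "v \<in> carrier_vec n \<Longrightarrow> i < n \<Longrightarrow> (mat_diag n f *\<^sub>v v) $ i = f i * v $ i"
  by (simp add: mat_diag_def scalar_prod_def mult_delta_left)

lemma mat_diag_mult_unit_vec:
  fixes f :: "nat \<Rightarrow> complex"
  shows "i < n \<Longrightarrow> mat_diag n f *\<^sub>v unit_vec n i = f i \<cdot>\<^sub>v unit_vec n i"
  by (intro eq_vecI) (auto simp: mat_diag_def scalar_prod_def mult_delta_left)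

lemma cscalar_prod_self_pos:
  fixes x :: "complex vec"
  shows "x \<in> carrier_vec n \<Longrightarrow> x \<noteq> 0\<^sub>v n \<Longrightarrow> x \<bullet>c x \<noteq> 0"
  using vnorm_eq_0_iff[of x n] by (simp add: cscalar_prod_self)

lemma num_range_nonempty:
  assumes M: "M \<in> carrier_mat n n" and "n \<noteq> 0"
  shows "num_range M \<noteq> {}"
  unfolding num_range_iff[OF M] using \<open>n \<noteq> 0\<close> by (auto intro!: exI[of _ "unit_vec n 0"])

section \<open>Polynomials of a matrix\<close>

definition mpoly :: "complex poly \<Rightarrow> complex mat \<Rightarrow> complex mat" where
  "mpoly p A = fold_coeffs (\<lambda>a M. a \<cdot>\<^sub>m 1\<^sub>m (dim_row A) + A * M) p (0\<^sub>m (dim_row A) (dim_row A))"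

lemma mpoly_0 [simp]: "A \<in> carrier_mat n n \<Longrightarrow> mpoly 0 A = 0\<^sub>m n n"
  by (auto simp: mpoly_def)

lemma mpoly_pCons:
  assumes "A \<in> carrier_mat n n"
  shows "mpoly (pCons a p) A = a \<cdot>\<^sub>m 1\<^sub>m n + A * mpoly p A"
proof (cases "a = 0 \<and> p = 0")
  case True
  then show ?thesis using assms by (auto simp: mpoly_def)
qed (use assms in \<open>auto simp: mpoly_def\<close>)

lemma mpoly_carrier [simp]: "A \<in> carrier_mat n n \<Longrightarrow> mpoly p A \<in> carrier_mat n n"
  by (induction p) (auto simp: mpoly_pCons)

lemma mpoly_mult_mat_vec:
  assumes "A \<in> carrier_mat n n" "x \<in> carrier_vec n"
  shows "mpoly (pCons a p) A *\<^sub>v x = a \<cdot>\<^sub>v x + A *\<^sub>v (mpoly p A *\<^sub>v x)"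
proof -
  have "a \<cdot>\<^sub>m 1\<^sub>m n *\<^sub>v x = a \<cdot>\<^sub>v x"
    using assms(2) by (intro eq_vecI) (auto simp: scalar_prod_def mult_delta_left mult_delta_right)
  then show ?thesis
    using assms assoc_mult_mat_vec[of A n n "mpoly p A" n x]
    by (simp add: mpoly_pCons add_mult_distrib_mat_vec[of _ n n])
qed

lemma mpoly_1: "A \<in> carrier_mat n n \<Longrightarrow> mpoly 1 A = 1\<^sub>m n"
  using mpoly_pCons[of A n 1 0] by (auto simp: one_pCons intro!: eq_matI)

text \<open>Serves two purposes: with \<open>X\<close> a matrix of eigenvectors it carries
  polynomials over to the diagonal form, and with all three matrices equal it says that a matrix
  commutes with its polynomials.\<close>

lemma mpoly_intertwine:
  assumes "A \<in> carrier_mat n n" "C \<in> carrier_mat m m" "X \<in> carrier_mat n m" "A * X = X * C"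
  shows "mpoly p A * X = X * mpoly p C"
proof (induction p)
  case 0 then show ?case using assms by simp
next
  case (pCons a p)
  have "A * mpoly p A * X = A * (X * mpoly p C)"
    using assms pCons.IH by (simp add: assoc_mult_mat[of _ n n _ n _ m])
  also have "\<dots> = X * (C * mpoly p C)"
    using assms by (simp flip: assoc_mult_mat[of A n n X m _ m] assoc_mult_mat[of X n m C m _ m])
  finally show ?case
    using assms
    by (simp add: mpoly_pCons add_mult_distrib_mat[of _ n n _ _ m] mult_add_distrib_mat[of X n m _ m]
        mult_smult_assoc_mat[of _ n n _ m] mult_smult_distrib[of X n m _ m])
qed

lemma mpoly_mat_diag: "mpoly p (mat_diag n d) = mat_diag n (\<lambda>i. poly p (d i))"
proof (induction p)
  case 0 then show ?case
    unfolding mpoly_0[OF mat_diag_dim] by (intro eq_matI) (auto simp: mat_diag_def)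
next
  case (pCons a p)
  show ?case
    unfolding mpoly_pCons[OF mat_diag_dim] pCons.IH mat_diag_diag by (intro eq_matI) (auto simp: mat_diag_def)
qed

section \<open>The Crouzeix--Palencia bound for diagonalizable matrices\<close>

text \<open>The diagonalized matrix is \<open>fcalc (\<lambda>z. z)\<close>. Only values at the
  eigenvalues \<open>d i\<close> enter \<open>fcalc\<close>, so it applies to Cauchy transforms and
  rational functions alike. With \<open>d\<close> as a parameter, the same \<open>S\<close> and
  \<open>Q\<close> serve for translates of the matrix.\<close>

locale diagonalization =
  fixes n :: nat and S Q :: "complex mat" and d :: "nat \<Rightarrow> complex"
  assumes S [simp]: "S \<in> carrier_mat n n" and Q [simp]: "Q \<in> carrier_mat n n"
    and SQ: "S * Q = 1\<^sub>m n" and QS: "Q * S = 1\<^sub>m n"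
begin

definition fcalc :: "(complex \<Rightarrow> complex) \<Rightarrow> complex mat" where
  "fcalc f = S * mat_diag n (\<lambda>i. f (d i)) * Q"

lemma fcalc_carrier [simp]: "fcalc f \<in> carrier_mat n n"
  by (auto simp: fcalc_def intro!: mult_carrier_mat[of _ n n])

lemma fcalc_one: "fcalc (\<lambda>_. 1) = 1\<^sub>m n"
  by (simp add: fcalc_def SQ right_mult_one_mat[OF S])

lemma fcalc_mult: "fcalc f * fcalc g = fcalc (\<lambda>z. f z * g z)"
proof -
  let ?D = "\<lambda>f. mat_diag n (\<lambda>i. f (d i))"
  have [simp]: "?D f \<in> carrier_mat n n" for f by simp
  have "fcalc f * fcalc g = S * ?D f * (Q * S) * ?D g * Q"
    by (simp add: fcalc_def assoc_mult_mat[of _ n n _ n _ n] mult_carrier_mat[of _ n n])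
  also have "\<dots> = S * (?D f * ?D g) * Q"
    by (simp add: QS assoc_mult_mat[of _ n n _ n _ n] mult_carrier_mat[of _ n n] right_mult_one_mat[of _ n n])
  finally show ?thesis by (simp add: fcalc_def)
qed

lemma fcalc_mpoly: "mpoly p (fcalc (\<lambda>z. z)) = fcalc (poly p)"
proof -
  let ?D = "mat_diag n d"
  have "fcalc (\<lambda>z. z) * S = S * ?D * (Q * S)"
    by (simp add: fcalc_def assoc_mult_mat[of _ n n _ n _ n] mult_carrier_mat[of _ n n])
  then have "fcalc (\<lambda>z. z) * S = S * ?D"
    by (simp add: QS right_mult_one_mat[of _ n n] mult_carrier_mat[of _ n n])
  then have "mpoly p (fcalc (\<lambda>z. z)) * S = S * mpoly p ?D"
    by (intro mpoly_intertwine[of _ n _ n]) auto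
  then have "mpoly p (fcalc (\<lambda>z. z)) * (S * Q) = S * mat_diag n (\<lambda>i. poly p (d i)) * Q"
    by (simp add: mpoly_mat_diag flip: assoc_mult_mat[of _ n n S n Q n])
  then show ?thesis
    unfolding SQ right_mult_one_mat[OF mpoly_carrier[OF fcalc_carrier]] by (simp add: fcalc_def)
qed

lemma fcalc_mult_vec:
  assumes x: "x \<in> carrier_vec n"
  shows "fcalc f *\<^sub>v x = S *\<^sub>v (mat_diag n (\<lambda>i. f (d i)) *\<^sub>v (Q *\<^sub>v x))"
proof -
  let ?D = "mat_diag n (\<lambda>i. f (d i))"
  have D: "?D \<in> carrier_mat n n" by simp
  have "fcalc f *\<^sub>v x = S * ?D *\<^sub>v (Q *\<^sub>v x)"
    unfolding fcalc_def by (rule assoc_mult_mat_vec[OF mult_carrier_mat[OF S D] Q x])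
  also have "\<dots> = S *\<^sub>v (?D *\<^sub>v (Q *\<^sub>v x))"
    by (rule assoc_mult_mat_vec[OF S D mult_mat_vec_carrier[OF Q x]])
  finally show ?thesis .
qed

text \<open>The form of the rank-one idempotent made of column \<open>i\<close> of \<open>S\<close>
  and row \<open>i\<close> of \<open>Q\<close>.\<close>

definition coef :: "complex vec \<Rightarrow> complex vec \<Rightarrow> nat \<Rightarrow> complex" where
  "coef x y i = (Q *\<^sub>v x) $ i * cnj ((mat_adjoint S *\<^sub>v y) $ i)"

lemma fcalc_form:
  assumes x: "x \<in> carrier_vec n" and y: "y \<in> carrier_vec n"
  shows "(fcalc f *\<^sub>v x) \<bullet>c y = (\<Sum>i<n. f (d i) * coef x y i)"
proof -
  let ?D = "mat_diag n (\<lambda>i. f (d i))"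
  have D: "?D \<in> carrier_mat n n" by simp
  have Qx: "Q *\<^sub>v x \<in> carrier_vec n" using mult_mat_vec_carrier[OF Q x] .
  have DQx: "?D *\<^sub>v (Q *\<^sub>v x) \<in> carrier_vec n" using mult_mat_vec_carrier[OF D Qx] .
  have Sy: "mat_adjoint S *\<^sub>v y \<in> carrier_vec n"
    using mult_mat_vec_carrier[OF mat_adjoint_carrier[OF S] y] .
  have "fcalc f *\<^sub>v x = S *\<^sub>v (?D *\<^sub>v (Q *\<^sub>v x))"
    by (rule fcalc_mult_vec[OF x])
  then have "(fcalc f *\<^sub>v x) \<bullet>c y = (?D *\<^sub>v (Q *\<^sub>v x)) \<bullet>c (mat_adjoint S *\<^sub>v y)"
    using cscalar_prod_adjoint[OF S DQx y] by simp
  also have "\<dots> = (\<Sum>i<n. (?D *\<^sub>v (Q *\<^sub>v x)) $ i * cnj ((mat_adjoint S *\<^sub>v y) $ i))"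
    by (rule cscalar_prod_sum[OF DQx Sy])
  also have "\<dots> = (\<Sum>i<n. f (d i) * coef x y i)"
    using mat_diag_mult_vec[OF Qx, of _ "\<lambda>i. f (d i)"]
    by (intro sum.cong) (simp_all add: coef_def del: index_mult_mat_vec)
  finally show ?thesis .
qed

lemma coef_sum:
  assumes "x \<in> carrier_vec n" "y \<in> carrier_vec n"
  shows "(\<Sum>i<n. coef x y i) = x \<bullet>c y"
  using fcalc_form[OF assms, of "\<lambda>_. 1"] assms by (simp add: fcalc_one)

lemma coef_expand:
  assumes "x \<in> carrier_vec n" "y \<in> carrier_vec n" "i < n"
  shows "coef (x + a \<cdot>\<^sub>v y) (x + a \<cdot>\<^sub>v y) i
    = coef x x i + a * coef y x i + cnj a * coef x y i + a * cnj a * coef y y i"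
proof -
  have "(M *\<^sub>v (x + a \<cdot>\<^sub>v y)) $ i = (M *\<^sub>v x) $ i + a * (M *\<^sub>v y) $ i" if "M \<in> carrier_mat n n" for M
    using that assms by (simp add: mult_add_distrib_mat_vec[of M n n] mult_mat_vec[of M n n])
  then show ?thesis using S Q by (simp add: coef_def algebra_simps)
qed

lemma diagonal_in_num_range:
  assumes i: "i < n"
  shows "d i \<in> num_range (fcalc (\<lambda>z. z))"
proof -
  let ?e = "unit_vec n i :: complex vec"
  define x where "x = S *\<^sub>v ?e"
  have e: "?e \<in> carrier_vec n" by simp
  have x: "x \<in> carrier_vec n" unfolding x_def by (rule mult_mat_vec_carrier[OF S e])
  have Qx: "Q *\<^sub>v x = ?e"
    unfolding x_def using assoc_mult_mat_vec[OF Q S e] by (simp add: QS)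
  have x0: "x \<noteq> 0\<^sub>v n"
    using Qx mult_mat_vec_zero[OF Q] unit_vec_nonzero[OF i, where 'a = complex] by auto
  have "fcalc (\<lambda>z. z) *\<^sub>v x = d i \<cdot>\<^sub>v x"
    unfolding fcalc_mult_vec[OF x] Qx mat_diag_mult_unit_vec[OF i] using mult_mat_vec[OF S e] by (simp add: x_def)
  then have "((fcalc (\<lambda>z. z) *\<^sub>v x) \<bullet>c x) / (x \<bullet>c x) = d i"
    using cscalar_prod_self_pos[OF x x0] x by (simp add: cscalar_prod_smult_left[of _ n])
  then show ?thesis unfolding num_range_iff[OF fcalc_carrier] using x x0 by force
qed

text \<open>The bound is a condition number of \<open>S\<close>. It is uniform in \<open>f\<close>,
  which makes the extremal constant finite.\<close>

lemma fcalc_bounded: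
  obtains C where "\<And>f x. (\<And>i. i < n \<Longrightarrow> cmod (f (d i)) \<le> 1) \<Longrightarrow> x \<in> carrier_vec n \<Longrightarrow>
    vnorm (fcalc f *\<^sub>v x) \<le> C * vnorm x"
proof -
  obtain C1 where C1: "0 \<le> C1" "\<And>x. x \<in> carrier_vec n \<Longrightarrow> vnorm (S *\<^sub>v x) \<le> C1 * vnorm x"
    using exists_opnorm_bound[OF S] by blast
  obtain C2 where C2: "0 \<le> C2" "\<And>x. x \<in> carrier_vec n \<Longrightarrow> vnorm (Q *\<^sub>v x) \<le> C2 * vnorm x"
    using exists_opnorm_bound[OF Q] by blast
  have "vnorm (fcalc f *\<^sub>v x) \<le> C1 * C2 * vnorm x"
    if f: "\<And>i. i < n \<Longrightarrow> cmod (f (d i)) \<le> 1" and x: "x \<in> carrier_vec n" for f x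
  proof -
    let ?D = "mat_diag n (\<lambda>i. f (d i))"
    have D: "?D \<in> carrier_mat n n" by simp
    have Qx: "Q *\<^sub>v x \<in> carrier_vec n" using mult_mat_vec_carrier[OF Q x] .
    have DQx: "?D *\<^sub>v (Q *\<^sub>v x) \<in> carrier_vec n" using mult_mat_vec_carrier[OF D Qx] .
    have Dv: "vnorm (?D *\<^sub>v v) \<le> vnorm v" if v: "v \<in> carrier_vec n" for v
    proof -
      have "cmod ((?D *\<^sub>v v) $ i) \<le> cmod (v $ i)" if "i < n" for i
        unfolding mat_diag_mult_vec[OF v that] norm_mult using f[OF that] by (simp add: mult_left_le_one_le)
      then show ?thesis
        using v D by (auto simp: vnorm_L2 mat_diag_def intro!: L2_set_mono)
    qed
    have "fcalc f *\<^sub>v x = S *\<^sub>v (?D *\<^sub>v (Q *\<^sub>v x))"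
      by (rule fcalc_mult_vec[OF x])
    then have "vnorm (fcalc f *\<^sub>v x) \<le> C1 * vnorm (?D *\<^sub>v (Q *\<^sub>v x))"
      using C1(2)[OF DQx] by simp
    also have "\<dots> \<le> C1 * (C2 * vnorm x)"
      using Dv[OF Qx] C2(2)[OF x] C1(1) by (intro mult_left_mono) auto
    finally show ?thesis by (simp add: mult.assoc)
  qed
  then show ?thesis using that by blast
qed

end

section \<open>Positivity of the double layer kernel of a matrix\<close>

locale curve_around_range = convex_curve + diagonalization +
  assumes range_inside: "w \<in> num_range (fcalc (\<lambda>z. z)) \<Longrightarrow> P w < 1"
begin

lemma d_inside: "i < n \<Longrightarrow> P (d i) < 1"
  using diagonal_in_num_range range_inside by blast

text \<open>The form of the resolvent at \<open>\<gamma> t\<close>, multiplied by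
  \<open>\<gamma>' t\<close>.\<close>

definition res :: "complex vec \<Rightarrow> complex vec \<Rightarrow> real \<Rightarrow> complex" where
  "res x y t = (\<Sum>i<n. coef x y i * (\<gamma>' t / (\<gamma> t - d i)))"

text \<open>Let y be the resolvent at \<open>\<gamma> t\<close> applied to x. The form equals the
  squared norm of y times \<open>\<gamma>' t * cnj (\<gamma> t - w)\<close>, with w the Rayleigh
  quotient of the matrix at y. Since w lies inside the curve, \<open>supporting\<close> gives the
  sign.\<close>

lemma res_nonneg:
  assumes x: "x \<in> carrier_vec n"
  shows "0 \<le> Im (res x x t)"
proof -
  let ?r = "\<lambda>z. 1 / (\<gamma> t - z)" and ?A = "fcalc (\<lambda>z. z)"
  define y where "y = fcalc ?r *\<^sub>v x"
  have y: "y \<in> carrier_vec n" unfolding y_def by (rule mult_mat_vec_carrier[OF fcalc_carrier x])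
  have Ay: "?A *\<^sub>v y \<in> carrier_vec n" by (rule mult_mat_vec_carrier[OF fcalc_carrier y])
  have "res x x t = \<gamma>' t * (y \<bullet>c x)"
    unfolding y_def fcalc_form[OF x x] res_def by (simp add: sum_distrib_left field_simps)
  moreover have "x = \<gamma> t \<cdot>\<^sub>v y + (- 1) \<cdot>\<^sub>v (?A *\<^sub>v y)"
  proof -
    have "fcalc (poly [:\<gamma> t, - 1:]) * fcalc ?r = fcalc (\<lambda>_. 1)"
      unfolding fcalc_mult unfolding fcalc_def
      by (intro arg_cong2[where f = "(*)"] refl eq_matI) (auto simp: mat_diag_def \<gamma>_neq d_inside)
    then have "x = mpoly [:\<gamma> t, - 1:] ?A *\<^sub>v y"
      unfolding y_def fcalc_mpoly using x by (simp add: fcalc_one flip: assoc_mult_mat_vec[of _ n n _ n])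
    also have "\<dots> = \<gamma> t \<cdot>\<^sub>v y + ?A *\<^sub>v ((- 1) \<cdot>\<^sub>v y + ?A *\<^sub>v (0\<^sub>m n n *\<^sub>v y))"
      using y by (simp add: mpoly_mult_mat_vec[of _ n] mpoly_0[of _ n])
    also have "(- 1) \<cdot>\<^sub>v y + ?A *\<^sub>v (0\<^sub>m n n *\<^sub>v y) = (- 1) \<cdot>\<^sub>v y"
    proof -
      have "0\<^sub>m n n *\<^sub>v y = 0\<^sub>v n" using y by auto
      moreover have "?A *\<^sub>v 0\<^sub>v n = 0\<^sub>v n" by (rule mult_mat_vec_zero[OF fcalc_carrier])
      ultimately show ?thesis using y by simp
    qed
    also have "?A *\<^sub>v ((- 1) \<cdot>\<^sub>v y) = (- 1) \<cdot>\<^sub>v (?A *\<^sub>v y)"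
      by (rule mult_mat_vec[OF fcalc_carrier y])
    finally show ?thesis .
  qed
  then have "x \<bullet>c y = \<gamma> t * (y \<bullet>c y) - (?A *\<^sub>v y) \<bullet>c y"
    using y Ay by (subst (1) \<open>x = _\<close>) (simp add: cscalar_prod_add_left[of _ n] cscalar_prod_smult_left[of _ n])
  ultimately have r: "res x x t = \<gamma>' t * cnj (\<gamma> t * (y \<bullet>c y) - (?A *\<^sub>v y) \<bullet>c y)"
    using cscalar_prod_cnj[OF x y] by simp
  show ?thesis
  proof (cases "y = 0\<^sub>v n")
    case True
    then have "y \<bullet>c y = 0" "(?A *\<^sub>v y) \<bullet>c y = 0" using Ay by (auto simp: cscalar_prod_sum[of _ n])
    then show ?thesis unfolding r by simp
  next
    case False
    then have ne: "y \<bullet>c y \<noteq> 0" using vnorm_eq_0_iff[OF y] by (simp add: cscalar_prod_self)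
    define w where "w = ((?A *\<^sub>v y) \<bullet>c y) / (y \<bullet>c y)"
    have "res x x t = \<gamma>' t * cnj ((\<gamma> t - w) * (y \<bullet>c y))"
      unfolding r using ne by (simp add: w_def left_diff_distrib)
    also have "\<dots> = of_real ((vnorm y)\<^sup>2) * (\<gamma>' t * cnj (\<gamma> t - w))"
      by (simp add: cscalar_prod_self)
    finally have "Im (res x x t) = (vnorm y)\<^sup>2 * Im (\<gamma>' t * cnj (\<gamma> t - w))"
      by (simp only: times_complex.sel Im_complex_of_real Re_complex_of_real mult_zero_left add_0_right)
    moreover have "0 \<le> Im (\<gamma>' t * cnj (\<gamma> t - w))"
      using y False unfolding w_def num_range_iff[OF fcalc_carrier]
      by (intro supporting less_imp_le range_inside[unfolded num_range_iff[OF fcalc_carrier]]) blast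
    ultimately show ?thesis by simp
  qed
qed

text \<open>Positivity is applied to \<open>x\<close> plus a unimodular multiple of
  \<open>y\<close>; the multiple is chosen so that the cross term becomes minus the modulus on the
  left.\<close>

lemma res_bound:
  assumes x: "x \<in> carrier_vec n" and y: "y \<in> carrier_vec n"
  shows "cmod (res x y t - cnj (res y x t)) \<le> Im (res x x t) + Im (res y y t)"
proof -
  define B where "B = res x y t - cnj (res y x t)"
  show ?thesis
  proof (cases "B = 0")
    case True
    then show ?thesis using res_nonneg[OF x, of t] res_nonneg[OF y, of t] unfolding B_def by simp
  next
    case False
    define a where "a = cnj (- \<i> * cmod B / B)"
    have aB: "cnj a * B = - \<i> * cmod B" using False by (simp add: a_def)
    have "cmod a = 1" using False by (simp add: a_def norm_mult norm_divide)
    then have aa: "a * cnj a = 1" using complex_norm_square[of a] by simp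
    have z: "x + a \<cdot>\<^sub>v y \<in> carrier_vec n" using x y by simp
    have "res (x + a \<cdot>\<^sub>v y) (x + a \<cdot>\<^sub>v y) t = res x x t + a * res y x t + cnj a * res x y t + a * cnj a * res y y t"
      unfolding res_def sum_distrib_left sum.distrib[symmetric]
      by (intro sum.cong) (simp_all add: coef_expand[OF x y] algebra_simps add_divide_distrib)
    then have "0 \<le> Im (res x x t) + Im (a * res y x t + cnj a * res x y t) + Im (res y y t)"
      using res_nonneg[OF z, of t] unfolding aa by simp
    also have "Im (a * res y x t + cnj a * res x y t) = Im (cnj a * B)"
      unfolding B_def by (simp add: algebra_simps)
    also have "\<dots> = - cmod B" unfolding aB by simp
    finally show ?thesis unfolding B_def by simp
  qed
qed

text \<open>The norm bound 2 for f(A) plus the adjoint of g(A), in weak form: the conjugated term is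
  the form of that adjoint. \<open>norm_form_sum_le\<close> yields the sum of the squared norms of
  the two vectors, which is 2 for unit vectors, and homogeneity gives the rest.\<close>

lemma form_sum_bound:
  assumes s: "1 < s" "f holomorphic_on {z. P z < s}" "\<And>z. P z \<le> 1 \<Longrightarrow> norm (f z) \<le> 1"
    and x: "x \<in> carrier_vec n" and y: "y \<in> carrier_vec n"
  shows "cmod ((fcalc f *\<^sub>v x) \<bullet>c y + cnj ((fcalc (conj_cauchy f) *\<^sub>v y) \<bullet>c x)) \<le> 2 * vnorm x * vnorm y"
proof (cases "vnorm x = 0 \<or> vnorm y = 0")
  case True
  then have "x = 0\<^sub>v n \<or> y = 0\<^sub>v n" using vnorm_eq_0_iff x y by blast
  then have "coef x y i = 0 \<and> coef y x i = 0" if "i < n" for i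
    using that mult_mat_vec_zero[OF Q] mult_mat_vec_zero[OF mat_adjoint_carrier[OF S]]
    by (auto simp: coef_def)
  then show ?thesis by (simp add: fcalc_form x y)
next
  case False
  then have pos: "0 < vnorm x" "0 < vnorm y" using vnorm_nonneg[of x] vnorm_nonneg[of y] by linarith+
  have unit: "cmod ((fcalc f *\<^sub>v u) \<bullet>c v + cnj ((fcalc (conj_cauchy f) *\<^sub>v v) \<bullet>c u)) \<le> 2"
    if u: "u \<in> carrier_vec n" "vnorm u = 1" and v: "v \<in> carrier_vec n" "vnorm v = 1" for u v
  proof -
    have "cmod ((\<Sum>i<n. f (d i) * coef u v i) + cnj (\<Sum>i<n. conj_cauchy f (d i) * coef v u i))
       \<le> Re (\<Sum>i<n. coef u u i) + Re (\<Sum>i<n. coef v v i)"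
      using norm_form_sum_le[OF s(1,2), of "{..<n}" d "coef u v" "coef v u" "coef u u" "coef v v"]
        res_bound[OF u(1) v(1)] d_inside s(3) by (simp add: res_def)
    then show ?thesis using u v by (simp add: fcalc_form coef_sum cscalar_prod_self)
  qed
  \<comment> \<open>The factors are real, so they pass through the conjugation in the second
    term.\<close>
  define a b where "a = complex_of_real (1 / vnorm x)" and "b = complex_of_real (1 / vnorm y)"
  have u: "a \<cdot>\<^sub>v x \<in> carrier_vec n" "vnorm (a \<cdot>\<^sub>v x) = 1" and v: "b \<cdot>\<^sub>v y \<in> carrier_vec n" "vnorm (b \<cdot>\<^sub>v y) = 1"
    using x y pos by (simp_all add: a_def b_def vnorm_smult norm_divide)
  have sc: "coef (a \<cdot>\<^sub>v x) (b \<cdot>\<^sub>v y) i = a * b * coef x y i" "coef (b \<cdot>\<^sub>v y) (a \<cdot>\<^sub>v x) i = a * b * coef y x i"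
    if "i < n" for i
  proof -
    have "(M *\<^sub>v (k \<cdot>\<^sub>v w)) $ i = k * (M *\<^sub>v w) $ i" if "M \<in> carrier_mat n n" "w \<in> carrier_vec n" for M w and k :: complex
      unfolding mult_mat_vec[OF that] using that \<open>i < n\<close> by simp
    then show "coef (a \<cdot>\<^sub>v x) (b \<cdot>\<^sub>v y) i = a * b * coef x y i"
        "coef (b \<cdot>\<^sub>v y) (a \<cdot>\<^sub>v x) i = a * b * coef y x i"
      using x y S Q by (simp_all add: coef_def a_def b_def)
  qed
  have "(fcalc f *\<^sub>v (a \<cdot>\<^sub>v x)) \<bullet>c (b \<cdot>\<^sub>v y) = a * b * ((fcalc f *\<^sub>v x) \<bullet>c y)"
    "(fcalc (conj_cauchy f) *\<^sub>v (b \<cdot>\<^sub>v y)) \<bullet>c (a \<cdot>\<^sub>v x) = a * b * ((fcalc (conj_cauchy f) *\<^sub>v y) \<bullet>c x)"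
    using u v x y by (simp_all add: fcalc_form sc sum_distrib_left mult_ac)
  then have "cmod (a * b * ((fcalc f *\<^sub>v x) \<bullet>c y) + cnj (a * b * ((fcalc (conj_cauchy f) *\<^sub>v y) \<bullet>c x))) \<le> 2"
    using unit[OF u v] by simp
  also have "a * b * ((fcalc f *\<^sub>v x) \<bullet>c y) + cnj (a * b * ((fcalc (conj_cauchy f) *\<^sub>v y) \<bullet>c x))
     = a * b * ((fcalc f *\<^sub>v x) \<bullet>c y + cnj ((fcalc (conj_cauchy f) *\<^sub>v y) \<bullet>c x))"
    by (simp add: a_def b_def distrib_left)
  also have "cmod \<dots> = cmod ((fcalc f *\<^sub>v x) \<bullet>c y + cnj ((fcalc (conj_cauchy f) *\<^sub>v y) \<bullet>c x)) / (vnorm x * vnorm y)"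
    by (simp add: a_def b_def norm_mult norm_divide)
  finally show ?thesis using pos by (simp add: field_simps)
qed

text \<open>The functions admitted in the extremal problem are holomorphic beyond the curve, so that
  dilating \<open>conj_cauchy f\<close> slightly makes it admissible.\<close>

definition admissible :: "(complex \<Rightarrow> complex) \<Rightarrow> bool" where
  "admissible f \<longleftrightarrow> (\<exists>s>1. f holomorphic_on {z. P z < s}) \<and> (\<forall>z. P z \<le> 1 \<longrightarrow> cmod (f z) \<le> 1)"

text \<open>The product f g f, with g the Cauchy transform, is what the extremal argument produces.
  Since g is known only inside the curve, it enters through dilations; only its values at the
  finitely many \<open>d i\<close> have to converge, and g is continuous there.\<close>

lemma admissible_bound_sandwich:
  assumes f: "admissible f"
    and K: "\<And>f x. admissible f \<Longrightarrow> x \<in> carrier_vec n \<Longrightarrow> vnorm (fcalc f *\<^sub>v x) \<le> K * vnorm x"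
    and x: "x \<in> carrier_vec n" and y: "y \<in> carrier_vec n"
  shows "cmod ((fcalc (\<lambda>z. f z * conj_cauchy f z * f z) *\<^sub>v x) \<bullet>c y) \<le> K * vnorm x * vnorm y"
proof -
  obtain s where s: "1 < s" "f holomorphic_on {z. P z < s}" and f1: "\<And>z. P z \<le> 1 \<Longrightarrow> cmod (f z) \<le> 1"
    using f unfolding admissible_def by blast
  let ?g = "conj_cauchy f"
  let ?h = "\<lambda>r z. f z * ?g (of_real r * z) * f z"
  have Pr: "P (of_real r * z) = r * P z" if "0 \<le> r" for r z
    using P_scale[OF that, of z] by (simp add: scaleR_conv_of_real)
  have adm: "admissible (?h r)" if r: "0 < r" "r < 1" for r
    unfolding admissible_def
  proof (intro conjI exI allI impI)
    \<comment> \<open>On \<open>P z < 1 / r\<close> the dilated argument stays inside the curve, and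
      on \<open>P z < s\<close> the factors \<open>f\<close> are holomorphic.\<close>
    show "1 < min s (1 / r)" using s(1) r by simp
    have "(?g \<circ> (\<lambda>z. of_real r * z)) holomorphic_on {z. P z < min s (1 / r)}"
      by (rule holomorphic_on_compose_gen[OF _ conj_cauchy_holomorphic[OF s]])
         (use r in \<open>auto intro!: holomorphic_intros simp: Pr pos_less_divide_eq mult.commute[of _ r]\<close>)
    then show "?h r holomorphic_on {z. P z < min s (1 / r)}"
      unfolding o_def by (intro holomorphic_intros holomorphic_on_subset[OF s(2)]) auto
    fix z assume z: "P z \<le> 1"
    have "r * P z < 1" using r z P_nonneg[of z] by (smt (verit) mult_left_le)
    then have "cmod (?g (of_real r * z)) \<le> 1"
      using r by (intro norm_conj_cauchy_le[OF s f1]) (auto simp: Pr)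
    then have "cmod (f z) * cmod (?g (of_real r * z)) * cmod (f z) \<le> 1 * 1 * 1"
      using f1[OF z] by (intro mult_mono) auto
    then show "cmod (?h r z) \<le> 1" by (simp add: norm_mult)
  qed
  have "((\<lambda>r. (fcalc (?h r) *\<^sub>v x) \<bullet>c y) \<longlongrightarrow> (fcalc (?h 1) *\<^sub>v x) \<bullet>c y) (at_left 1)"
    unfolding fcalc_form[OF x y]
  proof (intro tendsto_intros)
    fix i assume "i \<in> {..<n}"
    then have "isCont ?g (d i)"
      using holomorphic_on_imp_continuous_on[OF conj_cauchy_holomorphic[OF s]] d_inside open_sublevel
      by (simp add: continuous_on_eq_continuous_at)
    moreover have "((\<lambda>r. of_real r * d i) \<longlongrightarrow> of_real 1 * d i) (at_left (1::real))"
      by (intro tendsto_intros)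
    ultimately show "((\<lambda>r. ?g (of_real r * d i)) \<longlongrightarrow> ?g (of_real 1 * d i)) (at_left (1::real))"
      using isCont_tendsto_compose by fastforce
  qed
  moreover have "cmod ((fcalc (?h r) *\<^sub>v x) \<bullet>c y) \<le> K * vnorm x * vnorm y" if r: "0 < r" "r < 1" for r
  proof -
    have "cmod ((fcalc (?h r) *\<^sub>v x) \<bullet>c y) \<le> vnorm (fcalc (?h r) *\<^sub>v x) * vnorm y"
      by (rule cauchy_schwarz[OF mult_mat_vec_carrier[OF fcalc_carrier x] y])
    also have "\<dots> \<le> (K * vnorm x) * vnorm y"
      by (rule mult_right_mono[OF K[OF adm[OF r] x]]) simp
    finally show ?thesis .
  qed
  then have "\<forall>\<^sub>F r in at_left 1. cmod ((fcalc (?h r) *\<^sub>v x) \<bullet>c y) \<le> K * vnorm x * vnorm y"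
    by (auto simp: eventually_at_left_field intro!: exI[of _ 0])
  ultimately have "cmod ((fcalc (?h 1) *\<^sub>v x) \<bullet>c y) \<le> K * vnorm x * vnorm y"
    by (rule Lim_norm_ubound[rotated]) simp
  then show ?thesis by simp
qed

text \<open>Put T = f(A), G = g(A), let y be the adjoint of T applied to a unit vector x, and z = T
  y. The squared norm of z is the form of T at (y, z). Completing it by the form of G costs 2 |y|
  |z| plus the modulus of the form of G at (z, y). The latter is the form of T G T at (y, x), at
  most K |y| by extremality. With |y| at most K, |z| at most K |y|, and |y|^2 at most |z|, the
  estimate follows for the adjoint of T.\<close>

lemma extremal_inequality:
  assumes f: "admissible f" and K1: "1 \<le> K"
    and K: "\<And>f x. admissible f \<Longrightarrow> x \<in> carrier_vec n \<Longrightarrow> vnorm (fcalc f *\<^sub>v x) \<le> K * vnorm x"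
    and v: "v \<in> carrier_vec n" "vnorm v = 1"
  shows "vnorm (fcalc f *\<^sub>v v) ^ 4 \<le> 2 * K ^ 3 + K\<^sup>2"
proof -
  obtain s where s: "1 < s" "f holomorphic_on {z. P z < s}" and f1: "\<And>z. P z \<le> 1 \<Longrightarrow> cmod (f z) \<le> 1"
    using f unfolding admissible_def by blast
  define T where "T = fcalc f"
  define G where "G = fcalc (conj_cauchy f)"
  have T: "T \<in> carrier_mat n n" and G: "G \<in> carrier_mat n n" by (simp_all add: T_def G_def)
  note Tc = mult_mat_vec_carrier[OF T] and Gc = mult_mat_vec_carrier[OF G]
    and T'c = mult_mat_vec_carrier[OF mat_adjoint_carrier[OF T]]
  have KT: "vnorm (T *\<^sub>v u) \<le> K * vnorm u" if "u \<in> carrier_vec n" for u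
    unfolding T_def by (rule K[OF f that])
  have adj: "vnorm (mat_adjoint T *\<^sub>v x) ^ 4 \<le> 2 * K ^ 3 + K\<^sup>2" if x: "x \<in> carrier_vec n" "vnorm x = 1" for x
  proof -
    define y where "y = mat_adjoint T *\<^sub>v x"
    define z where "z = T *\<^sub>v y"
    have y: "y \<in> carrier_vec n" unfolding y_def by (rule T'c[OF x(1)])
    have z: "z \<in> carrier_vec n" unfolding z_def by (rule Tc[OF y])
    define b where "b = vnorm y"
    have b0: "0 \<le> b" by (simp add: b_def)
    have zK: "vnorm z \<le> K * b" unfolding z_def b_def by (rule KT[OF y])
    have "of_real (b\<^sup>2) = z \<bullet>c x"
      using cscalar_prod_adjoint[OF T y x(1)] by (simp add: z_def b_def cscalar_prod_self flip: y_def)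
    then have "cmod (of_real (b\<^sup>2)) \<le> vnorm z"
      using cauchy_schwarz[OF z x(1)] x(2) by simp
    then have bz: "b\<^sup>2 \<le> vnorm z" unfolding norm_of_real by simp
    then have "b * b \<le> K * b" using zK by (simp add: power2_eq_square)
    then have bK: "b \<le> K" using K1 b0 by (cases "b = 0") auto
    have "of_real ((vnorm z)\<^sup>2) = (T *\<^sub>v y) \<bullet>c z"
      by (simp add: z_def cscalar_prod_self)
    also have "\<dots> = (T *\<^sub>v y) \<bullet>c z + cnj ((G *\<^sub>v z) \<bullet>c y) - cnj ((G *\<^sub>v z) \<bullet>c y)" by simp
    finally have "cmod (of_real ((vnorm z)\<^sup>2)) \<le> cmod ((T *\<^sub>v y) \<bullet>c z + cnj ((G *\<^sub>v z) \<bullet>c y)) + cmod ((G *\<^sub>v z) \<bullet>c y)"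
      by (metis complex_mod_cnj norm_triangle_ineq4)
    moreover have "cmod ((T *\<^sub>v y) \<bullet>c z + cnj ((G *\<^sub>v z) \<bullet>c y)) \<le> 2 * vnorm y * vnorm z"
      unfolding T_def G_def by (rule form_sum_bound[OF s f1 y z])
    moreover have "cmod ((G *\<^sub>v z) \<bullet>c y) \<le> K * b"
    proof -
      have "(G *\<^sub>v z) \<bullet>c y = (T *\<^sub>v (G *\<^sub>v (T *\<^sub>v y))) \<bullet>c x"
        using cscalar_prod_adjoint[OF T Gc[OF z] x(1)] by (simp add: z_def y_def)
      also have "T *\<^sub>v (G *\<^sub>v (T *\<^sub>v y)) = fcalc (\<lambda>z. f z * conj_cauchy f z * f z) *\<^sub>v y"
        unfolding fcalc_mult[symmetric] T_def[symmetric] G_def[symmetric]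
        using assoc_mult_mat_vec[OF mult_carrier_mat[OF T G] T y] assoc_mult_mat_vec[OF T G Tc[OF y]] by simp
      finally show ?thesis
        using admissible_bound_sandwich[OF f K y x(1)] x(2) by (simp add: b_def)
    qed
    ultimately have "(vnorm z)\<^sup>2 \<le> 2 * b * vnorm z + K * b" by (simp add: b_def norm_power)
    moreover have "2 * b * vnorm z \<le> 2 * K * (K * K)"
      using order_trans[OF zK mult_left_mono[OF bK]] bK b0 K1 by (intro mult_mono) auto
    moreover have "K * b \<le> K * K" using bK K1 by simp
    moreover have "b ^ 4 \<le> (vnorm z)\<^sup>2" using power_mono[OF bz, of 2] by simp
    ultimately show ?thesis by (simp add: b_def y_def power2_eq_square power3_eq_cube)
  qed
  \<comment> \<open>Passing from the adjoint back to \<open>T\<close>: the squared norm of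
    \<open>T *\<^sub>v v\<close> is the inner product of \<open>v\<close> with the adjoint applied
    to \<open>T *\<^sub>v v\<close>.\<close>
  define L where "L = root 4 (2 * K ^ 3 + K\<^sup>2)"
  have L0: "0 \<le> L" and L4: "L ^ 4 = 2 * K ^ 3 + K\<^sup>2"
    using K1 by (simp_all add: L_def)
  have adjL: "vnorm (mat_adjoint T *\<^sub>v u) \<le> L * vnorm u" if u: "u \<in> carrier_vec n" for u
  proof (rule vnorm_mult_le_from_unit[OF mat_adjoint_carrier[OF T] u])
    fix w assume w: "w \<in> carrier_vec n" "vnorm w = 1"
    have "vnorm (mat_adjoint T *\<^sub>v w) ^ 4 \<le> L ^ 4" unfolding L4 by (rule adj[OF w])
    then show "vnorm (mat_adjoint T *\<^sub>v w) \<le> L" by (rule power_le_imp_le_base[of _ 3, simplified]) (rule L0)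
  qed
  have "of_real ((vnorm (T *\<^sub>v v))\<^sup>2) = v \<bullet>c (mat_adjoint T *\<^sub>v (T *\<^sub>v v))"
    using cscalar_prod_adjoint[OF T v(1) Tc[OF v(1)]] by (simp add: cscalar_prod_self)
  then have "cmod (of_real ((vnorm (T *\<^sub>v v))\<^sup>2)) \<le> vnorm (mat_adjoint T *\<^sub>v (T *\<^sub>v v))"
    using cauchy_schwarz[OF v(1) T'c[OF Tc[OF v(1)]]] v(2) by simp
  also have "\<dots> \<le> L * vnorm (T *\<^sub>v v)" by (rule adjL[OF Tc[OF v(1)]])
  finally have "vnorm (T *\<^sub>v v) * vnorm (T *\<^sub>v v) \<le> L * vnorm (T *\<^sub>v v)"
    by (simp add: power2_eq_square norm_mult)
  then have "vnorm (T *\<^sub>v v) \<le> L"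
    using L0 vnorm_nonneg[of "T *\<^sub>v v"] by (cases "vnorm (T *\<^sub>v v) = 0") auto
  then have "vnorm (T *\<^sub>v v) ^ 4 \<le> L ^ 4" by (intro power_mono) auto
  then show ?thesis by (simp add: T_def L4)
qed

theorem crouzeix_palencia_diagonalizable:
  assumes f: "admissible f" and x: "x \<in> carrier_vec n"
  shows "vnorm (fcalc f *\<^sub>v x) \<le> (1 + sqrt 2) * vnorm x"
proof -
  \<comment> \<open>The inserted 1 keeps \<open>K\<close> at least 1 even for \<open>n = 0\<close>,
    where there are no unit vectors.\<close>
  define M where "M = insert 1 {vnorm (fcalc f *\<^sub>v v) |f v. admissible f \<and> v \<in> carrier_vec n \<and> vnorm v = 1}"
  define K where "K = Sup M"
  obtain C where C: "\<And>f x. (\<And>i. i < n \<Longrightarrow> cmod (f (d i)) \<le> 1) \<Longrightarrow> x \<in> carrier_vec n \<Longrightarrow>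
    vnorm (fcalc f *\<^sub>v x) \<le> C * vnorm x"
    using fcalc_bounded by blast
  have bdd: "bdd_above M"
  proof (rule bdd_aboveI[of _ "max 1 C"])
    fix k assume "k \<in> M"
    then consider "k = 1" | f v where "k = vnorm (fcalc f *\<^sub>v v)" "admissible f" "v \<in> carrier_vec n" "vnorm v = 1"
      unfolding M_def by blast
    then show "k \<le> max 1 C"
    proof cases
      case 2
      have "vnorm (fcalc f *\<^sub>v v) \<le> C * vnorm v"
        using 2 d_inside by (intro C) (auto simp: admissible_def less_imp_le)
      then show ?thesis using 2 by simp
    qed simp
  qed
  have K1: "1 \<le> K" unfolding K_def by (rule cSup_upper[OF _ bdd]) (simp add: M_def)
  have K: "vnorm (fcalc f *\<^sub>v u) \<le> K * vnorm u" if "admissible f" and u: "u \<in> carrier_vec n" for f u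
  proof (rule vnorm_mult_le_from_unit[OF fcalc_carrier u])
    fix w assume "w \<in> carrier_vec n" "vnorm w = 1"
    then show "vnorm (fcalc f *\<^sub>v w) \<le> K"
      unfolding K_def using that(1) by (intro cSup_upper bdd) (auto simp: M_def)
  qed
  define L where "L = root 4 (2 * K ^ 3 + K\<^sup>2)"
  have L0: "0 \<le> L" and L4: "L ^ 4 = 2 * K ^ 3 + K\<^sup>2"
    using K1 by (simp_all add: L_def)
  have "K \<le> L"
    unfolding K_def
  proof (rule cSup_least)
    fix k assume "k \<in> M"
    then consider "k = 1" | f v where "k = vnorm (fcalc f *\<^sub>v v)" "admissible f" "v \<in> carrier_vec n" "vnorm v = 1"
      unfolding M_def by blast
    then have "k ^ 4 \<le> L ^ 4"
    proof cases
      case 1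
      then show ?thesis using one_le_power[OF K1, of 2] one_le_power[OF K1, of 3] by (simp add: L4)
    next
      case 2
      then show ?thesis unfolding L4 using extremal_inequality[OF _ K1 K] by blast
    qed
    then show "k \<le> L" by (rule power_le_imp_le_base[of _ 3, simplified]) (rule L0)
  qed (simp add: M_def)
  then have "K ^ 4 \<le> 2 * K ^ 3 + K\<^sup>2" using power_mono[of K L 4] K1 L4 by simp
  \<comment> \<open>Cancelling \<open>K\<^sup>2\<close> leaves a quadratic inequality, and
    \<open>1 + sqrt 2\<close> is the larger root of the corresponding equation.\<close>
  then have "K\<^sup>2 * K\<^sup>2 \<le> K\<^sup>2 * (2 * K + 1)"
    by (simp add: algebra_simps power2_eq_square power3_eq_cube power4_eq_xxxx)
  then have "K\<^sup>2 \<le> 2 * K + 1" using K1 by (subst (asm) mult_le_cancel_left_pos) auto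
  then have "(K - 1)\<^sup>2 \<le> 2" by (simp add: power2_eq_square algebra_simps)
  then have "K \<le> 1 + sqrt 2" using real_le_rsqrt by fastforce
  then show ?thesis
    using K[OF f x] mult_right_mono[of K "1 + sqrt 2" "vnorm x"] by simp
qed

end

section \<open>The numerical range and the general Crouzeix--Palencia bound\<close>

lemma form_expand:
  fixes a b :: complex
  assumes M: "M \<in> carrier_mat n n" and x: "x \<in> carrier_vec n" and y: "y \<in> carrier_vec n"
  shows "(M *\<^sub>v (a \<cdot>\<^sub>v x + b \<cdot>\<^sub>v y)) \<bullet>c (a \<cdot>\<^sub>v x + b \<cdot>\<^sub>v y) =
    a * cnj a * ((M *\<^sub>v x) \<bullet>c x) + a * cnj b * ((M *\<^sub>v x) \<bullet>c y)
    + b * cnj a * ((M *\<^sub>v y) \<bullet>c x) + b * cnj b * ((M *\<^sub>v y) \<bullet>c y)"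
proof -
  have Mx: "M *\<^sub>v x \<in> carrier_vec n" "M *\<^sub>v y \<in> carrier_vec n"
    using mult_mat_vec_carrier[OF M] x y by auto
  have "M *\<^sub>v (a \<cdot>\<^sub>v x + b \<cdot>\<^sub>v y) = a \<cdot>\<^sub>v (M *\<^sub>v x) + b \<cdot>\<^sub>v (M *\<^sub>v y)"
    using mult_add_distrib_mat_vec[OF M, of "a \<cdot>\<^sub>v x" "b \<cdot>\<^sub>v y"] mult_mat_vec[OF M x, of a] mult_mat_vec[OF M y, of b] x y
    by simp
  then have "(M *\<^sub>v (a \<cdot>\<^sub>v x + b \<cdot>\<^sub>v y)) \<bullet>c (a \<cdot>\<^sub>v x + b \<cdot>\<^sub>v y)
      = (\<Sum>i<n. (a \<cdot>\<^sub>v (M *\<^sub>v x) + b \<cdot>\<^sub>v (M *\<^sub>v y)) $ i * cnj ((a \<cdot>\<^sub>v x + b \<cdot>\<^sub>v y) $ i))"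
    using Mx x y by (subst cscalar_prod_sum[of _ n]) auto
  also have "\<dots> = (\<Sum>i<n. (a * (M *\<^sub>v x) $ i + b * (M *\<^sub>v y) $ i) * cnj (a * x $ i + b * y $ i))"
    using M Mx x y by (intro sum.cong) (auto simp del: index_mult_mat_vec(1))
  also have "\<dots> = (\<Sum>i<n. a * cnj a * ((M *\<^sub>v x) $ i * cnj (x $ i)) + a * cnj b * ((M *\<^sub>v x) $ i * cnj (y $ i))
      + b * cnj a * ((M *\<^sub>v y) $ i * cnj (x $ i)) + b * cnj b * ((M *\<^sub>v y) $ i * cnj (y $ i)))"
    by (intro sum.cong refl) (simp only: complex_cnj_add complex_cnj_mult algebra_simps)
  finally show ?thesis
    unfolding cscalar_prod_sum[OF Mx(1) x] cscalar_prod_sum[OF Mx(1) y] cscalar_prod_sum[OF Mx(2) x]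
      cscalar_prod_sum[OF Mx(2) y] sum_distrib_left sum.distrib .
qed

lemma form_quotient_bound:
  fixes x :: "complex vec"
  assumes M: "M \<in> carrier_mat n n" and x: "x \<in> carrier_vec n" "x \<noteq> 0\<^sub>v n"
    and C: "vnorm (M *\<^sub>v x) \<le> C * vnorm x"
  shows "cmod (((M *\<^sub>v x) \<bullet>c x) / (x \<bullet>c x)) \<le> C"
proof -
  have pos: "0 < vnorm x" using x vnorm_eq_0_iff[OF x(1)] vnorm_nonneg[of x] by linarith
  have "cmod ((M *\<^sub>v x) \<bullet>c x) \<le> (C * vnorm x) * vnorm x"
    using cauchy_schwarz[OF mult_mat_vec_carrier[OF M x(1)] x(1)] mult_right_mono[OF C vnorm_nonneg[of x]]
    by linarith
  then show ?thesis
    unfolding norm_divide cscalar_prod_self norm_of_real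
    using pos by (simp add: pos_divide_le_eq power2_eq_square mult.assoc)
qed

text \<open>The Toeplitz--Hausdorff theorem: after an affine normalisation the form vanishes at \<open>x\<close> and
  equals the norm form at \<open>y\<close>; a rotation of \<open>x\<close> makes it real along the segment from \<open>x\<close> to \<open>y\<close>,
  and the intermediate value theorem applies.\<close>

theorem convex_num_range:
  assumes A: "A \<in> carrier_mat n n"
  shows "convex (num_range A)"
  unfolding convex_alt
proof (intro ballI allI impI)
  fix a b and t :: real assume ab: "a \<in> num_range A" "b \<in> num_range A" and t: "0 \<le> t \<and> t \<le> 1"
  show "(1 - t) *\<^sub>R a + t *\<^sub>R b \<in> num_range A"
  proof (cases "a = b")
    case True
    then have "(1 - t) *\<^sub>R a + t *\<^sub>R b = a" by (simp add: algebra_simps)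
    then show ?thesis using ab by simp
  next
    case False
    obtain x where x: "x \<in> carrier_vec n" "x \<noteq> 0\<^sub>v n" "((A *\<^sub>v x) \<bullet>c x) / (x \<bullet>c x) = a"
      using ab(1) unfolding num_range_iff[OF A] by blast
    obtain y where y: "y \<in> carrier_vec n" "y \<noteq> 0\<^sub>v n" "((A *\<^sub>v y) \<bullet>c y) / (y \<bullet>c y) = b"
      using ab(2) unfolding num_range_iff[OF A] by blast
    \<comment> \<open>The affine normalisation sends \<open>a\<close> to 0 and \<open>b\<close> to
      1: \<open>h u u / (u \<bullet>c u)\<close> is the normalised Rayleigh quotient at
      \<open>u\<close>.\<close>
    define h where "h = (\<lambda>u v. ((A *\<^sub>v u) \<bullet>c v - a * (u \<bullet>c v)) / (b - a))"
    have hx: "h x x = 0"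
      using x cscalar_prod_self_pos[OF x(1,2)] by (auto simp: h_def field_simps)
    have hy: "h y y = y \<bullet>c y"
      using y cscalar_prod_self_pos[OF y(1,2)] False by (auto simp: h_def field_simps)
    have h_expand: "h (\<alpha> \<cdot>\<^sub>v x + \<beta> \<cdot>\<^sub>v y) (\<alpha> \<cdot>\<^sub>v x + \<beta> \<cdot>\<^sub>v y) = \<alpha> * cnj \<beta> * h x y + \<beta> * cnj \<alpha> * h y x + \<beta> * cnj \<beta> * h y y" for \<alpha> \<beta>
    proof -
      have "h (\<alpha> \<cdot>\<^sub>v x + \<beta> \<cdot>\<^sub>v y) (\<alpha> \<cdot>\<^sub>v x + \<beta> \<cdot>\<^sub>v y) = \<alpha> * cnj \<alpha> * h x x + \<alpha> * cnj \<beta> * h x y + \<beta> * cnj \<alpha> * h y x + \<beta> * cnj \<beta> * h y y"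
        using form_expand[OF A x(1) y(1), of \<alpha> \<beta>] form_expand[OF one_carrier_mat x(1) y(1), of \<alpha> \<beta>] x y
        unfolding h_def by (simp add: algebra_simps diff_divide_distrib add_divide_distrib)
      then show ?thesis using hx by simp
    qed
    \<comment> \<open>The mixed terms of the form along the path add up to a number with the
      imaginary part of \<open>\<omega> * r\<close>.\<close>
    define r where "r = h x y - cnj (h y x)"
    define \<omega> where "\<omega> = (if r = 0 then 1 else cnj r / cmod r)"
    have \<omega>: "\<omega> \<noteq> 0" "Im (\<omega> * r) = 0"
      by (auto simp: \<omega>_def complex_norm_square[symmetric] mult.commute[of "cnj r"] power2_eq_square)
    define z where "z = (\<lambda>s::real. (of_real (1 - s) * \<omega>) \<cdot>\<^sub>v x + of_real s \<cdot>\<^sub>v y)"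
    have z: "z s \<in> carrier_vec n" for s using x y by (simp add: z_def)
    define m where "m = Re (\<omega> * h x y + cnj \<omega> * h y x)"
    have m: "\<omega> * h x y + cnj \<omega> * h y x = of_real m"
    proof -
      have "Im (\<omega> * h x y + cnj \<omega> * h y x) = Im (\<omega> * r)"
        by (simp add: r_def algebra_simps)
      then show ?thesis using \<omega>(2) by (simp add: complex_eq_iff m_def)
    qed
    have hz: "h (z s) (z s) = of_real (s * (1 - s) * m + s\<^sup>2 * (vnorm y)\<^sup>2)" for s
    proof -
      have "h (z s) (z s) = of_real (s * (1 - s)) * (\<omega> * h x y + cnj \<omega> * h y x) + of_real (s * s) * h y y"
        unfolding z_def h_expand by (simp add: algebra_simps)
      then show ?thesis unfolding m hy cscalar_prod_self by (simp add: power2_eq_square)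
    qed
    \<comment> \<open>A zero of the path at \<open>s \<noteq> 0\<close> would make \<open>y\<close>
      a multiple of \<open>x\<close>, forcing \<open>h y y = 0\<close> because
      \<open>h x x = 0\<close>.\<close>
    have z_ne: "z s \<noteq> 0\<^sub>v n" if "s \<in> {0..1}" for s
    proof
      assume z0: "z s = 0\<^sub>v n"
      have comp: "of_real (1 - s) * \<omega> * x $ i + of_real s * y $ i = 0" if "i < n" for i
        using arg_cong[OF z0, of "\<lambda>v. v $ i"] that x y by (simp add: z_def)
      show False
      proof (cases "s = 0")
        case True
        then have "x = 0\<^sub>v n" using comp \<omega>(1) x(1) by (intro eq_vecI) auto
        then show False using x by simp
      next
        case s: False
        have "0\<^sub>v n \<bullet>c 0\<^sub>v n = (0::complex)" "(A *\<^sub>v 0\<^sub>v n) \<bullet>c 0\<^sub>v n = 0"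
          using mult_mat_vec_zero[OF A] by (simp_all add: cscalar_prod_sum[of _ n])
        have yx: "y = (- of_real (1 - s) * \<omega> / of_real s) \<cdot>\<^sub>v x + 0 \<cdot>\<^sub>v y"
        proof (rule eq_vecI)
          fix i assume "i < dim_vec ((- of_real (1 - s) * \<omega> / of_real s) \<cdot>\<^sub>v x + 0 \<cdot>\<^sub>v y)"
          then have i: "i < n" using y by simp
          then show "y $ i = ((- of_real (1 - s) * \<omega> / of_real s) \<cdot>\<^sub>v x + 0 \<cdot>\<^sub>v y) $ i"
            using comp[OF i] s x y by (simp add: field_simps eq_neg_iff_add_eq_0 add.commute)
        qed (use y in simp)
        have "h y y = 0" by (subst (1 2) yx) (simp add: h_expand)
        then show False using hy cscalar_prod_self_pos[OF y(1,2)] by simp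
      qed
    qed
    define N where "N = (\<lambda>s. (vnorm (z s))\<^sup>2)"
    have N_pos: "0 < N s" if "s \<in> {0..1}" for s
      using z_ne[OF that] vnorm_eq_0_iff[OF z, of s] by (simp add: N_def)
    have N_eq: "N s = Re ((z s) \<bullet>c (z s))" for s by (simp add: cscalar_prod_self N_def)
    have "continuous_on {0..1} N"
    proof -
      have "z s \<bullet>c z s = of_real (1 - s) * \<omega> * cnj (of_real (1 - s) * \<omega>) * (x \<bullet>c x) +
          of_real (1 - s) * \<omega> * cnj (of_real s) * (x \<bullet>c y) + of_real s * cnj (of_real (1 - s) * \<omega>) * (y \<bullet>c x)
          + of_real s * cnj (of_real s) * (y \<bullet>c y)" for s
        using form_expand[OF one_carrier_mat x(1) y(1), of "of_real (1 - s) * \<omega>" "of_real s"] x y z[of s]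
        unfolding z_def by simp
      then show ?thesis unfolding N_eq by (intro continuous_intros) (auto intro!: continuous_intros)
    qed
    then have "continuous_on {0..1} (\<lambda>s. (s * (1 - s) * m + s\<^sup>2 * (vnorm y)\<^sup>2) / N s)"
      using N_pos by (intro continuous_intros) fastforce+
    moreover have "N 1 = (vnorm y)\<^sup>2"
    proof -
      have "z 1 = y" using x y by (intro eq_vecI) (auto simp: z_def)
      then show ?thesis by (simp add: N_def)
    qed
    then have "(1 * (1 - 1) * m + 1\<^sup>2 * (vnorm y)\<^sup>2) / N 1 = 1" using N_pos[of 1] by simp
    ultimately obtain s where s: "s \<in> {0..1}" "(s * (1 - s) * m + s\<^sup>2 * (vnorm y)\<^sup>2) / N s = t"
      using IVT'[of "\<lambda>s. (s * (1 - s) * m + s\<^sup>2 * (vnorm y)\<^sup>2) / N s" 0 t 1] t by auto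
    have zz: "z s \<bullet>c z s = of_real (N s)" by (simp add: cscalar_prod_self N_def)
    have "h (z s) (z s) = of_real (t * N s)"
      unfolding hz using s N_pos[OF s(1)] by (simp add: field_simps flip: of_real_mult)
    then have "(A *\<^sub>v z s) \<bullet>c z s = a * of_real (N s) + (b - a) * of_real (t * N s)"
      using False zz by (simp add: h_def field_simps)
    then have "((A *\<^sub>v z s) \<bullet>c z s) / (z s \<bullet>c z s) = a + (b - a) * of_real t"
      unfolding zz using N_pos[OF s(1)] by (simp add: field_simps)
    moreover have "a + (b - a) * of_real t = (1 - t) *\<^sub>R a + t *\<^sub>R b"
      by (simp add: scaleR_conv_of_real algebra_simps)
    ultimately show ?thesis
      unfolding num_range_iff[OF A] using z z_ne[OF s(1)] by (intro CollectI exI[of _ "z s"]) auto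
  qed
qed

lemma bounded_num_range:
  assumes A: "A \<in> carrier_mat n n"
  shows "bounded (num_range A)"
proof -
  obtain C where C: "0 \<le> C" "\<And>x. x \<in> carrier_vec n \<Longrightarrow> vnorm (A *\<^sub>v x) \<le> C * vnorm x"
    using exists_opnorm_bound[OF A] by blast
  have "cmod w \<le> C" if w: "w \<in> num_range A" for w
  proof -
    obtain x where x: "x \<in> carrier_vec n" "x \<noteq> 0\<^sub>v n" "w = ((A *\<^sub>v x) \<bullet>c x) / (x \<bullet>c x)"
      using w unfolding num_range_iff[OF A] by blast
    then show ?thesis using form_quotient_bound[OF A x(1,2) C(2)[OF x(1)]] by simp
  qed
  then show ?thesis by (auto simp: bounded_iff)
qed

section \<open>Approximation by diagonalizable matrices\<close>

lemma exists_inverse_mat: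
  fixes S :: "complex mat"
  assumes S: "S \<in> carrier_mat n n" and inj: "\<And>c. c \<in> carrier_vec n \<Longrightarrow> S *\<^sub>v c = 0\<^sub>v n \<Longrightarrow> c = 0\<^sub>v n"
  obtains Q where "Q \<in> carrier_mat n n" "S * Q = 1\<^sub>m n" "Q * S = 1\<^sub>m n"
proof -
  have "Determinant.det S \<noteq> 0"
    using det_0_iff_vec_prod_zero[OF S] inj by blast
  from det_non_zero_imp_unit[OF S this, of undefined] that show ?thesis
    by (auto simp: Units_def ring_mat_def)
qed

lemma diagonalization_distinct:
  assumes B: "B \<in> carrier_mat n n" and ut: "upper_triangular B"
    and inj: "inj_on (\<lambda>i. B $$ (i, i)) {..<n}"
  obtains S Q where "diagonalization n S Q" "B = S * mat_diag n (\<lambda>i. B $$ (i, i)) * Q"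
proof -
  define b where "b = (\<lambda>i. B $$ (i, i))"
  have "\<exists>v. eigenvector B v (b i)" if i: "i < n" for i
  proof -
    have "b i \<in> set (diag_mat B)" using i B by (auto simp: diag_mat_def b_def)
    then have "poly (char_poly B) (b i) = 0"
      by (auto simp: char_poly_upper_triangular[OF B ut] poly_prod_list prod_list_zero_iff)
    then show ?thesis using eigenvalue_root_char_poly[OF B] by (auto simp: eigenvalue_def)
  qed
  then obtain v where v: "\<And>i. i < n \<Longrightarrow> eigenvector B (v i) (b i)" by metis
  have vc: "v i \<in> carrier_vec n" "v i \<noteq> 0\<^sub>v n" "B *\<^sub>v v i = b i \<cdot>\<^sub>v v i" if "i < n" for i
    using v[OF that] B by (auto simp: eigenvector_def)
  define S where "S = Matrix.mat n n (\<lambda>(r, i). v i $ r)"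
  let ?D = "mat_diag n b"
  have S: "S \<in> carrier_mat n n" by (simp add: S_def)
  have colS: "col S i = v i" if "i < n" for i
    using that vc(1)[OF that] by (intro eq_vecI) (auto simp: S_def)
  have BS: "B * S = S * ?D"
  proof (rule eq_matI)
    fix r i assume "r < dim_row (S * ?D)" "i < dim_col (S * ?D)"
    then have ri: "r < n" "i < n" using S by (auto simp: mat_diag_def)
    have "(B * S) $$ (r, i) = (B *\<^sub>v v i) $ r"
      using ri B S by (simp add: colS)
    also have "\<dots> = (S * ?D) $$ (r, i)"
    proof -
      have "(S * ?D) $$ (r, i) = S $$ (r, i) * b i"
        using ri by (simp add: mat_diag_mult_right[OF S])
      moreover have "S $$ (r, i) = v i $ r" using ri by (simp add: S_def)
      moreover have "dim_vec (v i) = n" using vc(1)[OF ri(2)] by simp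
      ultimately show ?thesis using ri unfolding vc(3)[OF ri(2)] by simp
    qed
    finally show "(B * S) $$ (r, i) = (S * ?D) $$ (r, i)" .
  qed (use B S in \<open>auto simp: mat_diag_def\<close>)
  have "c = 0\<^sub>v n" if c: "c \<in> carrier_vec n" and Sc: "S *\<^sub>v c = 0\<^sub>v n" for c
  proof (rule eq_vecI)
    fix i assume "i < dim_vec (0\<^sub>v n :: complex vec)"
    then have i: "i < n" by simp
    \<comment> \<open>Up to a factor the Lagrange polynomial for \<open>b i\<close>: applied to
      \<open>B\<close> it removes all other eigenvectors from a vanishing combination, so the
      coefficient \<open>c $ i\<close> must be zero.\<close>
    define p where "p = (\<Prod>j\<in>{..<n} - {i}. [:- b j, 1:])"
    have p0: "poly p (b j) = 0" if "j < n" "j \<noteq> i" for j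
      using that by (auto simp: p_def poly_prod)
    have pi: "poly p (b i) \<noteq> 0"
      using inj i by (auto simp: p_def poly_prod inj_on_def b_def)
    let ?Dp = "mat_diag n (\<lambda>i. poly p (b i))"
    have Dp: "?Dp \<in> carrier_mat n n" by simp
    have "mpoly p B * S = S * ?Dp"
      using mpoly_intertwine[OF B mat_diag_dim S BS, of p] by (simp add: mpoly_mat_diag)
    then have "S *\<^sub>v (?Dp *\<^sub>v c) = mpoly p B *\<^sub>v (S *\<^sub>v c)"
      using assoc_mult_mat_vec[OF S Dp c] assoc_mult_mat_vec[OF mpoly_carrier[OF B] S c, of p] by simp
    then have "S *\<^sub>v (?Dp *\<^sub>v c) = 0\<^sub>v n"
      unfolding Sc using mult_mat_vec_zero[OF mpoly_carrier[OF B]] by simp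
    moreover have "?Dp *\<^sub>v c = (poly p (b i) * c $ i) \<cdot>\<^sub>v unit_vec n i"
      using c i p0 by (intro eq_vecI) (auto simp: mat_diag_def scalar_prod_def mult_delta_left)
    moreover have "S *\<^sub>v unit_vec n i = v i"
      using S i vc(1)[OF i] by (intro eq_vecI) (auto simp: S_def)
    ultimately have "(poly p (b i) * c $ i) \<cdot>\<^sub>v v i = 0\<^sub>v n"
      using mult_mat_vec[OF S, of "unit_vec n i"] by simp
    then have "vnorm ((poly p (b i) * c $ i) \<cdot>\<^sub>v v i) = 0"
      using vnorm_eq_0_iff[of "0\<^sub>v n" n] by simp
    then have "cmod (poly p (b i) * c $ i) * vnorm (v i) = 0"
      unfolding vnorm_smult .
    then show "c $ i = 0\<^sub>v n $ i"
      using pi vc(2)[OF i] vnorm_eq_0_iff[OF vc(1)[OF i]] i by simp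
  qed (use c in simp)
  then obtain Q where Q: "Q \<in> carrier_mat n n" "S * Q = 1\<^sub>m n" "Q * S = 1\<^sub>m n"
    using exists_inverse_mat[OF S] by blast
  have "B = B * (S * Q)" using B by (simp add: Q right_mult_one_mat[OF B])
  also have "\<dots> = S * ?D * Q" using assoc_mult_mat[OF B S Q(1)] by (simp add: BS)
  finally show ?thesis
    using that[of S Q] S Q by (simp add: diagonalization_def b_def)
qed

text \<open>In a Schur basis the diagonal is shifted by e times 0, 1, 2 and so on. For small e > 0
  equal diagonal entries become separated and distinct ones remain so. The direction
  \<open>E\<close> does not depend on e, so polynomials of the perturbed matrix converge
  entrywise.\<close>

lemma diagonalizable_perturbation:
  fixes A :: "complex mat"
  assumes A: "A \<in> carrier_mat n n"
  obtains E where "E \<in> carrier_mat n n"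
    "\<forall>\<^sub>F e in at_right 0. \<exists>S Q d. diagonalization n S Q \<and> A + complex_of_real e \<cdot>\<^sub>m E = S * mat_diag n d * Q"
proof -
  obtain as where as: "char_poly A = (\<Prod>a\<leftarrow>as. [:- a, 1:])"
    using char_poly_factorized[OF A] by blast
  obtain B R R' where "schur_decomposition A as = (B, R, R')" by (metis prod_cases3)
  from schur_decomposition[OF A as this] have sim: "similar_mat_wit A B R R'" and ut: "upper_triangular B" by auto
  note w = similar_mat_witD2[OF A sim]
  let ?N = "mat_diag n (\<lambda>i. of_nat i :: complex)"
  define E where "E = R * ?N * R'"
  have N: "?N \<in> carrier_mat n n" by simp
  have E: "E \<in> carrier_mat n n" unfolding E_def by (intro mult_carrier_mat[of _ n n] w N)
  have "\<forall>\<^sub>F e in at_right 0. B $$ (i, i) + of_real e * of_nat i \<noteq> B $$ (j, j) + of_real e * of_nat j"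
    if "i \<noteq> j" for i j :: nat
  proof (cases "B $$ (i, i) = B $$ (j, j)")
    case True
    then show ?thesis using that
      by (auto simp: eventually_at_filter)
  next
    case False
    have "((\<lambda>e. (B $$ (i, i) + of_real e * of_nat i) - (B $$ (j, j) + of_real e * of_nat j)) \<longlongrightarrow>
      (B $$ (i, i) + of_real 0 * of_nat i) - (B $$ (j, j) + of_real 0 * of_nat j)) (at_right 0)"
      by (intro tendsto_intros)
    from tendsto_imp_eventually_ne[OF this, of 0] False show ?thesis by simp
  qed
  then have "\<forall>\<^sub>F e in at_right 0. \<forall>p\<in>{p \<in> {..<n} \<times> {..<n}. fst p \<noteq> snd p}.
      B $$ (fst p, fst p) + of_real e * of_nat (fst p) \<noteq> B $$ (snd p, snd p) + of_real e * of_nat (snd p)"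
    by (intro eventually_ball_finite) auto
  then have "\<forall>\<^sub>F e in at_right 0. \<exists>S Q d. diagonalization n S Q \<and> A + complex_of_real e \<cdot>\<^sub>m E = S * mat_diag n d * Q"
  proof eventually_elim
    case (elim e)
    define B' where "B' = B + complex_of_real e \<cdot>\<^sub>m ?N"
    have B': "B' \<in> carrier_mat n n" using w by (simp add: B'_def)
    have diag: "B' $$ (i, i) = B $$ (i, i) + of_real e * of_nat i" if "i < n" for i
      using that w by (simp add: B'_def mat_diag_def)
    have "upper_triangular B'"
      using ut w by (auto simp: upper_triangular_def B'_def mat_diag_def)
    moreover have "inj_on (\<lambda>i. B' $$ (i, i)) {..<n}"
      using elim by (auto simp: inj_on_def diag)
    ultimately obtain S Q where dec: "diagonalization n S Q" "B' = S * mat_diag n (\<lambda>i. B' $$ (i, i)) * Q"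
      using diagonalization_distinct[OF B'] by blast
    interpret diagonalization n S Q by (rule dec)
    let ?D = "mat_diag n (\<lambda>i. B' $$ (i, i))"
    have D: "?D \<in> carrier_mat n n" by simp
    note mc = mult_carrier_mat[of _ n n _ n] and am = assoc_mult_mat[of _ n n _ n _ n]
    have "A + complex_of_real e \<cdot>\<^sub>m E = R * B' * R'"
      using w N by (simp add: B'_def E_def mult_add_distrib_mat[of R n n _ n] add_mult_distrib_mat[of _ n n _ _ n] mc
          mult_smult_distrib[of R n n _ n] mult_smult_assoc_mat[of _ n n _ n])
    also have "\<dots> = R * (S * ?D * Q) * R'" using dec(2) by simp
    also have "\<dots> = (R * S) * ?D * (Q * R')"
      using w D S Q by (simp add: am mc)
    finally have eq: "A + complex_of_real e \<cdot>\<^sub>m E = (R * S) * ?D * (Q * R')" .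
    have "R * S * (Q * R') = R * (S * Q) * R'" using w S Q by (simp add: am mc)
    then have 1: "R * S * (Q * R') = 1\<^sub>m n" using w by (simp add: SQ)
    have "R' * (R * S) = R' * R * S" by (rule assoc_mult_mat[OF w(7) w(6) S, symmetric])
    then have RS: "R' * (R * S) = S" unfolding w(2) left_mult_one_mat[OF S] .
    have "Q * R' * (R * S) = Q * (R' * (R * S))"
      using w S Q by (intro assoc_mult_mat[of _ n n _ n _ n] mc)
    then have 2: "Q * R' * (R * S) = 1\<^sub>m n" by (simp add: RS QS)
    have "diagonalization n (R * S) (Q * R')"
      using w S Q 1 2 by (simp add: diagonalization_def mc)
    with eq show ?case by blast
  qed
  with E show ?thesis by (rule that)
qed

lemma mpoly_smult_vec:
  assumes A: "A \<in> carrier_mat n n" and x: "x \<in> carrier_vec n"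
  shows "mpoly (Polynomial.smult k q) A *\<^sub>v x = k \<cdot>\<^sub>v (mpoly q A *\<^sub>v x)"
proof (induction q)
  case 0
  then show ?case using A x by (auto intro!: eq_vecI simp: scalar_prod_def)
next
  case (pCons a q)
  have qx: "mpoly q A *\<^sub>v x \<in> carrier_vec n" by (rule mult_mat_vec_carrier[OF mpoly_carrier[OF A] x])
  show ?case
    using qx x mult_mat_vec_carrier[OF A qx]
    by (simp add: mpoly_mult_mat_vec[OF A x] pCons.IH mult_mat_vec[OF A qx] smult_add_distrib_vec[of _ n] smult_smult_assoc)
qed

lemma mpoly_perturbation_tendsto:
  assumes A: "A \<in> carrier_mat n n" and E: "E \<in> carrier_mat n n" and x: "x \<in> carrier_vec n" and "i < n"
  shows "((\<lambda>e. (mpoly p (A + complex_of_real e \<cdot>\<^sub>m E) *\<^sub>v x) $ i) \<longlongrightarrow> (mpoly p A *\<^sub>v x) $ i) (at_right 0)"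
  using \<open>i < n\<close>
proof (induction p arbitrary: i)
  case 0
  have AE: "A + complex_of_real e \<cdot>\<^sub>m E \<in> carrier_mat n n" for e using A E by simp
  show ?case by (simp add: mpoly_0[OF AE] mpoly_0[OF A])
next
  case (pCons a p)
  have AE: "A + complex_of_real e \<cdot>\<^sub>m E \<in> carrier_mat n n" for e using A E by simp
  have eq: "(mpoly (pCons a p) M *\<^sub>v x) $ i = a * x $ i + (\<Sum>j<n. M $$ (i, j) * (mpoly p M *\<^sub>v x) $ j)"
    if M: "M \<in> carrier_mat n n" for M
  proof -
    have px: "mpoly p M *\<^sub>v x \<in> carrier_vec n" by (rule mult_mat_vec_carrier[OF mpoly_carrier[OF M] x])
    have "(M *\<^sub>v u) $ i = (\<Sum>j<n. M $$ (i, j) * u $ j)" if "u \<in> carrier_vec n" for u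
      using M that pCons.prems by (simp add: scalar_prod_def atLeast0LessThan)
    from this[OF px] have "(M *\<^sub>v (mpoly p M *\<^sub>v x)) $ i = (\<Sum>j<n. M $$ (i, j) * (mpoly p M *\<^sub>v x) $ j)" .
    then show ?thesis
      using pCons.prems x M by (simp add: mpoly_mult_mat_vec[OF M x] del: index_mult_mat_vec(1))
  qed
  have "((\<lambda>e. a * x $ i + (\<Sum>j<n. (A $$ (i, j) + of_real e * E $$ (i, j)) * (mpoly p (A + complex_of_real e \<cdot>\<^sub>m E) *\<^sub>v x) $ j))
    \<longlongrightarrow> a * x $ i + (\<Sum>j<n. (A $$ (i, j) + of_real 0 * E $$ (i, j)) * (mpoly p A *\<^sub>v x) $ j)) (at_right 0)"
    by (intro tendsto_intros pCons.IH) auto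
  moreover have "(A + complex_of_real e \<cdot>\<^sub>m E) $$ (i, j) = A $$ (i, j) + of_real e * E $$ (i, j)" if "j < n" for e j
    using that pCons.prems A E by simp
  ultimately show ?case
    unfolding eq[OF AE] eq[OF A] by simp
qed

lemma vnorm_mpoly_perturbation_tendsto:
  assumes A: "A \<in> carrier_mat n n" and E: "E \<in> carrier_mat n n" and x: "x \<in> carrier_vec n"
  shows "((\<lambda>e. vnorm (mpoly p (A + complex_of_real e \<cdot>\<^sub>m E) *\<^sub>v x)) \<longlongrightarrow> vnorm (mpoly p A *\<^sub>v x)) (at_right 0)"
proof -
  have AE: "A + complex_of_real e \<cdot>\<^sub>m E \<in> carrier_mat n n" for e using A E by simp
  have dim: "dim_vec (mpoly p M *\<^sub>v x) = n" if "M \<in> carrier_mat n n" for M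
    using mpoly_carrier[OF that, of p] by simp
  show ?thesis
    unfolding vnorm_def dim[OF AE] dim[OF A]
    by (intro tendsto_intros mpoly_perturbation_tendsto[OF A E x]) auto
qed

text \<open>For \<open>k > C\<close> the quotient of p by k q has modulus below 1 on an open
  neighbourhood of the closed numerical range. This slack makes room for a smooth curve, and then
  for a diagonalizable perturbation inside it. First the perturbation tends to 0 for fixed
  \<open>k\<close>, then \<open>k\<close> tends to \<open>C\<close>.\<close>

theorem crouzeix_palencia:
  assumes A: "A \<in> carrier_mat n n" and x: "x \<in> carrier_vec n" and C: "0 \<le> C"
    and pq: "\<And>z. z \<in> closure (num_range A) \<Longrightarrow> poly q z \<noteq> 0 \<and> cmod (poly p z) \<le> C * cmod (poly q z)"
  shows "vnorm (mpoly p A *\<^sub>v x) \<le> (1 + sqrt 2) * C * vnorm (mpoly q A *\<^sub>v x)"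
proof (cases "n = 0")
  case True
  have "vnorm v = 0" if "v \<in> carrier_vec 0" for v :: "complex vec" using that by (simp add: vnorm_def)
  then show ?thesis
    using True mult_mat_vec_carrier[OF mpoly_carrier[OF A] x, of p] mult_mat_vec_carrier[OF mpoly_carrier[OF A] x, of q] by simp
next
  case False
  have bound: "vnorm (mpoly p A *\<^sub>v x) \<le> (1 + sqrt 2) * (k * vnorm (mpoly q A *\<^sub>v x))" if k: "C < k" for k
  proof -
    define V where "V = {z. cmod (poly p z) < k * cmod (poly q z)}"
    have "open V" unfolding V_def by (intro open_Collect_less continuous_intros)
    moreover have "closure (num_range A) \<subseteq> V"
      using pq k mult_strict_right_mono[OF k] unfolding V_def by (fastforce intro: order.strict_trans1)
    moreover have "num_range A \<noteq> {}" using num_range_nonempty[OF A False] .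
    ultimately obtain P \<gamma> \<gamma>' c\<^sub>0 c\<^sub>1 c s \<eta> where curve: "convex_curve P \<gamma> \<gamma>' c\<^sub>0 c\<^sub>1" and s: "1 < s" and \<eta>: "0 < \<eta>"
      and inner: "\<And>w v. w \<in> num_range A \<Longrightarrow> norm (v - w) \<le> \<eta> \<Longrightarrow> P (v - c) < 1"
      and outer: "\<And>z. P z < s \<Longrightarrow> z + c \<in> V"
      using exists_convex_curve_between[OF convex_num_range[OF A] bounded_num_range[OF A]] by metis
    obtain E where E: "E \<in> carrier_mat n n" and ev: "\<forall>\<^sub>F e in at_right 0. \<exists>S Q d. diagonalization n S Q \<and>
        A + complex_of_real e \<cdot>\<^sub>m E = S * mat_diag n d * Q"
      using diagonalizable_perturbation[OF A] by blast
    obtain CE where CE: "0 \<le> CE" "\<And>x. x \<in> carrier_vec n \<Longrightarrow> vnorm (E *\<^sub>v x) \<le> CE * vnorm x"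
      using exists_opnorm_bound[OF E] by blast
    have "((\<lambda>e::real. e * CE) \<longlongrightarrow> 0 * CE) (at_right 0)" by (intro tendsto_intros)
    \<comment> \<open>Rayleigh quotients of the perturbed matrix differ from those of
      \<open>A\<close> by at most \<open>e * CE\<close>, hence stay within the margin
      \<open>\<eta>\<close>.\<close>
    then have ev2: "\<forall>\<^sub>F e in at_right 0. e * CE < \<eta>"
      using \<eta> by (intro order_tendstoD(2)[of "\<lambda>e. e * CE"]) auto
    have "\<forall>\<^sub>F e in at_right 0. vnorm (mpoly p (A + complex_of_real e \<cdot>\<^sub>m E) *\<^sub>v x) \<le>
        (1 + sqrt 2) * vnorm (mpoly (Polynomial.smult (of_real k) q) (A + complex_of_real e \<cdot>\<^sub>m E) *\<^sub>v x)"
      using ev ev2 eventually_at_right_less[of "0::real"]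
    proof eventually_elim
      case (elim e)
      define A' where "A' = A + complex_of_real e \<cdot>\<^sub>m E"
      have A': "A' \<in> carrier_mat n n" using A E by (simp add: A'_def)
      obtain S Q d where dg: "diagonalization n S Q" and eq: "A' = S * mat_diag n d * Q"
        using elim(1) unfolding A'_def by blast
      interpret D: diagonalization n S Q d by (rule dg)
      \<comment> \<open>The gauge is centred at 0, so the eigenvalues are translated by
        \<open>c\<close>.\<close>
      interpret D': diagonalization n S Q "\<lambda>i. d i - c" by (rule dg)
      have shift: "D'.fcalc f = D.fcalc (\<lambda>z. f (z - c))" for f
        by (simp add: D.fcalc_def D'.fcalc_def)
      have A'_eq: "A' = D.fcalc (\<lambda>z. z)" by (simp add: D.fcalc_def eq)
      have "curve_around_range P \<gamma> \<gamma>' c\<^sub>0 c\<^sub>1 n S Q (\<lambda>i. d i - c)"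
      proof (intro curve_around_range.intro curve curve_around_range_axioms.intro dg)
        fix w' assume "w' \<in> num_range (D'.fcalc (\<lambda>z. z))"
        then obtain y where y: "y \<in> carrier_vec n" "y \<noteq> 0\<^sub>v n"
          and w'_eq: "w' = ((D'.fcalc (\<lambda>z. z) *\<^sub>v y) \<bullet>c y) / (y \<bullet>c y)"
          unfolding num_range_iff[OF D'.fcalc_carrier] by blast
        have yy: "y \<bullet>c y \<noteq> 0" by (rule cscalar_prod_self_pos[OF y])
        have Ay: "A *\<^sub>v y \<in> carrier_vec n" and Ey: "E *\<^sub>v y \<in> carrier_vec n"
          using mult_mat_vec_carrier[OF _ y(1)] A E by auto
        have A'y: "A' *\<^sub>v y = A *\<^sub>v y + of_real e \<cdot>\<^sub>v (E *\<^sub>v y)"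
        proof -
          have "complex_of_real e \<cdot>\<^sub>m E *\<^sub>v y = of_real e \<cdot>\<^sub>v (E *\<^sub>v y)"
            using E y by (intro eq_vecI) auto
          then show ?thesis using A E y by (simp add: A'_def add_mult_distrib_mat_vec[of _ n n])
        qed
        define w where "w = ((A *\<^sub>v y) \<bullet>c y) / (y \<bullet>c y)"
        define v where "v = ((A' *\<^sub>v y) \<bullet>c y) / (y \<bullet>c y)"
        have "v - w = of_real e * (((E *\<^sub>v y) \<bullet>c y) / (y \<bullet>c y))"
          unfolding w_def v_def A'y using y Ay Ey
          by (simp add: cscalar_prod_add_left[of _ n] cscalar_prod_smult_left[of _ n] add_divide_distrib)
        also have "cmod \<dots> \<le> e * CE"
        proof -
          have "cmod (((E *\<^sub>v y) \<bullet>c y) / (y \<bullet>c y)) \<le> CE"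
            by (rule form_quotient_bound[OF E y CE(2)[OF y(1)]])
          then show ?thesis
            unfolding norm_mult using elim(3) by (intro mult_mono) auto
        qed
        finally have "cmod (v - w) \<le> \<eta>" using elim(2) by simp
        moreover have "w \<in> num_range A" unfolding num_range_iff[OF A] w_def using y by blast
        ultimately have "P (v - c) < 1" by (intro inner)
        moreover have "(D'.fcalc (\<lambda>z. z) *\<^sub>v y) \<bullet>c y / (y \<bullet>c y) = v - c"
        proof -
          have "(D'.fcalc (\<lambda>z. z) *\<^sub>v y) \<bullet>c y = (A' *\<^sub>v y) \<bullet>c y - c * (y \<bullet>c y)"
            unfolding shift A'_eq D.fcalc_form[OF y(1) y(1)] D.coef_sum[OF y(1) y(1), symmetric]
            by (simp add: left_diff_distrib sum_subtractf sum_distrib_left)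
          then show ?thesis using yy by (simp add: v_def diff_divide_distrib)
        qed
        ultimately show "P w' < 1" unfolding w'_eq by simp
      qed
      then interpret curve_around_range P \<gamma> \<gamma>' c\<^sub>0 c\<^sub>1 n S Q "\<lambda>i. d i - c" .
      let ?q = "Polynomial.smult (of_real k) q"
      define f where "f = (\<lambda>z. poly p (z + c) / poly ?q (z + c))"
      have q0: "cmod (poly p (z + c)) < cmod (poly ?q (z + c))" if "P z < s" for z
        using outer[OF that] k C by (simp add: V_def norm_mult)
      then have q0': "poly ?q (z + c) \<noteq> 0" if "P z < s" for z using that by fastforce
      have adm: "admissible f"
        unfolding admissible_def
      proof (intro conjI exI allI impI)
        show "f holomorphic_on {z. P z < s}"
          unfolding f_def using q0' by (intro holomorphic_intros) auto
        fix z assume "P z \<le> 1"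
        then have "P z < s" using s by simp
        from q0[OF this] q0'[OF this] show "cmod (f z) \<le> 1"
          by (simp add: f_def norm_divide del: poly_smult)
      qed (rule s)
      \<comment> \<open>An identity between values at the eigenvalues, which lie inside the curve,
        where the denominator has no zero.\<close>
      have "D'.fcalc f * mpoly ?q A' = mpoly p A'"
      proof -
        have "d i - c + c = d i" for i by simp
        then have "f (d i - c) * poly ?q (d i) = poly p (d i)" if "i < n" for i
          using q0'[of "d i - c"] d_inside[OF that] s unfolding f_def by simp
        then have "mat_diag n (\<lambda>i. f (d i - c) * poly ?q (d i)) = mat_diag n (\<lambda>i. poly p (d i))"
          unfolding mat_diag_def by (intro eq_matI) (auto simp del: poly_smult)
        then show ?thesis
          unfolding A'_eq D.fcalc_mpoly shift D.fcalc_mult unfolding D.fcalc_def by (simp del: poly_smult)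
      qed
      then have "mpoly p A' *\<^sub>v x = D'.fcalc f * mpoly ?q A' *\<^sub>v x" by (simp only:)
      also have "\<dots> = D'.fcalc f *\<^sub>v (mpoly ?q A' *\<^sub>v x)"
        by (rule assoc_mult_mat_vec[OF D'.fcalc_carrier mpoly_carrier[OF A'] x])
      finally have "mpoly p A' *\<^sub>v x = D'.fcalc f *\<^sub>v (mpoly ?q A' *\<^sub>v x)" .
      then show ?case
        using crouzeix_palencia_diagonalizable[OF adm mult_mat_vec_carrier[OF mpoly_carrier[OF A'] x, of ?q]]
        unfolding A'_def by simp
    qed
    then have "vnorm (mpoly p A *\<^sub>v x) \<le> (1 + sqrt 2) * vnorm (mpoly (Polynomial.smult (of_real k) q) A *\<^sub>v x)"
      by (intro tendsto_le[OF _ tendsto_mult[OF tendsto_const vnorm_mpoly_perturbation_tendsto[OF A E x]]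
            vnorm_mpoly_perturbation_tendsto[OF A E x]]) auto
    then show ?thesis
      using k C by (simp add: mpoly_smult_vec[OF A x] vnorm_smult)
  qed
  have "((\<lambda>k. (1 + sqrt 2) * (k * vnorm (mpoly q A *\<^sub>v x))) \<longlongrightarrow> (1 + sqrt 2) * (C * vnorm (mpoly q A *\<^sub>v x))) (at_right C)"
    by (intro tendsto_intros)
  moreover have "\<forall>\<^sub>F k in at_right C. vnorm (mpoly p A *\<^sub>v x) \<le> (1 + sqrt 2) * (k * vnorm (mpoly q A *\<^sub>v x))"
    using eventually_at_right_less[of C] by eventually_elim (rule bound)
  ultimately have "vnorm (mpoly p A *\<^sub>v x) \<le> (1 + sqrt 2) * (C * vnorm (mpoly q A *\<^sub>v x))"
    by (intro tendsto_lowerbound) auto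
  then show ?thesis by (simp add: mult.assoc)
qed

section \<open>Singular values and the Sylvester equation\<close>

lemma exists_kernel_vec:
  fixes fs :: "complex vec list"
  assumes fs: "set fs \<subseteq> carrier_vec m" and len: "length fs < m"
  obtains c where "c \<in> carrier_vec m" "c \<noteq> 0\<^sub>v m" "\<And>f. f \<in> set fs \<Longrightarrow> f \<bullet> c = 0"
proof -
  \<comment> \<open>Zero rows complete the system to a square one; a matrix with a zero row has no
    inverse.\<close>
  define gs where "gs = fs @ replicate (m - length fs) (0\<^sub>v m)"
  have gs: "set gs \<subseteq> carrier_vec m" "length gs = m" using fs len by (auto simp: gs_def)
  define M where "M = mat_of_rows m gs"
  have M: "M \<in> carrier_mat m m" using gs by (auto simp: M_def)
  have row: "row M i = gs ! i" if "i < m" for i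
    using that gs unfolding M_def by (intro mat_of_rows_row) auto
  have "\<exists>c. c \<in> carrier_vec m \<and> M *\<^sub>v c = 0\<^sub>v m \<and> c \<noteq> 0\<^sub>v m"
  proof (rule ccontr)
    assume "\<not> ?thesis"
    then obtain Q where Q: "Q \<in> carrier_mat m m" "M * Q = 1\<^sub>m m"
      using exists_inverse_mat[OF M] by metis
    have "row M (length fs) = 0\<^sub>v m" unfolding row[OF len] using len by (simp add: gs_def nth_append)
    then have "(M * Q) $$ (length fs, length fs) = 0" using M Q(1) len by simp
    then show False using Q(2) len by simp
  qed
  then obtain c where c: "c \<in> carrier_vec m" "M *\<^sub>v c = 0\<^sub>v m" "c \<noteq> 0\<^sub>v m" by blast
  show ?thesis
  proof (rule that[OF c(1,3)])
    fix f assume "f \<in> set fs"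
    then obtain i where i: "i < length fs" "f = fs ! i" by (auto simp: in_set_conv_nth)
    have "row M i \<bullet> c = (M *\<^sub>v c) $ i" using i len M by simp
    also have "\<dots> = 0" using c(2) i len by simp
    finally show "f \<bullet> c = 0" using i len by (simp add: row gs_def nth_append)
  qed
qed

text \<open>A rank factorisation: the columns of \<open>D\<close> are expanded in a maximal
  independent set of columns, and for each of these the vector of its coefficients is one
  functional.\<close>

lemma crank_functionals:
  fixes D :: "complex mat"
  assumes D: "D \<in> carrier_mat n m" and k: "crank D \<le> k"
  obtains fs where "set fs \<subseteq> carrier_vec m" "length fs \<le> k"
    "\<And>w. w \<in> carrier_vec m \<Longrightarrow> (\<And>f. f \<in> set fs \<Longrightarrow> f \<bullet> w = 0) \<Longrightarrow> D *\<^sub>v w = 0\<^sub>v n"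
proof -
  interpret vec_space "TYPE(complex)" n .
  have cols: "set (cols D) \<subseteq> carrier_vec n" using D cols_dim by blast
  obtain S where S: "finite S" "maximal S (\<lambda>T. T \<subseteq> set (cols D) \<and> lin_indpt T)"
    using maximal_exists_superset[of "set (cols D)" "\<lambda>T. T \<subseteq> set (cols D) \<and> lin_indpt T" "{}"]
    by (auto simp: finite_lin_indpt2)
  have card: "card S \<le> k"
    using rank_card_indpt[OF D S(2)] k D by (simp add: crank_def)
  have Sc: "S \<subseteq> carrier_vec n" and indpt: "lin_indpt S" and Ssub: "S \<subseteq> set (cols D)"
    using S(2) cols unfolding maximal_def by auto
  have span: "col D j \<in> span S" if j: "j < m" for j
  proof (rule ccontr)
    assume notin: "col D j \<notin> span S"
    have cj: "col D j \<in> carrier_vec n" "col D j \<in> set (cols D)" using D j by (auto simp: cols_def)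
    have nS: "col D j \<notin> S" using notin span_mem[OF _, of S] Sc by (meson in_own_span subsetD)
    have "lin_indpt (S \<union> {col D j})"
      using lin_dep_iff_in_span[of S "col D j"] Sc indpt cj notin nS by auto
    moreover have "S \<union> {col D j} \<subseteq> set (cols D)" using Ssub cj by auto
    ultimately have "S = S \<union> {col D j}" using S(2) unfolding maximal_def by blast
    then show False using nS by blast
  qed
  have "\<exists>a. col D j = lincomb a S" if "j < m" for j
    using span[OF that] finite_span[OF S(1)] Sc by auto
  then obtain a where a: "\<And>j. j < m \<Longrightarrow> col D j = lincomb (a j) S" by metis
  obtain xs where xs: "set xs = S" "distinct xs" using finite_distinct_list[OF S(1)] by blast
  show ?thesis
  proof (rule that[of "map (\<lambda>s. Matrix.vec m (\<lambda>j. a j s)) xs"])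
    show "length (map (\<lambda>s. Matrix.vec m (\<lambda>j. a j s)) xs) \<le> k"
      using card xs by (simp add: distinct_card[symmetric])
    fix w assume w: "w \<in> carrier_vec m"
      and fw: "\<And>f. f \<in> set (map (\<lambda>s. Matrix.vec m (\<lambda>j. a j s)) xs) \<Longrightarrow> f \<bullet> w = 0"
    have 0: "(\<Sum>j<m. a j s * w $ j) = 0" if "s \<in> S" for s
      using fw[of "Matrix.vec m (\<lambda>j. a j s)"] that xs w by (simp add: scalar_prod_def atLeast0LessThan)
    show "D *\<^sub>v w = 0\<^sub>v n"
    proof (rule eq_vecI)
      fix i assume "i < dim_vec (0\<^sub>v n :: complex vec)"
      then have i: "i < n" by simp
      have "D $$ (i, j) = (\<Sum>s\<in>S. a j s * s $ i)" if j: "j < m" for j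
      proof -
        have "D $$ (i, j) = col D j $ i" using D i j by simp
        then show ?thesis unfolding a[OF j] lincomb_index[OF i Sc] .
      qed
      then have "(D *\<^sub>v w) $ i = (\<Sum>j<m. \<Sum>s\<in>S. a j s * s $ i * w $ j)"
        using D i w by (simp add: scalar_prod_def atLeast0LessThan sum_distrib_right)
      also have "\<dots> = (\<Sum>s\<in>S. \<Sum>j<m. a j s * s $ i * w $ j)" by (rule sum.swap)
      also have "\<dots> = (\<Sum>s\<in>S. s $ i * (\<Sum>j<m. a j s * w $ j))"
        by (simp add: sum_distrib_left mult_ac)
      finally show "(D *\<^sub>v w) $ i = 0\<^sub>v n $ i" using 0 i by simp
    qed (use D in simp)
  qed auto
qed

section \<open>Spectral theorem for normal matrices\<close>

lemma unitary_from_eigenvector: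
  fixes A :: "complex mat"
  assumes A: "A \<in> carrier_mat n n" and n: "0 < n"
  obtains W e where "W \<in> carrier_mat n n" "mat_adjoint W * W = 1\<^sub>m n"
    "A *\<^sub>v col W 0 = e \<cdot>\<^sub>v col W 0"
proof -
  obtain as where as: "char_poly A = (\<Prod>a\<leftarrow>as. [:- a, 1:])" "length as = n"
    using char_poly_factorized[OF A] by blast
  then have "poly (char_poly A) (hd as) = 0"
    using n by (cases as) auto
  then obtain v where "eigenvector A v (hd as)"
    using eigenvalue_root_char_poly[OF A] by (auto simp: eigenvalue_def)
  then have v: "v \<in> carrier_vec n" "v \<noteq> 0\<^sub>v n" "A *\<^sub>v v = hd as \<cdot>\<^sub>v v"
    using A by (auto simp: eigenvector_def)
  interpret cof_vec_space n "TYPE(complex)" .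
  define b where "b = basis_completion v"
  from basis_completion[OF v(1,2), folded b_def]
  have b: "set b \<subseteq> carrier_vec n" "distinct b" "\<not> lin_dep (set b)" "length b = n" "hd b = v" by auto
  obtain vs where bv: "b = v # vs" using b(4,5) n by (cases b) auto
  \<comment> \<open>Gram-Schmidt keeps the first vector, so the eigenvector stays in front. The
    result is orthogonal but not normalised, hence the division by norms in
    \<open>W\<close>.\<close>
  define ws where "ws = gram_schmidt n b"
  from gram_schmidt_result[OF b(1-3) ws_def]
  have ws: "corthogonal ws" "set ws \<subseteq> carrier_vec n" "length ws = n" by (auto simp: b(4))
  have hd: "ws ! 0 = v"
    using gram_schmidt_hd[OF v(1), of vs, folded bv ws_def] ws(3) n by (cases ws) auto
  have wc: "ws ! i \<in> carrier_vec n" if "i < n" for i using ws that by auto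
  have wpos: "vnorm (ws ! i) \<noteq> 0" if "i < n" for i
    using corthogonalD[OF ws(1), of i i] that ws(3) by (auto simp: cscalar_prod_self)
  define W where "W = Matrix.mat n n (\<lambda>(r, i). ws ! i $ r / vnorm (ws ! i))"
  have W: "W \<in> carrier_mat n n" by (simp add: W_def)
  have "mat_adjoint W * W = 1\<^sub>m n"
  proof (rule eq_matI)
    fix i j assume "i < dim_row (1\<^sub>m n)" "j < dim_col (1\<^sub>m n)"
    then have ij: "i < n" "j < n" by auto
    have "(mat_adjoint W * W) $$ (i, j) = (\<Sum>r<n. cnj (W $$ (r, i)) * W $$ (r, j))"
      using ij W by (simp add: scalar_prod_def atLeast0LessThan)
    also have "\<dots> = (\<Sum>r<n. ws ! j $ r * cnj (ws ! i $ r) / (vnorm (ws ! i) * vnorm (ws ! j)))"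
      using ij by (intro sum.cong) (auto simp: W_def mult.commute)
    also have "\<dots> = (ws ! j \<bullet>c ws ! i) / (vnorm (ws ! i) * vnorm (ws ! j))"
      using ij wc by (simp add: cscalar_prod_sum[of _ n] sum_divide_distrib)
    also have "\<dots> = 1\<^sub>m n $$ (i, j)"
      using ij wpos corthogonalD[OF ws(1), of j i] ws(3)
      by (auto simp: cscalar_prod_self power2_eq_square)
    finally show "(mat_adjoint W * W) $$ (i, j) = 1\<^sub>m n $$ (i, j)" .
  qed (use W in auto)
  moreover have "col W 0 = complex_of_real (1 / vnorm v) \<cdot>\<^sub>v v"
    using n v(1) hd by (intro eq_vecI) (auto simp: W_def)
  then have "A *\<^sub>v col W 0 = hd as \<cdot>\<^sub>v col W 0"
    using mult_mat_vec[OF A v(1)] v(3) by (simp add: smult_smult_assoc mult.commute)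
  ultimately show ?thesis using W that by blast
qed

lemma normal_mat_entries:
  assumes A: "A \<in> carrier_mat n n" and N: "normal_mat A" and ij: "i < n" "j < n"
  shows "(\<Sum>k<n. A $$ (i, k) * cnj (A $$ (j, k))) = (\<Sum>k<n. cnj (A $$ (k, i)) * A $$ (k, j))"
proof -
  have "(A * mat_adjoint A) $$ (i, j) = (mat_adjoint A * A) $$ (i, j)"
    using N by (simp add: normal_mat_def)
  then show ?thesis using A ij by (simp add: scalar_prod_def atLeast0LessThan)
qed

lemma normal_mat_entriesI:
  assumes A: "A \<in> carrier_mat n n"
    and "\<And>i j. i < n \<Longrightarrow> j < n \<Longrightarrow>
      (\<Sum>k<n. A $$ (i, k) * cnj (A $$ (j, k))) = (\<Sum>k<n. cnj (A $$ (k, i)) * A $$ (k, j))"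
  shows "normal_mat A"
  unfolding normal_mat_def
  using assms by (intro eq_matI) (auto simp: scalar_prod_def atLeast0LessThan)

text \<open>Deflation: in a unitary basis starting with an eigenvector, the first column vanishes
  below the corner. Comparing the corner entries of the products of the matrix with its adjoint in
  both orders shows that the first row and the first column have the same norm. So the first row
  vanishes beside the corner too, and the remaining block is again normal.\<close>

theorem normal_unitary_diagonalization:
  assumes "A \<in> carrier_mat n n" and "normal_mat A"
  shows "\<exists>U d. U \<in> carrier_mat n n \<and> mat_adjoint U * U = 1\<^sub>m n \<and> A = U * mat_diag n d * mat_adjoint U"
  using assms
proof (induction n arbitrary: A)
  case 0
  then show ?case
    by (intro exI[of _ "1\<^sub>m 0"]) (auto intro!: eq_matI simp: mat_diag_def)
next
  case (Suc n)
  let ?N = "Suc n"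
  note A = Suc.prems(1)
  obtain W e where W: "W \<in> carrier_mat ?N ?N" and WW: "mat_adjoint W * W = 1\<^sub>m ?N"
    and We: "A *\<^sub>v col W 0 = e \<cdot>\<^sub>v col W 0"
    using unitary_from_eigenvector[OF A] by blast
  let ?W' = "mat_adjoint W"
  have W': "?W' \<in> carrier_mat ?N ?N" using W by simp
  have WW': "W * ?W' = 1\<^sub>m ?N" by (rule mat_mult_left_right_inverse[OF W' W WW])
  note mc = mult_carrier_mat[of _ ?N ?N _ ?N] and am = assoc_mult_mat[of _ ?N ?N _ ?N _ ?N]
  define M where "M = ?W' * A * W"
  have M: "M \<in> carrier_mat ?N ?N" using A W W' by (simp add: M_def mc)
  have cancel: "W * (?W' * Z) = Z" if "Z \<in> carrier_mat ?N ?N" for Z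
    using am[OF W W' that] that by (simp add: WW')
  have A_eq: "A = W * M * ?W'"
    using A W W' by (simp add: M_def am mc cancel WW')
  have M_adj: "mat_adjoint M = ?W' * mat_adjoint A * W"
    using A W W' by (simp add: M_def mat_adjoint_mult[of _ ?N ?N _ ?N] am mc)
  have "M * mat_adjoint M = ?W' * (A * mat_adjoint A) * W"
    unfolding M_adj using A W W' by (simp add: M_def am mc cancel)
  also have "\<dots> = ?W' * (mat_adjoint A * A) * W" using Suc.prems(2) by (simp add: normal_mat_def)
  also have "\<dots> = mat_adjoint M * M"
    unfolding M_adj using A W W' by (simp add: M_def am mc cancel)
  finally have M_normal: "normal_mat M" by (simp add: normal_mat_def)
  have col0: "M $$ (i, 0) = (if i = 0 then e else 0)" if i: "i < ?N" for i
  proof -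
    have c: "col W 0 \<in> carrier_vec ?N" using W by (intro carrier_vecI) simp
    have "M $$ (i, 0) = (M *\<^sub>v unit_vec ?N 0) $ i" using i M by simp
    also have "M *\<^sub>v unit_vec ?N 0 = ?W' *\<^sub>v (A *\<^sub>v (W *\<^sub>v unit_vec ?N 0))"
      using A W W' by (simp add: M_def assoc_mult_mat_vec[of _ ?N ?N _ ?N] mc)
    also have "W *\<^sub>v unit_vec ?N 0 = col W 0" using W by (intro eq_vecI) auto
    also have "?W' *\<^sub>v (A *\<^sub>v col W 0) = e \<cdot>\<^sub>v (?W' *\<^sub>v col W 0)"
      unfolding We by (rule mult_mat_vec[OF W' c])
    also have "(e \<cdot>\<^sub>v (?W' *\<^sub>v col W 0)) $ i = e * (?W' * W) $$ (i, 0)"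
      using i W W' by simp
    finally show ?thesis unfolding WW using i by simp
  qed
  have row0: "M $$ (0, j) = 0" if j: "0 < j" "j < ?N" for j
  proof -
    have "(\<Sum>k<?N. cnj (M $$ (k, 0)) * M $$ (k, 0)) = cnj e * e"
      using col0 by (subst sum.lessThan_Suc_shift) simp
    then have "(\<Sum>k<?N. M $$ (0, k) * cnj (M $$ (0, k))) = cnj e * e"
      using normal_mat_entries[OF M M_normal, of 0 0] by simp
    then have "(\<Sum>k<n. M $$ (0, Suc k) * cnj (M $$ (0, Suc k))) = 0"
      using col0[of 0] by (subst (asm) sum.lessThan_Suc_shift) (simp add: mult.commute)
    then have "complex_of_real (\<Sum>k<n. (cmod (M $$ (0, Suc k)))\<^sup>2) = 0"
      by (simp only: complex_norm_square of_real_sum)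
    then have "(\<Sum>k<n. (cmod (M $$ (0, Suc k)))\<^sup>2) = 0" by (simp only: of_real_eq_0_iff)
    then have "\<forall>k<n. cmod (M $$ (0, Suc k)) = 0"
      by (subst (asm) sum_nonneg_eq_0_iff) auto
    then show ?thesis using j by (cases j) auto
  qed
  define M' where "M' = Matrix.mat n n (\<lambda>(i, j). M $$ (Suc i, Suc j))"
  have M': "M' \<in> carrier_mat n n" by (simp add: M'_def)
  have "normal_mat M'"
  proof (rule normal_mat_entriesI[OF M'])
    fix i j assume ij: "i < n" "j < n"
    have "(\<Sum>k<?N. M $$ (Suc i, k) * cnj (M $$ (Suc j, k))) = (\<Sum>k<?N. cnj (M $$ (k, Suc i)) * M $$ (k, Suc j))"
      using ij by (intro normal_mat_entries[OF M M_normal]) auto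
    then show "(\<Sum>k<n. M' $$ (i, k) * cnj (M' $$ (j, k))) = (\<Sum>k<n. cnj (M' $$ (k, i)) * M' $$ (k, j))"
      using ij col0 row0 by (simp add: M'_def sum.lessThan_Suc_shift del: sum.lessThan_Suc)
  qed
  from Suc.IH[OF M' this] obtain U d where U: "U \<in> carrier_mat n n" "mat_adjoint U * U = 1\<^sub>m n"
    and M'_eq: "M' = U * mat_diag n d * mat_adjoint U" by blast
  define U2 where "U2 = Matrix.mat ?N ?N (\<lambda>(i, j). if i = 0 \<or> j = 0 then (if i = j then 1 else 0) else U $$ (i - 1, j - 1))"
  define d2 where "d2 = case_nat e d"
  have U2: "U2 \<in> carrier_mat ?N ?N" by (simp add: U2_def)
  have entry: "(V * mat_diag l f * mat_adjoint V) $$ (i, j) = (\<Sum>k<l. V $$ (i, k) * f k * cnj (V $$ (j, k)))"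
    if "V \<in> carrier_mat l l" "i < l" "j < l" for V :: "complex mat" and l f i j
    using that by (simp add: mat_diag_mult_right[OF that(1)] scalar_prod_def atLeast0LessThan)
  have M_eq: "M = U2 * mat_diag ?N d2 * mat_adjoint U2"
  proof (rule eq_matI)
    fix i j assume "i < dim_row (U2 * mat_diag ?N d2 * mat_adjoint U2)" "j < dim_col (U2 * mat_diag ?N d2 * mat_adjoint U2)"
    then have ij: "i < ?N" "j < ?N" using U2 by auto
    have "(U2 * mat_diag ?N d2 * mat_adjoint U2) $$ (i, j) =
      (\<Sum>k<?N. U2 $$ (i, k) * d2 k * cnj (U2 $$ (j, k)))" by (rule entry[OF U2 ij])
    also have "\<dots> = U2 $$ (i, 0) * e * cnj (U2 $$ (j, 0)) + (\<Sum>k<n. U2 $$ (i, Suc k) * d k * cnj (U2 $$ (j, Suc k)))"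
      by (simp add: sum.lessThan_Suc_shift d2_def del: sum.lessThan_Suc)
    also have "\<dots> = M $$ (i, j)"
    proof (cases "i = 0 \<or> j = 0")
      case True
      then have "(\<Sum>k<n. U2 $$ (i, Suc k) * d k * cnj (U2 $$ (j, Suc k))) = 0"
        using ij by (intro sum.neutral) (auto simp: U2_def)
      then show ?thesis using True ij col0 row0 by (auto simp: U2_def)
    next
      case False
      then obtain i' j' where i': "i = Suc i'" "j = Suc j'" "i' < n" "j' < n"
        using ij by (cases i; cases j) auto
      have "M $$ (i, j) = M' $$ (i', j')" using i' by (simp add: M'_def)
      also have "\<dots> = (\<Sum>k<n. U $$ (i', k) * d k * cnj (U $$ (j', k)))"
        unfolding M'_eq by (rule entry[OF U(1) i'(3,4)])
      finally show ?thesis using i' by (simp add: U2_def)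
    qed
    finally show "M $$ (i, j) = (U2 * mat_diag ?N d2 * mat_adjoint U2) $$ (i, j)" by simp
  qed (use M U2 in auto)
  have U2U2: "mat_adjoint U2 * U2 = 1\<^sub>m ?N"
  proof (rule eq_matI)
    fix i j assume "i < dim_row (1\<^sub>m ?N)" "j < dim_col (1\<^sub>m ?N)"
    then have ij: "i < ?N" "j < ?N" by auto
    have "(mat_adjoint U2 * U2) $$ (i, j) = (\<Sum>k<?N. cnj (U2 $$ (k, i)) * U2 $$ (k, j))"
      using ij U2 by (simp add: scalar_prod_def atLeast0LessThan)
    also have "\<dots> = cnj (U2 $$ (0, i)) * U2 $$ (0, j) + (\<Sum>k<n. cnj (U2 $$ (Suc k, i)) * U2 $$ (Suc k, j))"
      by (rule sum.lessThan_Suc_shift)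
    also have "\<dots> = 1\<^sub>m ?N $$ (i, j)"
    proof (cases "i = 0 \<or> j = 0")
      case True
      then have "(\<Sum>k<n. cnj (U2 $$ (Suc k, i)) * U2 $$ (Suc k, j)) = 0"
        using ij by (intro sum.neutral) (auto simp: U2_def)
      then show ?thesis using True ij by (auto simp: U2_def)
    next
      case False
      then obtain i' j' where i': "i = Suc i'" "j = Suc j'" "i' < n" "j' < n"
        using ij by (cases i; cases j) auto
      have "(\<Sum>k<n. cnj (U $$ (k, i')) * U $$ (k, j')) = (mat_adjoint U * U) $$ (i', j')"
        using i' U(1) by (simp add: scalar_prod_def atLeast0LessThan)
      then show ?thesis using i' by (simp add: U2_def U(2))
    qed
    finally show "(mat_adjoint U2 * U2) $$ (i, j) = 1\<^sub>m ?N $$ (i, j)" .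
  qed (use U2 in auto)
  have U2': "mat_adjoint U2 \<in> carrier_mat ?N ?N" using U2 by simp
  have D: "mat_diag ?N d2 \<in> carrier_mat ?N ?N" by simp
  have adj: "mat_adjoint (W * U2) = mat_adjoint U2 * ?W'" by (rule mat_adjoint_mult[OF W U2])
  have "mat_adjoint (W * U2) * (W * U2) = mat_adjoint U2 * (?W' * W * U2)"
    unfolding adj using W W' U2 U2' by (simp add: am mc)
  then have 1: "mat_adjoint (W * U2) * (W * U2) = 1\<^sub>m ?N"
    unfolding WW left_mult_one_mat[OF U2] U2U2 .
  have 2: "A = W * U2 * mat_diag ?N d2 * mat_adjoint (W * U2)"
    unfolding adj by (subst A_eq, subst M_eq) (use W W' U2 U2' D in \<open>simp add: am mc\<close>)
  have 3: "W * U2 \<in> carrier_mat ?N ?N" by (rule mult_carrier_mat[OF W U2])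
  show ?case by (intro exI[of _ "W * U2"] exI[of _ d2] conjI 1 2 3)
qed

lemma vnorm_unitary:
  assumes U: "U \<in> carrier_mat n n" "mat_adjoint U * U = 1\<^sub>m n" and x: "x \<in> carrier_vec n"
  shows "vnorm (U *\<^sub>v x) = vnorm x"
proof -
  have "complex_of_real ((vnorm (U *\<^sub>v x))\<^sup>2) = x \<bullet>c (mat_adjoint U *\<^sub>v (U *\<^sub>v x))"
    unfolding cscalar_prod_self[symmetric]
    by (rule cscalar_prod_adjoint[OF U(1) x mult_mat_vec_carrier[OF U(1) x]])
  also have "mat_adjoint U *\<^sub>v (U *\<^sub>v x) = x"
    using assoc_mult_mat_vec[OF mat_adjoint_carrier[OF U(1)] U(1) x] x by (simp add: U(2))
  finally have "complex_of_real ((vnorm (U *\<^sub>v x))\<^sup>2) = complex_of_real ((vnorm x)\<^sup>2)"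
    by (simp add: cscalar_prod_self)
  then show ?thesis unfolding of_real_eq_iff by simp
qed

text \<open>Unitary invariance turns both norms into sums over the eigenvalues with the same
  weights. Term by term comparison loses no constant, since the eigenvalues belong to the numerical
  range.\<close>

theorem normal_poly_bound:
  assumes A: "A \<in> carrier_mat n n" and N: "normal_mat A" and x: "x \<in> carrier_vec n" and C: "0 \<le> C"
    and pq: "\<And>z. z \<in> num_range A \<Longrightarrow> cmod (poly p z) \<le> C * cmod (poly q z)"
  shows "vnorm (mpoly p A *\<^sub>v x) \<le> C * vnorm (mpoly q A *\<^sub>v x)"
proof -
  obtain U d where U: "U \<in> carrier_mat n n" "mat_adjoint U * U = 1\<^sub>m n"
    and A_eq: "A = U * mat_diag n d * mat_adjoint U"
    using normal_unitary_diagonalization[OF A N] by blast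
  have U': "mat_adjoint U \<in> carrier_mat n n" using U by simp
  interpret diagonalization n U "mat_adjoint U" d
    using U U' mat_mult_left_right_inverse[OF U' U(1) U(2)] by (simp add: diagonalization_def)
  have A_f: "A = fcalc (\<lambda>z. z)" by (simp add: fcalc_def A_eq)
  have dW: "d i \<in> num_range A" if "i < n" for i
    using diagonal_in_num_range[OF that] by (simp flip: A_f)
  have norm_eq: "vnorm (mpoly r A *\<^sub>v x) = L2_set (\<lambda>i. cmod (poly r (d i)) * cmod ((mat_adjoint U *\<^sub>v x) $ i)) {..<n}" for r
  proof -
    let ?D = "mat_diag n (\<lambda>i. poly r (d i))" and ?y = "mat_adjoint U *\<^sub>v x"
    have D: "?D \<in> carrier_mat n n" by simp
    have y: "?y \<in> carrier_vec n" by (rule mult_mat_vec_carrier[OF U' x])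
    have Dy: "?D *\<^sub>v ?y \<in> carrier_vec n" by (rule mult_mat_vec_carrier[OF D y])
    have "vnorm (mpoly r A *\<^sub>v x) = vnorm (?D *\<^sub>v ?y)"
      unfolding A_f fcalc_mpoly fcalc_mult_vec[OF x] by (rule vnorm_unitary[OF U Dy])
    also have "\<dots> = L2_set (\<lambda>i. cmod ((?D *\<^sub>v ?y) $ i)) {..<n}" using Dy by (simp add: vnorm_L2 mat_diag_def)
    also have "\<dots> = L2_set (\<lambda>i. cmod (poly r (d i)) * cmod (?y $ i)) {..<n}"
    proof (rule L2_set_cong[OF refl])
      fix i assume "i \<in> {..<n}"
      then show "cmod ((?D *\<^sub>v ?y) $ i) = cmod (poly r (d i)) * cmod (?y $ i)"
        using mat_diag_mult_vec[OF y] by (simp only: norm_mult lessThan_iff)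
    qed
    finally show ?thesis .
  qed
  have "L2_set (\<lambda>i. cmod (poly p (d i)) * cmod ((mat_adjoint U *\<^sub>v x) $ i)) {..<n}
     \<le> L2_set (\<lambda>i. C * (cmod (poly q (d i)) * cmod ((mat_adjoint U *\<^sub>v x) $ i))) {..<n}"
    using mult_right_mono[OF pq[OF dW]] by (intro L2_set_mono) (auto simp: mult.assoc[symmetric] simp del: index_mult_mat_vec)
  then show ?thesis unfolding norm_eq using C by (simp add: L2_set_right_distrib)
qed

section \<open>Singular values under linear constraints\<close>

lemma order_prod_list_linear:
  "Polynomial.order z (\<Prod>a\<leftarrow>as. [:- a, 1:]) = count (mset as) (z :: complex)"
proof (induction as)
  case (Cons a as)
  have "(\<Prod>a\<leftarrow>as. [:- a, 1:]) \<noteq> (0 :: complex poly)"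
    by (auto simp: prod_list_zero_iff)
  then have "Polynomial.order z (\<Prod>a\<leftarrow>a # as. [:- a, 1:]) = Polynomial.order z [:- a, 1:] + Polynomial.order z (\<Prod>a\<leftarrow>as. [:- a, 1:])"
    by (simp add: order_mult del: mult_pCons_left mult_pCons_right)
  moreover have "Polynomial.order z [:- a, 1:] = (if a = z then 1 else 0)"
    using order_power_n_n[of a 1] by (auto intro!: order_0I)
  ultimately show ?case using Cons.IH by simp
qed simp

text \<open>\<open>eig_mset\<close> counts roots of the characteristic polynomial, which is a
  similarity invariant and splits into the linear factors of the \<open>d i\<close>.\<close>

lemma sing_vals_eq:
  assumes X: "X \<in> carrier_mat n m" and U: "U \<in> carrier_mat m m" "mat_adjoint U * U = 1\<^sub>m m"
    and eq: "mat_adjoint X * X = U * mat_diag m d * mat_adjoint U"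
  shows "sing_vals X = rev (sort (map (\<lambda>i. sqrt (Re (d i))) [0..<m]))"
proof -
  have U': "mat_adjoint U \<in> carrier_mat m m" using U by simp
  have UU': "U * mat_adjoint U = 1\<^sub>m m" by (rule mat_mult_left_right_inverse[OF U' U(1) U(2)])
  have D: "mat_diag m d \<in> carrier_mat m m" by simp
  have "similar_mat_wit (mat_adjoint X * X) (mat_diag m d) U (mat_adjoint U)"
    using X U U' UU' D by (intro similar_mat_witI[of _ _ m] eq mult_carrier_mat[of _ m n]) auto
  then have "char_poly (mat_adjoint X * X) = char_poly (mat_diag m d)"
    by (intro char_poly_similar) (auto simp: similar_mat_def)
  also have "\<dots> = (\<Prod>a\<leftarrow>diag_mat (mat_diag m d). [:- a, 1:])"
    by (rule char_poly_upper_triangular[OF D]) (auto simp: mat_diag_def upper_triangular_def)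
  also have "diag_mat (mat_diag m d) = map d [0..<m]"
    by (auto simp: diag_mat_def mat_diag_def)
  finally have "eig_mset (mat_adjoint X * X) = mset (map d [0..<m])"
    unfolding eig_mset_def by (simp only: order_prod_list_linear count_inverse)
  then have "sing_vals X = rev (sorted_list_of_multiset (image_mset (\<lambda>z. sqrt (Re z)) (mset (map d [0..<m]))))"
    by (simp only: sing_vals_def)
  also have "image_mset (\<lambda>z. sqrt (Re z)) (mset (map d [0..<m])) = mset (map (\<lambda>i. sqrt (Re (d i))) [0..<m])"
    by (simp add: image_mset.compositionality o_def flip: mset_map)
  finally show ?thesis by (simp only: sorted_list_of_multiset_mset)
qed

text \<open>Counting indices replaces the choice of a sorting permutation, and it absorbs ties among
  the values.\<close>

lemma card_ge_rev_sort_nth: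
  fixes s :: "nat \<Rightarrow> real"
  assumes "j < m"
  shows "Suc j \<le> card {i. i < m \<and> rev (sort (map s [0..<m])) ! j \<le> s i}"
proof -
  let ?ys = "rev (sort (map s [0..<m]))"
  define c where "c = ?ys ! j"
  have len: "length ?ys = m" by simp
  have dec: "?ys ! j \<le> ?ys ! i" if "i \<le> j" for i
    using that assms sorted_rev_nth_mono[of ?ys i j] by simp
  have "{..j} \<subseteq> {i. i < length ?ys \<and> c \<le> ?ys ! i}"
    using assms dec by (auto simp: c_def)
  then have "card {..j} \<le> card {i. i < length ?ys \<and> c \<le> ?ys ! i}"
    by (intro card_mono) auto
  also have "\<dots> = length (filter ((\<le>) c) ?ys)" by (rule length_filter_conv_card[symmetric])
  also have "\<dots> = size (filter_mset ((\<le>) c) (mset ?ys))" by (metis mset_filter size_mset)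
  also have "mset ?ys = mset (map s [0..<m])" by simp
  also have "size (filter_mset ((\<le>) c) (mset (map s [0..<m]))) = length (filter ((\<le>) c) (map s [0..<m]))"
    by (metis mset_filter size_mset)
  also have "\<dots> = card {i. i < length (map s [0..<m]) \<and> c \<le> map s [0..<m] ! i}" by (rule length_filter_conv_card)
  also have "{i. i < length (map s [0..<m]) \<and> c \<le> map s [0..<m] ! i} = {i. i < m \<and> c \<le> s i}" by auto
  finally show ?thesis by (simp add: c_def)
qed

text \<open>Half of the Courant--Fischer principle: fewer than \<open>j\<close> linear constraints leave a vector in the
  span of the first \<open>j\<close> right singular vectors.\<close>

theorem sigma_le_constrained:
  assumes X: "X \<in> carrier_mat n m" and j: "1 \<le> j"
    and fs: "set fs \<subseteq> carrier_vec m" "length fs < j" and b: "0 \<le> b"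
    and bound: "\<And>v. v \<in> carrier_vec m \<Longrightarrow> (\<And>f. f \<in> set fs \<Longrightarrow> f \<bullet> v = 0) \<Longrightarrow> vnorm (X *\<^sub>v v) \<le> b * vnorm v"
  shows "sigma j X \<le> b"
proof -
  let ?H = "mat_adjoint X * X"
  have X': "mat_adjoint X \<in> carrier_mat m n" using X by simp
  have H: "?H \<in> carrier_mat m m" by (rule mult_carrier_mat[OF X' X])
  have "mat_adjoint ?H = ?H" using mat_adjoint_mult[OF X' X] by simp
  then have "normal_mat ?H" by (simp add: normal_mat_def)
  then obtain U d where U: "U \<in> carrier_mat m m" "mat_adjoint U * U = 1\<^sub>m m"
    and eq: "?H = U * mat_diag m d * mat_adjoint U"
    using normal_unitary_diagonalization[OF H] by blast
  have U': "mat_adjoint U \<in> carrier_mat m m" using U by simp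
  interpret diagonalization m U "mat_adjoint U" d
    using U U' mat_mult_left_right_inverse[OF U' U(1) U(2)] by (simp add: diagonalization_def)
  have H_f: "?H = fcalc (\<lambda>z. z)" by (simp add: fcalc_def eq)
  have XUc: "complex_of_real ((vnorm (X *\<^sub>v (U *\<^sub>v c)))\<^sup>2) = (\<Sum>i<m. d i * of_real ((cmod (c $ i))\<^sup>2))"
    if c: "c \<in> carrier_vec m" for c
  proof -
    have Uc: "U *\<^sub>v c \<in> carrier_vec m" by (rule mult_mat_vec_carrier[OF U(1) c])
    have XUc: "X *\<^sub>v (U *\<^sub>v c) \<in> carrier_vec n" by (rule mult_mat_vec_carrier[OF X Uc])
    have e: "complex_of_real ((vnorm (X *\<^sub>v (U *\<^sub>v c)))\<^sup>2) = (U *\<^sub>v c) \<bullet>c (mat_adjoint X *\<^sub>v (X *\<^sub>v (U *\<^sub>v c)))"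
      unfolding cscalar_prod_self[symmetric] by (rule cscalar_prod_adjoint[OF X Uc XUc])
    have "complex_of_real ((vnorm (X *\<^sub>v (U *\<^sub>v c)))\<^sup>2) = cnj (complex_of_real ((vnorm (X *\<^sub>v (U *\<^sub>v c)))\<^sup>2))"
      by (rule complex_cnj_complex_of_real[symmetric])
    also have "\<dots> = cnj ((U *\<^sub>v c) \<bullet>c (mat_adjoint X *\<^sub>v (X *\<^sub>v (U *\<^sub>v c))))" unfolding e ..
    also have "\<dots> = (mat_adjoint X *\<^sub>v (X *\<^sub>v (U *\<^sub>v c))) \<bullet>c (U *\<^sub>v c)"
      by (rule cscalar_prod_cnj[OF Uc mult_mat_vec_carrier[OF X' XUc]])
    also have "mat_adjoint X *\<^sub>v (X *\<^sub>v (U *\<^sub>v c)) = fcalc (\<lambda>z. z) *\<^sub>v (U *\<^sub>v c)"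
      unfolding H_f[symmetric] by (rule assoc_mult_mat_vec[OF X' X Uc, symmetric])
    also have "\<dots> \<bullet>c (U *\<^sub>v c) = (\<Sum>i<m. d i * coef (U *\<^sub>v c) (U *\<^sub>v c) i)" by (rule fcalc_form[OF Uc Uc])
    also have "mat_adjoint U *\<^sub>v (U *\<^sub>v c) = c"
      using assoc_mult_mat_vec[OF U' U(1) c] c by (simp add: U(2))
    then have "(\<Sum>i<m. d i * coef (U *\<^sub>v c) (U *\<^sub>v c) i) = (\<Sum>i<m. d i * of_real ((cmod (c $ i))\<^sup>2))"
      by (simp only: coef_def complex_norm_square)
    finally show ?thesis .
  qed
  have d: "d i = of_real ((vnorm (X *\<^sub>v (U *\<^sub>v unit_vec m i)))\<^sup>2)" if i: "i < m" for i
  proof -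
    have "(\<Sum>k<m. d k * of_real ((cmod ((unit_vec m i :: complex vec) $ k))\<^sup>2)) = (\<Sum>k<m. if k = i then d k else 0)"
      using i by (intro sum.cong) auto
    then show ?thesis using XUc[of "unit_vec m i"] i by simp
  qed
  define s where "s = (\<lambda>i. sqrt (Re (d i)))"
  have s0: "0 \<le> s i" if "i < m" for i using d[OF that] by (simp add: s_def)
  have ds: "d i = of_real ((s i)\<^sup>2)" if "i < m" for i using d[OF that] by (simp add: s_def)
  have sv: "sing_vals X = rev (sort (map s [0..<m]))"
    unfolding s_def by (rule sing_vals_eq[OF X U eq])
  show ?thesis
  proof (cases "j \<le> m")
    \<comment> \<open>Beyond the number of columns \<open>sigma\<close> takes its default value
      0.\<close>
    case False
    then show ?thesis using b by (simp add: sigma_def sv)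
  next
    case True
    define \<sigma> where "\<sigma> = sigma j X"
    have \<sigma>: "\<sigma> = rev (sort (map s [0..<m])) ! (j - 1)" using True j by (simp add: \<sigma>_def sigma_def sv)
    define I where "I = {i. i < m \<and> \<sigma> \<le> s i}"
    have I: "j \<le> card I" "finite I" "I \<subseteq> {..<m}"
      using card_ge_rev_sort_nth[of "j - 1" m s] True j by (auto simp: I_def \<sigma>)
    \<comment> \<open>Coordinates outside \<open>I\<close> are forced to vanish, and the constraints
      \<open>fs\<close> are pulled back through \<open>U\<close>. These are
      \<open>m - card I\<close> conditions plus fewer than \<open>j\<close>, and
      \<open>j \<le> card I\<close>, so a nonzero solution remains.\<close>
    define gs where "gs = map (unit_vec m) (filter (\<lambda>i. i \<notin> I) [0..<m]) @ map (\<lambda>f. transpose_mat U *\<^sub>v f) fs"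
    have "length (filter (\<lambda>i. i \<notin> I) [0..<m]) = card ({..<m} - I)"
      by (subst distinct_card[symmetric]) (auto intro!: arg_cong[where f = card])
    also have "\<dots> = m - card I" using I by (simp add: card_Diff_subset)
    finally have len: "length gs < m"
      using I(1) fs(2) True j card_mono[OF _ I(3)] by (simp add: gs_def)
    have gs: "set gs \<subseteq> carrier_vec m"
      using U(1) fs(1) by (auto simp: gs_def intro!: mult_mat_vec_carrier[of _ m m])
    obtain c where c: "c \<in> carrier_vec m" "c \<noteq> 0\<^sub>v m" "\<And>g. g \<in> set gs \<Longrightarrow> g \<bullet> c = 0"
      using exists_kernel_vec[OF gs len] by blast
    have c0: "c $ i = 0" if "i < m" "i \<notin> I" for i
    proof -
      have "unit_vec m i \<bullet> c = 0" using that by (intro c(3)) (auto simp: gs_def)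
      then show ?thesis using that c(1) by simp
    qed
    define v where "v = U *\<^sub>v c"
    have v: "v \<in> carrier_vec m" unfolding v_def by (rule mult_mat_vec_carrier[OF U(1) c(1)])
    have "f \<bullet> v = 0" if f: "f \<in> set fs" for f
    proof -
      have fc: "f \<in> carrier_vec m" using f fs by auto
      have "(transpose_mat U *\<^sub>v f) \<bullet> c = f \<bullet> v"
        unfolding v_def using transpose_vec_mult_scalar[OF U(1) c(1) fc] by simp
      moreover have "(transpose_mat U *\<^sub>v f) \<bullet> c = 0" using f by (intro c(3)) (auto simp: gs_def)
      ultimately show ?thesis by simp
    qed
    then have "vnorm (X *\<^sub>v v) \<le> b * vnorm v" by (rule bound[OF v])
    then have up: "vnorm (X *\<^sub>v v) \<le> b * vnorm c"
      unfolding v_def vnorm_unitary[OF U c(1)] .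
    have "(\<Sum>i<m. d i * of_real ((cmod (c $ i))\<^sup>2)) = of_real (\<Sum>i<m. (s i)\<^sup>2 * (cmod (c $ i))\<^sup>2)"
      unfolding of_real_sum by (intro sum.cong) (simp_all add: ds)
    then have X2: "(vnorm (X *\<^sub>v v))\<^sup>2 = (\<Sum>i<m. (s i)\<^sup>2 * (cmod (c $ i))\<^sup>2)"
      using XUc[OF c(1)] unfolding v_def by (simp only: of_real_eq_iff)
    have \<sigma>0: "0 \<le> \<sigma>"
    proof -
      have "\<sigma> \<in> set (rev (sort (map s [0..<m])))" unfolding \<sigma> using True j by (intro nth_mem) simp
      then show ?thesis using s0 by auto
    qed
    have "\<sigma>\<^sup>2 * (vnorm c)\<^sup>2 = (\<Sum>i<m. \<sigma>\<^sup>2 * (cmod (c $ i))\<^sup>2)"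
      using c(1) by (simp add: vnorm_def sum_nonneg sum_distrib_left)
    also have "\<dots> \<le> (vnorm (X *\<^sub>v v))\<^sup>2"
      unfolding X2
    proof (rule sum_mono)
      fix i assume i: "i \<in> {..<m}"
      show "\<sigma>\<^sup>2 * (cmod (c $ i))\<^sup>2 \<le> (s i)\<^sup>2 * (cmod (c $ i))\<^sup>2"
      proof (cases "i \<in> I")
        case True
        then have "\<sigma>\<^sup>2 \<le> (s i)\<^sup>2" using \<sigma>0 by (intro power_mono) (auto simp: I_def)
        then show ?thesis by (intro mult_right_mono) auto
      qed (use c0 i in simp)
    qed
    finally have "(\<sigma> * vnorm c)\<^sup>2 \<le> (vnorm (X *\<^sub>v v))\<^sup>2" by (simp only: power_mult_distrib)
    then have "\<sigma> * vnorm c \<le> vnorm (X *\<^sub>v v)" by (rule power2_le_imp_le) simp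
    with up have "\<sigma> * vnorm c \<le> b * vnorm c" by simp
    moreover have "0 < vnorm c" using c vnorm_eq_0_iff[OF c(1)] vnorm_nonneg[of c] by linarith
    ultimately show ?thesis unfolding \<sigma>_def by simp
  qed
qed

section \<open>Polynomials in the Sylvester equation\<close>

lemma mpoly_krylov_zero:
  assumes D: "D \<in> carrier_mat n m" and C: "C \<in> carrier_mat m m"
  shows "w \<in> carrier_vec m \<Longrightarrow> (\<And>j. j < h \<Longrightarrow> D *\<^sub>v (C ^\<^sub>m j *\<^sub>v w) = 0\<^sub>v n) \<Longrightarrow> p = 0 \<or> degree p < h \<Longrightarrow>
    D *\<^sub>v (mpoly p C *\<^sub>v w) = 0\<^sub>v n"
proof (induction p arbitrary: w h)
  case 0
  have "mpoly 0 C *\<^sub>v w = 0\<^sub>v m" unfolding mpoly_0[OF C] using 0 by (intro eq_vecI) auto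
  then show ?case using mult_mat_vec_zero[OF D] by simp
next
  case (pCons a p)
  note w = pCons.prems(1)
  have h: "0 < h" using pCons.prems(3) pCons.hyps by auto
  have Cw: "C *\<^sub>v w \<in> carrier_vec m" by (rule mult_mat_vec_carrier[OF C w])
  have pw: "mpoly p C *\<^sub>v (C *\<^sub>v w) \<in> carrier_vec m" by (rule mult_mat_vec_carrier[OF mpoly_carrier[OF C] Cw])
  have "C *\<^sub>v (mpoly p C *\<^sub>v w) = mpoly p C *\<^sub>v (C *\<^sub>v w)"
    using mpoly_intertwine[OF C C C refl, of p] assoc_mult_mat_vec[OF C mpoly_carrier[OF C] w, of p]
      assoc_mult_mat_vec[OF mpoly_carrier[OF C] C w, of p] by simp
  then have "D *\<^sub>v (mpoly (pCons a p) C *\<^sub>v w) = a \<cdot>\<^sub>v (D *\<^sub>v w) + D *\<^sub>v (mpoly p C *\<^sub>v (C *\<^sub>v w))"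
    using mult_add_distrib_mat_vec[OF D _ pw, of "a \<cdot>\<^sub>v w"] mult_mat_vec[OF D w, of a] w
    by (simp add: mpoly_mult_mat_vec[OF C w])
  also have "D *\<^sub>v w = 0\<^sub>v n"
    using pCons.prems(2)[OF h] C w by simp
  also have "D *\<^sub>v (mpoly p C *\<^sub>v (C *\<^sub>v w)) = 0\<^sub>v n"
  \<comment> \<open>One factor \<open>C\<close> is moved onto the vector, which shifts the powers
    and lowers the number of conditions by one.\<close>
  proof (rule pCons.IH[OF Cw, of "h - 1"])
    fix j assume "j < h - 1"
    then have "D *\<^sub>v (C ^\<^sub>m Suc j *\<^sub>v w) = 0\<^sub>v n" by (intro pCons.prems(2)) simp
    then show "D *\<^sub>v (C ^\<^sub>m j *\<^sub>v (C *\<^sub>v w)) = 0\<^sub>v n"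
      using assoc_mult_mat_vec[OF pow_carrier_mat[OF C, of j] C w] by simp
  next
    show "p = 0 \<or> degree p < h - 1" using pCons.prems(3) pCons.hyps by (cases "p = 0") auto
  qed
  finally show ?case by (auto intro!: eq_vecI)
qed

lemma vec_minus_eq_zeroD:
  fixes a b :: "complex vec"
  assumes "a - b = 0\<^sub>v n" "a \<in> carrier_vec n" "b \<in> carrier_vec n"
  shows "b = a"
proof (rule eq_vecI)
  fix i assume "i < dim_vec a"
  then show "b $ i = a $ i"
    using arg_cong[OF assms(1), of "\<lambda>v. v $ i"] assms(2,3) by simp
qed (use assms in simp)

text \<open>If \<open>D\<close> annihilates u then X C u = A X u, so Horner's scheme moves one
  factor at a time across \<open>X\<close>. For a polynomial of degree at most \<open>h\<close> this
  applies \<open>D\<close> only to polynomials of degree below \<open>h\<close>. Hence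
  \<open>h\<close> conditions suffice instead of \<open>h + 1\<close>, which is what makes the index
  \<open>1 + k * h\<close>.\<close>

lemma mpoly_sylvester:
  assumes A: "A \<in> carrier_mat n n" and C: "C \<in> carrier_mat m m" and X: "X \<in> carrier_mat n m"
    and D: "D \<in> carrier_mat n m" and eq: "A * X - X * C = D"
    and w: "w \<in> carrier_vec m" and 0: "\<And>j. j < h \<Longrightarrow> D *\<^sub>v (C ^\<^sub>m j *\<^sub>v w) = 0\<^sub>v n"
  shows "degree p \<le> h \<Longrightarrow> X *\<^sub>v (mpoly p C *\<^sub>v w) = mpoly p A *\<^sub>v (X *\<^sub>v w)"
proof (induction p)
  case 0
  have Xw: "X *\<^sub>v w \<in> carrier_vec n" by (rule mult_mat_vec_carrier[OF X w])
  have "mpoly 0 C *\<^sub>v w = 0\<^sub>v m" unfolding mpoly_0[OF C] using w by (intro eq_vecI) auto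
  moreover have "mpoly 0 A *\<^sub>v (X *\<^sub>v w) = 0\<^sub>v n"
    unfolding mpoly_0[OF A] using Xw by (intro eq_vecI) (auto simp del: index_mult_mat_vec(1) simp: index_mult_mat_vec(1)[of _ "0\<^sub>m n n"])
  ultimately show ?case using mult_mat_vec_zero[OF X] by simp
next
  case (pCons a p)
  have Xw: "X *\<^sub>v w \<in> carrier_vec n" by (rule mult_mat_vec_carrier[OF X w])
  define u where "u = mpoly p C *\<^sub>v w"
  have u: "u \<in> carrier_vec m" unfolding u_def by (rule mult_mat_vec_carrier[OF mpoly_carrier[OF C] w])
  have Cu: "C *\<^sub>v u \<in> carrier_vec m" by (rule mult_mat_vec_carrier[OF C u])
  have deg: "p = 0 \<or> degree p < h" "degree p \<le> h" using pCons.prems by (cases "p = 0"; simp)+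
  have "D *\<^sub>v u = 0\<^sub>v n" unfolding u_def using mpoly_krylov_zero[OF D C w 0 deg(1)] by blast
  then have "A *\<^sub>v (X *\<^sub>v u) - X *\<^sub>v (C *\<^sub>v u) = 0\<^sub>v n"
    unfolding eq[symmetric]
    using minus_mult_distrib_mat_vec[OF mult_carrier_mat[OF A X] mult_carrier_mat[OF X C] u]
      assoc_mult_mat_vec[OF A X u] assoc_mult_mat_vec[OF X C u] by simp
  moreover have "A *\<^sub>v (X *\<^sub>v u) \<in> carrier_vec n" "X *\<^sub>v (C *\<^sub>v u) \<in> carrier_vec n"
    using A X C u by (auto intro!: mult_mat_vec_carrier)
  ultimately have XC: "X *\<^sub>v (C *\<^sub>v u) = A *\<^sub>v (X *\<^sub>v u)"
    by (rule vec_minus_eq_zeroD)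
  have "X *\<^sub>v (mpoly (pCons a p) C *\<^sub>v w) = a \<cdot>\<^sub>v (X *\<^sub>v w) + X *\<^sub>v (C *\<^sub>v u)"
    using mult_add_distrib_mat_vec[OF X _ Cu, of "a \<cdot>\<^sub>v w"] mult_mat_vec[OF X w, of a] w
    by (simp add: mpoly_mult_mat_vec[OF C w] u_def)
  also have "\<dots> = mpoly (pCons a p) A *\<^sub>v (X *\<^sub>v w)"
    unfolding XC mpoly_mult_mat_vec[OF A Xw] using pCons.IH[OF deg(2)] by (simp add: u_def)
  finally show ?case .
qed

text \<open>As p(C) is invertible, the conditions on w can be rewritten as conditions on v = p(C) w,
  at most \<open>k\<close> for each power below \<open>h\<close>. The factor \<open>a\<close> leads
  from p(A) X w to q(A) X w, which is X q(C) w, and the factor \<open>b\<close> leads from q(C) w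
  back to v.\<close>

theorem sigma_sylvester_bound:
  assumes A: "A \<in> carrier_mat n n" and C: "C \<in> carrier_mat m m" and X: "X \<in> carrier_mat n m"
    and D: "D \<in> carrier_mat n m" and eq: "A * X - X * C = D" and k: "crank D \<le> k"
    and deg: "degree p \<le> h" "degree q \<le> h" and ab: "0 \<le> a" "0 \<le> b"
    and bA: "\<And>x. x \<in> carrier_vec n \<Longrightarrow> vnorm (mpoly p A *\<^sub>v x) \<le> a * vnorm (mpoly q A *\<^sub>v x)"
    and bC: "\<And>y. y \<in> carrier_vec m \<Longrightarrow> vnorm (mpoly q C *\<^sub>v y) \<le> b * vnorm (mpoly p C *\<^sub>v y)"
    and inj: "\<And>y. y \<in> carrier_vec m \<Longrightarrow> mpoly p C *\<^sub>v y = 0\<^sub>v m \<Longrightarrow> y = 0\<^sub>v m"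
  shows "sigma (1 + k * h) X \<le> a * b * spec_norm X"
proof -
  obtain gs where gs: "set gs \<subseteq> carrier_vec m" "length gs \<le> k"
    and gs_D: "\<And>w. w \<in> carrier_vec m \<Longrightarrow> (\<And>f. f \<in> set gs \<Longrightarrow> f \<bullet> w = 0) \<Longrightarrow> D *\<^sub>v w = 0\<^sub>v n"
    using crank_functionals[OF D k] by blast
  obtain R where R: "R \<in> carrier_mat m m" "mpoly p C * R = 1\<^sub>m m"
    using exists_inverse_mat[OF mpoly_carrier[OF C] inj] by metis
  have CR: "C ^\<^sub>m j * R \<in> carrier_mat m m" for j by (rule mult_carrier_mat[OF pow_carrier_mat[OF C] R(1)])
  define fs where "fs = concat (map (\<lambda>j. map (\<lambda>g. transpose_mat (C ^\<^sub>m j * R) *\<^sub>v g) gs) [0..<h])"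
  have "length fs = h * length gs" by (simp add: fs_def length_concat o_def sum_list_triv)
  then have "length fs \<le> h * k" by (simp only: mult_le_mono2[OF gs(2)])
  then have len: "length fs < 1 + k * h" by (simp add: mult.commute)
  have fs: "set fs \<subseteq> carrier_vec m"
    using gs(1) CR by (auto simp: fs_def intro!: mult_mat_vec_carrier[of _ m m] transpose_carrier_mat)
  show ?thesis
  proof (rule sigma_le_constrained[OF X _ fs len])
    show "0 \<le> a * b * spec_norm X" using ab spec_norm_nonneg by simp
    fix v assume v: "v \<in> carrier_vec m" and fv: "\<And>f. f \<in> set fs \<Longrightarrow> f \<bullet> v = 0"
    define w where "w = R *\<^sub>v v"
    have w: "w \<in> carrier_vec m" unfolding w_def by (rule mult_mat_vec_carrier[OF R(1) v])
    have pw: "mpoly p C *\<^sub>v w = v"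
      unfolding w_def using assoc_mult_mat_vec[OF mpoly_carrier[OF C] R(1) v, of p] v by (simp add: R(2))
    have 0: "D *\<^sub>v (C ^\<^sub>m j *\<^sub>v w) = 0\<^sub>v n" if j: "j < h" for j
    proof (rule gs_D)
      show "C ^\<^sub>m j *\<^sub>v w \<in> carrier_vec m" by (rule mult_mat_vec_carrier[OF pow_carrier_mat[OF C] w])
      fix g assume g: "g \<in> set gs"
      have gc: "g \<in> carrier_vec m" using g gs by auto
      have "C ^\<^sub>m j *\<^sub>v w = C ^\<^sub>m j * R *\<^sub>v v"
        unfolding w_def by (rule assoc_mult_mat_vec[OF pow_carrier_mat[OF C] R(1) v, symmetric])
      then have "g \<bullet> (C ^\<^sub>m j *\<^sub>v w) = (transpose_mat (C ^\<^sub>m j * R) *\<^sub>v g) \<bullet> v"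
        using transpose_vec_mult_scalar[OF CR v gc, of j] by simp
      also have "\<dots> = 0" using g j by (intro fv) (auto simp: fs_def)
      finally show "g \<bullet> (C ^\<^sub>m j *\<^sub>v w) = 0" .
    qed
    have Xw: "X *\<^sub>v w \<in> carrier_vec n" by (rule mult_mat_vec_carrier[OF X w])
    note syl = mpoly_sylvester[OF A C X D eq w 0]
    have qw: "mpoly q C *\<^sub>v w \<in> carrier_vec m" by (rule mult_mat_vec_carrier[OF mpoly_carrier[OF C] w])
    have "vnorm (X *\<^sub>v v) = vnorm (mpoly p A *\<^sub>v (X *\<^sub>v w))"
      using syl[OF _ deg(1)] by (simp add: pw)
    also have "\<dots> \<le> a * vnorm (mpoly q A *\<^sub>v (X *\<^sub>v w))" by (rule bA[OF Xw])
    also have "mpoly q A *\<^sub>v (X *\<^sub>v w) = X *\<^sub>v (mpoly q C *\<^sub>v w)" using syl[OF _ deg(2)] by simp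
    also have "a * vnorm (X *\<^sub>v (mpoly q C *\<^sub>v w)) \<le> a * (spec_norm X * (b * vnorm v))"
      using order_trans[OF spec_norm_bound[OF X qw] mult_left_mono[OF bC[OF w] spec_norm_nonneg]] ab
      unfolding pw by (intro mult_left_mono) auto
    finally show "vnorm (X *\<^sub>v v) \<le> a * b * spec_norm X * vnorm v" by (simp add: mult_ac)
  qed simp
qed

theorem theorem1:
  fixes A B D X :: "complex mat" and E F :: "complex set" and n m k h :: nat
  assumes "A \<in> carrier_mat n n" and "B \<in> carrier_mat m m" and "D \<in> carrier_mat n m"
    and "crank D \<le> k"
    and "compact E" and "compact F" and "E \<inter> F = {}"
    and "num_range A \<subseteq> E" and "num_range (- B) \<subseteq> F"
    and "X \<in> carrier_mat n m" and "A * X + X * B = D"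
    and "h \<ge> 1"
  shows "sigma (1 + k * h) X \<le>
    (if normal_mat A \<and> normal_mat B then 1 else (1 + sqrt 2)^2) * zolotarev h E F * spec_norm X"
proof -
  note A = assms(1) and B = assms(2) and D = assms(3) and X = assms(10)
  define C where "C = - B"
  have C: "C \<in> carrier_mat m m" using B by (simp add: C_def)
  have WC: "num_range C \<subseteq> F" using assms(9) by (simp add: C_def)
  have eq: "A * X - X * C = D"
  proof -
    have "X * C = - (X * B)" unfolding C_def using X B by simp
    then show ?thesis using assms(11) A B X
      by (intro eq_matI) (auto simp flip: assms(11))
  qed
  \<comment> \<open>The general bound asks for control on the closed numerical ranges; these stay
    within \<open>E\<close> and \<open>F\<close>, which are closed.\<close>
  have clA: "closure (num_range A) \<subseteq> E" and clC: "closure (num_range C) \<subseteq> F"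
    by (rule closure_minimal[OF assms(8) compact_imp_closed[OF assms(5)]],
        rule closure_minimal[OF WC compact_imp_closed[OF assms(6)]])
  define K :: real where "K = (if normal_mat A \<and> normal_mat B then 1 else (1 + sqrt 2)^2)"
  have "0 < 1 + sqrt 2" by (rule add_pos_nonneg) auto
  then have K: "0 < K" by (simp add: K_def)
  define Z where "Z = {(SUP z\<in>E. cmod (poly p z / poly q z)) * (SUP z\<in>F. cmod (poly q z / poly p z))
      | p q :: complex poly. p \<noteq> 0 \<and> q \<noteq> 0 \<and> degree p \<le> h \<and> degree q \<le> h \<and>
          (\<forall>z\<in>E. poly q z \<noteq> 0) \<and> (\<forall>z\<in>F. poly p z \<noteq> 0)}"
  have zol: "zolotarev h E F = Inf Z" by (simp add: zolotarev_def Z_def)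
  have "1 \<noteq> (0 :: complex poly)" by simp
  then have Z_ne: "Z \<noteq> {}"
    unfolding Z_def by (auto intro!: exI[of _ "1 :: complex poly"])
  show ?thesis
  \<comment> \<open>In this case \<open>E\<close> or \<open>F\<close> may be empty and the suprema
    carry no information, but \<open>X\<close> acts as zero and \<open>spec_norm X\<close> is
    0.\<close>
  proof (cases "n = 0 \<or> m = 0")
    case True
    have X0: "vnorm (X *\<^sub>v v) = 0" if v: "v \<in> carrier_vec m" for v
    proof -
      have "X *\<^sub>v v = 0\<^sub>v n" using True X v by (intro eq_vecI) (auto simp: scalar_prod_def)
      then show ?thesis using vnorm_eq_0_iff[of "0\<^sub>v n" n] by simp
    qed
    have "sigma (1 + k * h) X \<le> 0"
      by (rule sigma_le_constrained[OF X, of _ "[]"]) (auto simp: X0)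
    moreover have "spec_norm X = 0"
    proof -
      have S: "insert 0 {vnorm (X *\<^sub>v v) |v. v \<in> carrier_vec (dim_col X) \<and> vnorm v = 1} = {0}"
        using X0 X by auto
      show ?thesis unfolding spec_norm_def S by simp
    qed
    ultimately show ?thesis by (simp only: mult_zero_right)
  next
    case False
    have E_ne: "E \<noteq> {}" using num_range_nonempty[OF A] False assms(8) by auto
    have F_ne: "F \<noteq> {}" using num_range_nonempty[OF C] False WC by auto
    have sup: "cmod (poly p z) \<le> (SUP z\<in>G. cmod (poly p z / poly q z)) * cmod (poly q z)"
      "0 \<le> (SUP z\<in>G. cmod (poly p z / poly q z))"
      if G: "compact G" "\<forall>z\<in>G. poly q z \<noteq> 0" "z \<in> G" for p q G z
    proof -
      have "compact ((\<lambda>z. cmod (poly p z / poly q z)) ` G)"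
        using G by (intro compact_continuous_image continuous_intros) auto
      then have "bdd_above ((\<lambda>z. cmod (poly p z / poly q z)) ` G)"
        by (intro bounded_imp_bdd_above compact_imp_bounded)
      then have le: "cmod (poly p z / poly q z) \<le> (SUP z\<in>G. cmod (poly p z / poly q z))"
        using G(3) by (intro cSUP_upper)
      show "0 \<le> (SUP z\<in>G. cmod (poly p z / poly q z))" by (rule order_trans[OF _ le]) simp
      show "cmod (poly p z) \<le> (SUP z\<in>G. cmod (poly p z / poly q z)) * cmod (poly q z)"
        using le G(2,3) by (simp add: norm_divide pos_divide_le_eq)
    qed
    have main: "sigma (1 + k * h) X \<le> K * (a * b) * spec_norm X"
      if a: "a = (SUP z\<in>E. cmod (poly p z / poly q z))" and b: "b = (SUP z\<in>F. cmod (poly q z / poly p z))"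
        and deg: "degree p \<le> h" "degree q \<le> h" and q0: "\<forall>z\<in>E. poly q z \<noteq> 0" and p0: "\<forall>z\<in>F. poly p z \<noteq> 0"
      for p q a b
    proof -
      have a_le: "cmod (poly p z) \<le> a * cmod (poly q z)" if "z \<in> E" for z
        unfolding a by (rule sup[OF assms(5) q0 that])
      have b_le: "cmod (poly q z) \<le> b * cmod (poly p z)" if "z \<in> F" for z
        unfolding b by (rule sup[OF assms(6) p0 that])
      obtain z\<^sub>1 z\<^sub>2 where z\<^sub>1: "z\<^sub>1 \<in> E" and z\<^sub>2: "z\<^sub>2 \<in> F" using E_ne F_ne by blast
      have a0: "0 \<le> a" unfolding a by (rule sup(2)[OF assms(5) q0 z\<^sub>1])
      have b0: "0 \<le> b" unfolding b by (rule sup(2)[OF assms(6) p0 z\<^sub>2])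
      \<comment> \<open>Invertibility of p(C) follows from the general bound for the pair 1 and p,
        since p has no zero on \<open>F\<close>: the norm of \<open>y\<close> is at most a constant
        times that of p(C) y.\<close>
      have inj: "y = 0\<^sub>v m" if y: "y \<in> carrier_vec m" and py: "mpoly p C *\<^sub>v y = 0\<^sub>v m" for y
      proof -
        define c where "c = (SUP z\<in>F. cmod (poly 1 z / poly p z))"
        have "vnorm (mpoly 1 C *\<^sub>v y) \<le> (1 + sqrt 2) * c * vnorm (mpoly p C *\<^sub>v y)"
        proof (rule crouzeix_palencia[OF C y])
          show "0 \<le> c" unfolding c_def by (rule sup(2)[OF assms(6) p0 z\<^sub>2])
          show "poly p z \<noteq> 0 \<and> cmod (poly 1 z) \<le> c * cmod (poly p z)" if "z \<in> closure (num_range C)" for z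
            using that clC p0 sup(1)[OF assms(6) p0, of z 1] unfolding c_def by blast
        qed
        then have "vnorm y \<le> 0"
          using py vnorm_eq_0_iff[of "0\<^sub>v m" m] y by (simp add: mpoly_1[OF C])
        then show ?thesis using vnorm_nonneg[of y] vnorm_eq_0_iff[OF y] by linarith
      qed
      show ?thesis
      proof (cases "normal_mat A \<and> normal_mat B")
        case True
        have neg: "(- B1) * (- B2) = B1 * B2" if "B1 \<in> carrier_mat m m" "B2 \<in> carrier_mat m m" for B1 B2 :: "complex mat"
          using that by (intro eq_matI) (auto simp: scalar_prod_def)
        have "mat_adjoint C = - mat_adjoint B"
          using B unfolding C_def by (intro eq_matI) auto
        then have NC: "normal_mat C"
          using True neg[OF B mat_adjoint_carrier[OF B]] neg[OF mat_adjoint_carrier[OF B] B]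
          unfolding normal_mat_def C_def by simp
        have "sigma (1 + k * h) X \<le> a * b * spec_norm X"
        proof (rule sigma_sylvester_bound[OF A C X D eq assms(4) deg a0 b0 _ _ inj])
          show "vnorm (mpoly p A *\<^sub>v x) \<le> a * vnorm (mpoly q A *\<^sub>v x)" if "x \<in> carrier_vec n" for x
            using True a_le assms(8) by (intro normal_poly_bound[OF A _ that a0]) blast+
          show "vnorm (mpoly q C *\<^sub>v y) \<le> b * vnorm (mpoly p C *\<^sub>v y)" if "y \<in> carrier_vec m" for y
            using b_le WC by (intro normal_poly_bound[OF C NC that b0]) blast
        qed
        then show ?thesis using True by (simp add: K_def)
      next
        case False
        let ?s = "1 + sqrt 2"
        have s0: "0 \<le> ?s" by (simp add: add_nonneg_nonneg)
        have "sigma (1 + k * h) X \<le> (?s * a) * (?s * b) * spec_norm X"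
        proof (rule sigma_sylvester_bound[OF A C X D eq assms(4) deg _ _ _ _ inj])
          show "vnorm (mpoly p A *\<^sub>v x) \<le> ?s * a * vnorm (mpoly q A *\<^sub>v x)" if "x \<in> carrier_vec n" for x
            using a_le q0 clA by (intro crouzeix_palencia[OF A that a0]) auto
          show "vnorm (mpoly q C *\<^sub>v y) \<le> ?s * b * vnorm (mpoly p C *\<^sub>v y)" if "y \<in> carrier_vec m" for y
            using b_le p0 clC by (intro crouzeix_palencia[OF C that b0]) auto
        qed (use a0 b0 s0 in auto)
        also have "(?s * a) * (?s * b) * spec_norm X = K * (a * b) * spec_norm X"
          unfolding K_def if_not_P[OF False] by (simp add: power2_eq_square)
        finally show ?thesis .
      qed
    qed
    have le: "sigma (1 + k * h) X \<le> K * r * spec_norm X" if r: "r \<in> Z" for r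
    proof -
      obtain p q where pq: "r = (SUP z\<in>E. cmod (poly p z / poly q z)) * (SUP z\<in>F. cmod (poly q z / poly p z))"
        "degree p \<le> h" "degree q \<le> h" "\<forall>z\<in>E. poly q z \<noteq> 0" "\<forall>z\<in>F. poly p z \<noteq> 0"
        using r unfolding Z_def mem_Collect_eq by (elim exE conjE)
      show ?thesis unfolding pq(1) by (rule main[OF refl refl pq(2-5)])
    qed
    \<comment> \<open>The estimate holds for every competitor and passes to the infimum after
      division by \<open>K * spec_norm X\<close>; a vanishing norm is therefore treated
      apart.\<close>
    have "sigma (1 + k * h) X \<le> K * Inf Z * spec_norm X"
    proof (cases "spec_norm X = 0")
      case True
      then show ?thesis using le Z_ne by auto
    next
      case False
      then have pos: "0 < K * spec_norm X" using K spec_norm_nonneg[of X] by simp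
      have "sigma (1 + k * h) X / (K * spec_norm X) \<le> Inf Z"
      proof (rule cInf_greatest[OF Z_ne])
        fix r assume "r \<in> Z"
        from le[OF this] show "sigma (1 + k * h) X / (K * spec_norm X) \<le> r"
          using pos by (simp add: pos_divide_le_eq mult_ac)
      qed
      then show ?thesis using pos by (simp add: pos_divide_le_eq mult_ac)
    qed
    then show ?thesis unfolding zol K_def .
  qed
qed

end
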